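(* Let $1<p<N$, let $\Omega\subset\mathbb{R}^N$ be a bounded, strictly convex, open set with $C^2$ boundary and $0\in\overline{\Omega}$, and let $f:\overline{\Omega}\times\mathbb{R}\to\mathbb{R}$ be a Carathéodory function. Assume: (H0)' $|f(x,s)|\le |x|^{-\mu}\,\tilde f(s)$, where $\mu\in(0,p)$, and $\tilde f:\mathbb{R}\to[0,+\infty)$ is continuous, satisfies $\tilde f(s)>0$ for $|s|>s_0$ (for some $s_0\ge 0$), and $$\lim_{|s|\to\infty}\frac{\tilde f(s)}{|s|^{p^*_\mu-1}}=0;$$ (H1) there is a constant $c_0>0$ such that $$\limsup_{s\to+\infty}\frac{\max_{[-s,s]}\tilde f}{\max\{\tilde f(-s),\tilde f(s)\}}\le c_0 .$$ Define $$h(s):=\frac{|s|^{p^*_\mu-1}}{\max\{\tilde f(-s),\tilde f(s)\}}\quad\text{for }|s|>s_0,\qquad B:=\begin{cases}\dfrac{p^*_\mu-1}{p^*_{N/p}},&\text{if }\mu\in(0,1),\\[4pt] 1,&\text{if }\mu\in[1,p).\end{cases}$$ Then there exists a constant $C_0>0$, independent of the solution, such that for every weak solution $u\in W_0^{1,p}(\Omega)$ of $-\Delta_p u=f(x,u)$ in $\Omega$, $u=0$ on $\partial\Omega$, at least one of the following holds: (i) $\|u\|_\infty\le C_0$; (ii) $s_0<\|u\|_\infty<\infty$ and for every $\varepsilon>0$ there exists a constant $C>0$ such that $$h\big(\|u\|_\infty\big)\le C\,\big(1+\|u\|_{p^*}\big)^{(p^*_\mu-p)(B+\varepsilon)},$$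 where $C$ depends only on $\varepsilon$, $c_0$, $\mu$, $N$ and $\Omega$ (and on the fixed exponent $p$), and is independent of the solution $u$.
   Context: $\Delta_p u=\operatorname{div}(|\nabla u|^{p-2}\nabla u)$ is the $p$-Laplacian. $p^*=\frac{Np}{N-p}$ is the critical Sobolev exponent, and $(p^* )'=\frac{p^*}{p^*-1}$. For $\mu\in[0,p]$, $p^*_\mu:=\frac{p(N-\mu)}{N-p}$ is the critical Hardy–Sobolev exponent. Moreover $p^*_{N/p}:=p^*\left(1-\frac1p\right)=\frac{N(p-1)}{N-p}$. $\|\cdot\|_q$ denotes the norm of $L^q(\Omega)$. $f$ is Carathéodory: $f(\cdot,s)$ is measurable for all $s\in\mathbb{R}$ and $f(x,\cdot)$ is continuous for almost all $x\in\Omega$. A weak solution is $u\in W_0^{1,p}(\Omega)$ such that $f(\cdot,u)\in L^{(p^* )'}(\Omega)$ and $\int_\Omega|\nabla u|^{p-2}\nabla u\cdot\nabla\varphi\,dx=\int_\Omega f(x,u)\varphi\,dx$ for all $\varphi\in W_0^{1,p}(\Omega)$. *)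

theory Defs
  imports "HOL-Analysis.Analysis" "HOL-Probability.Essential_Supremum"
begin

fun Ck :: "nat \<Rightarrow> ('a::euclidean_space \<Rightarrow> real) \<Rightarrow> bool" where
  "Ck 0 g \<longleftrightarrow> continuous_on UNIV g"
| "Ck (Suc k) g \<longleftrightarrow> (\<forall>x. g differentiable (at x)) \<and>
     (\<forall>b\<in>Basis. Ck k (\<lambda>x. frechet_derivative g (at x) b))"

definition grad :: "('a::euclidean_space \<Rightarrow> real) \<Rightarrow> 'a \<Rightarrow> 'a" where
  "grad g x = (\<Sum>b\<in>Basis. frechet_derivative g (at x) b *\<^sub>R b)"

text \<open>Near each boundary point the set is the part above the graph of a \<open>C\<^sup>2\<close> function over
  the hyperplane orthogonal to \<open>e\<close>. The vector \<open>x - (x \<bullet> e) *\<^sub>R e\<close> is the projection of \<open>x\<close> to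
  that hyperplane, so only the values of \<open>\<gamma>\<close> on the hyperplane matter.\<close>

definition has_C2_boundary :: "'a::euclidean_space set \<Rightarrow> bool" where
  "has_C2_boundary \<Omega> \<longleftrightarrow> (\<forall>x0\<in>frontier \<Omega>. \<exists>r>0. \<exists>e \<gamma>. norm e = 1 \<and> Ck 2 \<gamma> \<and>
     \<Omega> \<inter> ball x0 r = {x \<in> ball x0 r. x \<bullet> e > \<gamma> (x - (x \<bullet> e) *\<^sub>R e)})"

definition strictly_convex :: "'a::euclidean_space set \<Rightarrow> bool" where
  "strictly_convex S \<longleftrightarrow>
     (\<forall>x\<in>closure S. \<forall>y\<in>closure S. x \<noteq> y \<longrightarrow> open_segment x y \<subseteq> interior S)"

definition Lp :: "'a::euclidean_space set \<Rightarrow> real \<Rightarrow> ('a \<Rightarrow> 'b::euclidean_space) set" where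
  "Lp \<Omega> q = {g. g \<in> borel_measurable (lebesgue_on \<Omega>) \<and>
                 integrable (lebesgue_on \<Omega>) (\<lambda>x. norm (g x) powr q)}"

text \<open>Meaningful for members of \<open>Lp \<Omega> q\<close> only (a divergent integral has the value 0).\<close>

definition Lp_norm :: "'a::euclidean_space set \<Rightarrow> real \<Rightarrow> ('a \<Rightarrow> 'b::euclidean_space) \<Rightarrow> real" where
  "Lp_norm \<Omega> q g = (LINT x|lebesgue_on \<Omega>. norm (g x) powr q) powr (1 / q)"

definition Linf_norm :: "'a::euclidean_space set \<Rightarrow> ('a \<Rightarrow> real) \<Rightarrow> ereal" where
  "Linf_norm \<Omega> g = esssup (lebesgue_on \<Omega>) (\<lambda>x. ereal \<bar>g x\<bar>)"

definition test_functions :: "'a::euclidean_space set \<Rightarrow> ('a \<Rightarrow> real) set" where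
  "test_functions \<Omega> = {\<phi>. (\<forall>k. Ck k \<phi>) \<and> compact (closure (support_on UNIV \<phi>)) \<and>
                           closure (support_on UNIV \<phi>) \<subseteq> \<Omega>}"

definition is_weak_grad :: "'a::euclidean_space set \<Rightarrow> ('a \<Rightarrow> real) \<Rightarrow> ('a \<Rightarrow> 'a) \<Rightarrow> bool" where
  "is_weak_grad \<Omega> u G \<longleftrightarrow>
     (\<forall>K. compact K \<and> K \<subseteq> \<Omega> \<longrightarrow> integrable (lebesgue_on K) u \<and> integrable (lebesgue_on K) G) \<and>
     (\<forall>\<phi>\<in>test_functions \<Omega>. \<forall>b\<in>Basis.
        (LINT x|lebesgue_on \<Omega>. u x * (grad \<phi> x \<bullet> b)) = - (LINT x|lebesgue_on \<Omega>. (G x \<bullet> b) * \<phi> x))"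

text \<open>The weak gradient is unique up to a null set, so the choice is immaterial below.\<close>

definition weak_grad :: "'a::euclidean_space set \<Rightarrow> ('a \<Rightarrow> real) \<Rightarrow> 'a \<Rightarrow> 'a" where
  "weak_grad \<Omega> u = (SOME G. is_weak_grad \<Omega> u G)"

definition W1 :: "'a::euclidean_space set \<Rightarrow> real \<Rightarrow> ('a \<Rightarrow> real) set" where
  "W1 \<Omega> p = {u \<in> Lp \<Omega> p. \<exists>G \<in> Lp \<Omega> p. is_weak_grad \<Omega> u G}"

definition W10 :: "'a::euclidean_space set \<Rightarrow> real \<Rightarrow> ('a \<Rightarrow> real) set" where
  "W10 \<Omega> p = {u \<in> W1 \<Omega> p. \<forall>\<epsilon>>0. \<exists>\<phi>\<in>test_functions \<Omega>.
      Lp_norm \<Omega> p (\<lambda>x. u x - \<phi> x) + Lp_norm \<Omega> p (\<lambda>x. weak_grad \<Omega> u x - grad \<phi> x) < \<epsilon>}"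

definition sobolev_exp :: "real \<Rightarrow> real \<Rightarrow> real" where
  "sobolev_exp N p = N * p / (N - p)"

definition conj_exp :: "real \<Rightarrow> real" where
  "conj_exp q = q / (q - 1)"

definition hardy_sobolev_exp :: "real \<Rightarrow> real \<Rightarrow> real \<Rightarrow> real" where
  "hardy_sobolev_exp N p \<mu> = p * (N - \<mu>) / (N - p)"

text \<open>The denominator is \<open>p\<^sup>*\<^sub>N\<^sub>/\<^sub>p = p\<^sup>* (1 - 1/p)\<close>.\<close>

definition B_exp :: "real \<Rightarrow> real \<Rightarrow> real \<Rightarrow> real" where
  "B_exp N p \<mu> =
     (if \<mu> < 1 then (hardy_sobolev_exp N p \<mu> - 1) / (sobolev_exp N p * (1 - 1 / p)) else 1)"

definition caratheodory :: "'a::euclidean_space set \<Rightarrow> ('a \<Rightarrow> real \<Rightarrow> real) \<Rightarrow> bool" where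
  "caratheodory \<Omega> f \<longleftrightarrow>
     (\<forall>s. (\<lambda>x. f x s) \<in> borel_measurable (lebesgue_on (closure \<Omega>))) \<and>
     (AE x in lebesgue_on \<Omega>. continuous_on UNIV (f x))"

definition h_fun :: "real \<Rightarrow> real \<Rightarrow> real \<Rightarrow> (real \<Rightarrow> real) \<Rightarrow> real \<Rightarrow> real" where
  "h_fun N p \<mu> ft s = \<bar>s\<bar> powr (hardy_sobolev_exp N p \<mu> - 1) / max (ft (- s)) (ft s)"

text \<open>Where the gradient vanishes, \<open>0 powr (p - 2) = 0\<close>, so that the field
  \<open>|\<nabla>u|\<^sup>p\<^sup>-\<^sup>2 \<nabla>u\<close> is 0 there, also for \<open>p < 2\<close>.\<close>

definition weak_solution ::
    "'a::euclidean_space set \<Rightarrow> real \<Rightarrow> ('a \<Rightarrow> real \<Rightarrow> real) \<Rightarrow> ('a \<Rightarrow> real) \<Rightarrow> bool" where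
  "weak_solution \<Omega> p f u \<longleftrightarrow>
     u \<in> W10 \<Omega> p \<and>
     (\<lambda>x. f x (u x)) \<in> Lp \<Omega> (conj_exp (sobolev_exp (real DIM('a)) p)) \<and>
     (\<forall>\<phi>\<in>W10 \<Omega> p.
        (LINT x|lebesgue_on \<Omega>.
           norm (weak_grad \<Omega> u x) powr (p - 2) * (weak_grad \<Omega> u x \<bullet> weak_grad \<Omega> \<phi> x)) =
        (LINT x|lebesgue_on \<Omega>. f x (u x) * \<phi> x))"

end

theory Submission
  imports Defs
begin

text \<open>
  The proof avoids regularity theory and works with the distribution function
  \<open>\<Phi>(k) = |{|u| > k}|\<close> alone. Testing the equation with a smooth truncation of \<open>u\<close> between the
  levels \<open>k\<close> and \<open>k + d\<close>, and applying the weak-type \<open>W\<^sup>1\<^sup>,\<^sup>1\<close> Sobolev inequality to it, gives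
  \<open>d \<Phi>(k + d)\<^bsup>1-1/N\<^esup> \<le> C (d \<integral>\<^bsub>{|u|>k}\<^esub> |f(x,u)|)\<^bsup>1/p\<^esup> \<Phi>(k)\<^bsup>1-1/p\<^esup>\<close>, while
  \<open>\<integral>\<^bsub>A\<^esub> |x|\<^bsup>-\<mu>\<^esup> \<le> C |A|\<^bsup>1-\<mu>/N\<^esup>\<close> for every set \<open>A\<close>. The subcritical growth of \<open>f\<close> turns
  this into arbitrarily fast polynomial decay of \<open>\<Phi>\<close>, and then, by Stampacchia's iteration, into
  boundedness of \<open>u\<close>. Once \<open>M = \<parallel>u\<parallel>\<^sub>\<infinity>\<close> is finite, \<open>|f(x,u)| \<le> K |x|\<^bsup>-\<mu>\<^esup>\<close> with
  \<open>K = max\<^bsub>[-M,M]\<^esub> f\<^sup>~\<close>, and the same iteration started at the level \<open>M/2\<close>, where Chebyshev's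
  inequality controls \<open>\<Phi>\<close> by the \<open>L\<^sup>p\<^sup>*\<close> norm, yields the scale-invariant bound
  \<open>M\<^bsup>q-1\<^esup> \<le> C K \<parallel>u\<parallel>\<^bsup>q-p\<^esup>\<close> with \<open>q = p\<^sup>*\<^sub>\<mu>\<close>. This is stronger than required since \<open>B \<ge> 1\<close>.
\<close>

section \<open>Smooth real functions\<close>

text \<open>The constant in (ii) is fixed before \<open>f\<close>, \<open>ft\<close> and
  \<open>s0\<close>, while the argument for boundedness yields constants that involve the energy of
  the individual solution. The two matters are therefore separated: boundedness is shown only
  qualitatively, and the quantitative estimate afterwards uses constants that come from the domain
  and the exponents alone. \<open>W10\<close> consists of limits of test functions, so composition
  with a truncation should map test functions to test functions. For this reason a smooth step
  function with bounded slope is built from scratch, and levels are compared across a gap d. The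
  weak-type inequality suffices because only measures of level sets enter the iteration. It is
  obtained from a regularised Riesz kernel applied to a cutoff that is at least 1 on the level set.
  At critical growth a weak L^{p^*} bound merely reproduces itself under the recursion. The limit 0
  in (H0)' supplies a small factor, which turns this borderline balance into a gain at every
  doubling of the level.\<close>

lemma Ck_SucI:
  assumes "\<And>x. (g has_derivative g' x) (at x)" "\<And>b. b \<in> Basis \<Longrightarrow> Ck k (\<lambda>x. g' x b)"
  shows "Ck (Suc k) g"
proof -
  have "frechet_derivative g (at x) = g' x" for x
    using frechet_derivative_at[OF assms(1)] by simp
  then show ?thesis using assms by (auto simp: differentiable_def)
qed

lemma Ck_SucD:
  assumes "Ck (Suc k) g"
  shows "(g has_derivative frechet_derivative g (at x)) (at x)"
    and "b \<in> Basis \<Longrightarrow> Ck k (\<lambda>x. frechet_derivative g (at x) b)"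
  using assms by (auto simp: frechet_derivative_works)

lemma Ck_Suc_imp: "Ck (Suc k) g \<Longrightarrow> Ck k g"
proof (induction k arbitrary: g)
  case 0
  then show ?case
    by (auto simp: continuous_on_eq_continuous_at differentiable_imp_continuous_within)
next
  case (Suc k)
  then show ?case by (meson Ck.simps(2))
qed

lemma Ck_const: "Ck k (\<lambda>x. c)"
proof (induction k arbitrary: c)
  case (Suc k)
  show ?case by (rule Ck_SucI[where g' = "\<lambda>x v. 0"]) (auto intro: Suc)
qed auto

lemma Ck_add: "Ck k g \<Longrightarrow> Ck k h \<Longrightarrow> Ck k (\<lambda>x. g x + h x)"
proof (induction k arbitrary: g h)
  case 0 then show ?case by (auto intro: continuous_intros)
next
  case (Suc k)
  show ?case
    by (rule Ck_SucI[where g' = "\<lambda>x v. frechet_derivative g (at x) v + frechet_derivative h (at x) v"])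
      (rule has_derivative_add Suc.IH Ck_SucD[OF Suc.prems(1)] Ck_SucD[OF Suc.prems(2)] | assumption)+
qed

lemma Ck_mult: "Ck k g \<Longrightarrow> Ck k h \<Longrightarrow> Ck k (\<lambda>x. g x * h x)"
proof (induction k arbitrary: g h)
  case 0 then show ?case by (auto intro: continuous_intros)
next
  case (Suc k)
  show ?case
    by (rule Ck_SucI[where g' = "\<lambda>x v. g x * frechet_derivative h (at x) v + frechet_derivative g (at x) v * h x"])
      (rule has_derivative_mult Ck_add Suc.IH Ck_SucD[OF Suc.prems(1)] Ck_SucD[OF Suc.prems(2)]
         Ck_Suc_imp[OF Suc.prems(1)] Ck_Suc_imp[OF Suc.prems(2)] | assumption)+
qed

lemma Ck_prod: "finite A \<Longrightarrow> (\<And>a. a \<in> A \<Longrightarrow> Ck k (g a)) \<Longrightarrow> Ck k (\<lambda>x. \<Prod>a\<in>A. g a x)"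
  by (induction rule: finite_induct) (auto intro: Ck_const Ck_mult)

lemma Ck_linear: assumes "bounded_linear g" shows "Ck k g"
proof (cases k)
  case 0 then show ?thesis by (simp add: assms linear_continuous_on)
next
  case (Suc j)
  show ?thesis unfolding Suc
    by (rule Ck_SucI[where g' = "\<lambda>x. g"]) (rule bounded_linear_imp_has_derivative assms Ck_const)+
qed

text \<open>The derivative of a function of one real variable is multiplication by a scalar. The
  chain rule then yields a product of scalar functions, and the induction closes with
  \<open>Ck_mult\<close>.\<close>

lemma Ck_compose:
  fixes F :: "real \<Rightarrow> real"
  shows "Ck k F \<Longrightarrow> Ck k g \<Longrightarrow> Ck k (\<lambda>x. F (g x))"
proof (induction k arbitrary: F g)
  case 0 then show ?case by (auto intro: continuous_on_compose2)
next
  case (Suc k)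
  let ?F' = "\<lambda>y. frechet_derivative F (at y) 1"
  have F: "(F has_derivative (\<lambda>v. v * ?F' y)) (at y)" for y
  proof -
    have *: "(F has_derivative frechet_derivative F (at y)) (at y)"
      using Ck_SucD(1)[OF Suc.prems(1)] .
    have "frechet_derivative F (at y) v = v * ?F' y" for v
      using linear_scale[OF has_derivative_linear[OF *], of v 1] by simp
    then have "frechet_derivative F (at y) = (\<lambda>v. v * ?F' y)" by (rule ext)
    then show ?thesis by (rule subst[where P = "\<lambda>D. (F has_derivative D) (at y)"]) (rule *)
  qed
  have "Ck k ?F'" using Ck_SucD(2)[OF Suc.prems(1), of 1] by simp
  then show ?case
    by (intro Ck_SucI[where g' = "\<lambda>x v. frechet_derivative g (at x) v * ?F' (g x)"])
      (rule has_derivative_compose[OF _ F] Ck_mult Suc.IH Ck_Suc_imp[OF Suc.prems(2)] Ck_SucD[OF Suc.prems(2)]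
        | assumption)+
qed

lemma Ck_real_SucI:
  fixes F :: "real \<Rightarrow> real"
  assumes "\<And>x. (F has_real_derivative F' x) (at x)" "Ck k F'"
  shows "Ck (Suc k) F"
  by (rule Ck_SucI[where g' = "\<lambda>x v. F' x * v"])
    (use assms in \<open>auto simp: has_field_derivative_def\<close>)

lemma Ck_real_affine: "Ck k (\<lambda>x::real. a * x + b)"
  by (intro Ck_add Ck_const Ck_linear bounded_linear_mult_right)

text \<open>The derivatives of exp (-1/x) on the positive axis all have the form P(1/x) exp (-1/x)
  with a polynomial P. The family over all P is closed under differentiation, so a single derivative
  formula gives smoothness of every order.\<close>

definition flat_exp :: "real poly \<Rightarrow> real \<Rightarrow> real" where
  "flat_exp P x = (if x > 0 then poly P (1 / x) * exp (- (1 / x)) else 0)"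

text \<open>The substitution y = 1/x moves the limit from the right to infinity, where the
  exponential beats every power of y.\<close>

lemma flat_exp_limit: "((\<lambda>x. flat_exp P x) \<longlongrightarrow> 0) (at 0)"
proof (rule filterlim_split_at)
  show "(flat_exp P \<longlongrightarrow> 0) (at_left 0)"
    by (rule tendsto_eventually) (auto simp: flat_exp_def eventually_at_filter)
  have "((\<lambda>x. poly P x / exp x) \<longlongrightarrow> 0) at_top"
  proof -
    have "((\<lambda>x. \<Sum>i\<le>degree P. coeff P i * (x ^ i / exp x)) \<longlongrightarrow> (\<Sum>i\<le>degree P. coeff P i * 0)) at_top"
      by (intro tendsto_sum tendsto_mult tendsto_const tendsto_power_div_exp_0)
    then show ?thesis by (simp add: poly_altdef sum_divide_distrib)
  qed
  then have "((\<lambda>x. poly P (inverse x) / exp (inverse x)) \<longlongrightarrow> 0) (at_right (0::real))"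
    by (rule filterlim_compose[OF _ filterlim_inverse_at_top_right])
  then show "(flat_exp P \<longlongrightarrow> 0) (at_right 0)"
    by (rule Lim_transform_eventually)
      (auto simp: flat_exp_def eventually_at_filter field_simps exp_minus)
qed

text \<open>Differentiating P(1/x) exp (-1/x) brings out x^{-2} (P - P')(1/x), which is the value of
  \<open>monom 1 2 * (P - pderiv P)\<close> at 1/x.\<close>

lemma flat_exp_deriv:
  "(flat_exp P has_real_derivative flat_exp (monom 1 2 * (P - pderiv P)) x) (at x)"
proof -
  consider "x > 0" | "x < 0" | "x = 0" by linarith
  then show ?thesis
  proof cases
    case 1
    have "((\<lambda>x. poly P (1 / x) * exp (- (1 / x))) has_real_derivative
        flat_exp (monom 1 2 * (P - pderiv P)) x) (at x)"
      using 1 by (auto intro!: derivative_eq_intros DERIV_chain2[OF poly_DERIV]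
          simp: flat_exp_def poly_monom field_simps power2_eq_square)
    then show ?thesis
      by (rule has_field_derivative_transform_within_open[where S = "{0<..}"])
        (use 1 in \<open>auto simp: flat_exp_def\<close>)
  next
    case 2
    have "((\<lambda>x. 0) has_real_derivative flat_exp (monom 1 2 * (P - pderiv P)) x) (at x)"
      using 2 by (auto simp: flat_exp_def)
    then show ?thesis
      by (rule has_field_derivative_transform_within_open[where S = "{..<0}"])
        (use 2 in \<open>auto simp: flat_exp_def\<close>)
  next
    case 3
    \<comment> \<open>At 0 the difference quotient is again a member of the family, namely that of
      \<open>monom 1 1 * P\<close>, so its limit is already known.\<close>
    have "((\<lambda>h. flat_exp P h / h) \<longlongrightarrow> 0) (at 0)"
      by (rule Lim_transform_eventually[OF flat_exp_limit[of "monom 1 1 * P"]])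
        (auto simp: flat_exp_def poly_monom)
    then show ?thesis using 3 by (simp add: has_field_derivative_iff flat_exp_def)
  qed
qed

lemma Ck_flat_exp: "Ck k (flat_exp P)"
proof (induction k arbitrary: P)
  case 0
  show ?case using DERIV_isCont[OF flat_exp_deriv] by (simp add: continuous_on_eq_continuous_at)
next
  case (Suc k)
  show ?case by (rule Ck_real_SucI[OF flat_exp_deriv Suc])
qed

section \<open>A bump profile and a monotone smooth step\<close>

definition bump :: "real \<Rightarrow> real" where "bump x = (if x > 0 then exp (- (1 / x)) else 0)"

lemma Ck_bump: "Ck k bump"
  using Ck_flat_exp[of k 1] by (simp add: flat_exp_def[abs_def] bump_def[abs_def] cong: if_cong)

lemma bump_mono: "mono bump"
  by (auto simp: mono_def bump_def frac_le)

lemma bump_nonneg: "0 \<le> bump x" and bump_le_1: "bump x \<le> 1"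
  by (auto simp: bump_def)

text \<open>The outer \<open>bump\<close> cuts the inner difference at 0: for x <= 0 that difference
  is at most 0, and for x >= 1 it is the constant \<open>bump 1\<close>. Nesting monotone functions
  gives monotonicity at once, and smoothness needs composition only, with no quotient of
  functions.\<close>

definition smooth_step :: "real \<Rightarrow> real" where
  "smooth_step x = bump (bump 1 - bump (1 - x)) / bump (bump 1)"

lemma bump_pos: "x > 0 \<Longrightarrow> bump x > 0" by (simp add: bump_def)

lemma smooth_step_0: "x \<le> 0 \<Longrightarrow> smooth_step x = 0"
  using monoD[OF bump_mono, of 1 "1 - x"] by (simp add: smooth_step_def bump_def)

lemma smooth_step_1: "x \<ge> 1 \<Longrightarrow> smooth_step x = 1"
  using bump_pos[OF bump_pos, of 1] by (simp add: smooth_step_def bump_def[of "1 - x"])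

lemma smooth_step_mono: "mono smooth_step"
  unfolding mono_def smooth_step_def
  by (intro allI impI divide_right_mono monoD[OF bump_mono] diff_left_mono bump_nonneg) auto

lemma smooth_step_nonneg: "0 \<le> smooth_step x" and smooth_step_le_1: "smooth_step x \<le> 1"
proof -
  have "smooth_step (min x 0) \<le> smooth_step x" "smooth_step x \<le> smooth_step (max x 1)"
    by (auto intro: monoD[OF smooth_step_mono])
  then show "0 \<le> smooth_step x" "smooth_step x \<le> 1"
    by (auto simp: smooth_step_0 smooth_step_1)
qed

lemma Ck_smooth_step: "Ck k smooth_step"
proof -
  have "Ck k (\<lambda>x. bump (bump 1 + (-1) * bump ((-1) * x + 1)) * (1 / bump (bump 1)))"
    by (intro Ck_mult Ck_add Ck_const Ck_compose[OF Ck_bump] Ck_real_affine)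
  then show ?thesis by (simp add: smooth_step_def[abs_def] algebra_simps)
qed

lemma Ck_real_deriv:
  fixes F :: "real \<Rightarrow> real"
  assumes "Ck 1 F"
  shows "(F has_real_derivative deriv F x) (at x)" "continuous_on UNIV (deriv F)"
proof -
  have 1: "Ck (Suc 0) F" using assms by simp
  have *: "(F has_derivative frechet_derivative F (at y)) (at y)" for y
    using Ck_SucD(1)[OF 1] .
  have "frechet_derivative F (at y) v = v * frechet_derivative F (at y) 1" for v y
    using linear_scale[OF has_derivative_linear[OF *], of y v 1] by simp
  then have **: "(F has_real_derivative frechet_derivative F (at y) 1) (at y)" for y
    using * unfolding has_field_derivative_def by (metis (no_types, lifting) ext mult.commute)
  then have d: "deriv F = (\<lambda>y. frechet_derivative F (at y) 1)"
    by (auto intro: DERIV_imp_deriv)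
  show "(F has_real_derivative deriv F x) (at x)" using ** d by simp
  show "continuous_on UNIV (deriv F)" unfolding d using Ck_SucD(2)[OF 1, of 1] by simp
qed

text \<open>Off the interval from 0 to 1 the step is locally constant, and on this compact interval
  the continuous derivative is bounded.\<close>

lemma smooth_step_deriv_bound: "\<exists>L>0. \<forall>x. 0 \<le> deriv smooth_step x \<and> deriv smooth_step x \<le> L"
proof -
  note D = Ck_real_deriv[OF Ck_smooth_step]
  have nn: "0 \<le> deriv smooth_step x" for x
    using D(1) by (rule mono_on_imp_deriv_nonneg[of UNIV, rotated])
      (use smooth_step_mono in \<open>auto simp: monotone_on_def mono_def\<close>)
  have out: "deriv smooth_step x = 0" if "x < 0 \<or> x > 1" for x
  proof -
    have "((\<lambda>x. if x < 0 then 0 else 1) has_real_derivative 0) (at x)"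
      using that
    proof
      assume "x < 0"
      then show ?thesis
        by (intro has_field_derivative_transform_within_open[OF DERIV_const[of 0], where S = "{..<0}"]) auto
    next
      assume "x > 1"
      then show ?thesis
        by (intro has_field_derivative_transform_within_open[OF DERIV_const[of 1], where S = "{1<..}"]) auto
    qed
    then have "(smooth_step has_real_derivative 0) (at x)"
      by (rule has_field_derivative_transform_within_open[where S = "{..<0} \<union> {1<..}"])
         (use that in \<open>auto simp: smooth_step_0 smooth_step_1\<close>)
    then show ?thesis by (rule DERIV_imp_deriv)
  qed
  have "compact (deriv smooth_step ` {0..1})"
    by (rule compact_continuous_image) (use D(2) continuous_on_subset in auto)
  then have "bounded (deriv smooth_step ` {0..1})" by (rule compact_imp_bounded)
  then obtain L where L: "\<forall>x\<in>{0..1}. \<bar>deriv smooth_step x\<bar> \<le> L"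
    by (auto simp: bounded_iff)
  have "deriv smooth_step x \<le> max L 1" for x
    using bspec[OF L, of x] out[of x] by (cases "x \<in> {0..1}") (auto simp: not_le)
  then show ?thesis using nn by (intro exI[of _ "max L 1"]) auto
qed

section \<open>Integration by parts and Riesz kernels\<close>

lemma has_derivative_0_off_support:
  fixes h :: "'a::real_normed_vector \<Rightarrow> 'b::real_normed_vector"
  assumes "(h has_derivative h') (at x)" "closed K" "\<And>x. x \<notin> K \<Longrightarrow> h x = 0" "x \<notin> K"
  shows "h' v = 0"
proof -
  have "(h has_derivative (\<lambda>v. 0)) (at x)"
    by (rule has_derivative_transform_within_open[where f = "\<lambda>x. 0" and s = "- K"])
      (use assms in \<open>auto simp: open_Compl\<close>)
  then show ?thesis using has_derivative_unique[OF assms(1)] by metis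
qed

lemma integrable_continuous_compact_support:
  fixes f :: "'a::euclidean_space \<Rightarrow> 'b::euclidean_space"
  assumes "continuous_on UNIV f" "compact K" "\<And>x. x \<notin> K \<Longrightarrow> f x = 0"
  shows "integrable lborel f"
proof -
  have "integrable lborel (\<lambda>x. indicator K x *\<^sub>R f x)"
    using borel_integrable_compact[OF assms(2)] assms(1) continuous_on_subset by blast
  moreover have "(\<lambda>x. indicator K x *\<^sub>R f x) = f"
    using assms(3) by (auto simp: indicator_def fun_eq_iff)
  ultimately show ?thesis by simp
qed

lemma bounded_continuous_compact_support:
  fixes f :: "'a::euclidean_space \<Rightarrow> 'b::euclidean_space"
  assumes "continuous_on UNIV f" "compact K" "\<And>x. x \<notin> K \<Longrightarrow> f x = 0"
  obtains B where "B \<ge> 0" "\<And>x. norm (f x) \<le> B"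
proof -
  have "bounded (f ` K)"
    using compact_continuous_image[OF continuous_on_subset[OF assms(1)] assms(2)] compact_imp_bounded by auto
  then obtain B where "\<And>x. x \<in> K \<Longrightarrow> norm (f x) \<le> B"
    by (auto simp: bounded_iff)
  then have "norm (f x) \<le> max B 0" for x
    using assms(3)[of x] by (cases "x \<in> K") (force simp: le_max_iff_disj)+
  then show ?thesis using that[of "max B 0"] by auto
qed

text \<open>Difference quotients of a compactly supported function have integral 0 by translation
  invariance of Lebesgue measure, and dominated convergence carries this over to the
  derivative.\<close>

lemma integral_directional_derivative_eq_0:
  fixes h :: "'a::euclidean_space \<Rightarrow> real"
  assumes h: "\<And>x. (h has_derivative h' x) (at x)" and cont: "continuous_on UNIV (\<lambda>x. h' x b)"
    and K: "compact K" "\<And>x. x \<notin> K \<Longrightarrow> h x = 0"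
  shows "integrable lborel (\<lambda>x. h' x b)" "(LINT x|lborel. h' x b) = 0"
proof -
  have h'0: "h' x b = 0" if "x \<notin> K" for x
    using has_derivative_0_off_support[OF h compact_imp_closed[OF K(1)] K(2) that] by auto
  show "integrable lborel (\<lambda>x. h' x b)"
    by (rule integrable_continuous_compact_support[OF cont K(1) h'0])
  obtain B where B: "B \<ge> 0" "\<And>x. norm (h' x b) \<le> B"
    using bounded_continuous_compact_support[OF cont K(1) h'0] by auto
  have conth: "continuous_on UNIV h"
    using has_derivative_continuous[OF h] by (simp add: continuous_on_eq_continuous_at)
  have inth: "integrable lborel h"
    by (rule integrable_continuous_compact_support[OF conth K])
  define s where "s n = 1 / (real n + 1)" for n
  have s: "0 < s n" "s n \<le> 1" for n by (auto simp: s_def)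
  have s0: "s \<longlonglongrightarrow> 0" unfolding s_def by real_asymp
  define D where "D n x = (h (x + s n *\<^sub>R b) - h x) / s n" for n x
  \<comment> \<open>The steps \<open>s n\<close> are at most 1, so one compact set contains the
    supports of all difference quotients and can carry the dominating function.\<close>
  define K' where "K' = K \<union> (\<lambda>(x, t). x - t *\<^sub>R b) ` (K \<times> {0..1})"
  have "compact K'"
    unfolding K'_def using K
    by (intro compact_Un compact_continuous_image compact_Times) (auto intro!: continuous_intros simp: case_prod_beta)
  have D0: "D n x = 0" if "x \<notin> K'" for n x
  proof -
    have "x + s n *\<^sub>R b \<notin> K"
    proof
      assume "x + s n *\<^sub>R b \<in> K"
      then have "x \<in> (\<lambda>(x, t). x - t *\<^sub>R b) ` (K \<times> {0..1})"
        using s[of n] by (intro image_eqI[of _ _ "(x + s n *\<^sub>R b, s n)"]) (auto intro: less_imp_le)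
      then show False using that by (simp add: K'_def)
    qed
    then show ?thesis using that K(2) by (simp add: D_def K'_def)
  qed
  \<comment> \<open>By the mean value theorem along the segment from x in direction b, each quotient
    is a value of the derivative and inherits its bound.\<close>
  have DB: "norm (D n x) \<le> B" for n x
  proof -
    let ?k = "\<lambda>t. h (x + t *\<^sub>R b)"
    have k: "(?k has_real_derivative h' (x + t *\<^sub>R b) b) (at t)" for t
    proof -
      have "(?k has_derivative (\<lambda>v. h' (x + t *\<^sub>R b) (v *\<^sub>R b))) (at t)"
        by (rule has_derivative_compose[where f = "\<lambda>t. x + t *\<^sub>R b", OF _ h]) (auto intro!: derivative_eq_intros)
      moreover have "(\<lambda>v. h' (x + t *\<^sub>R b) (v *\<^sub>R b)) = (*) (h' (x + t *\<^sub>R b) b)"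
        using linear_scale[OF has_derivative_linear[OF h]] by auto
      ultimately show ?thesis by (simp add: has_field_derivative_def)
    qed
    obtain z where "?k (s n) - ?k 0 = (s n - 0) * h' (x + z *\<^sub>R b) b"
      using MVT2[of 0 "s n" ?k, OF s(1) k] by auto
    then have "D n x = h' (x + z *\<^sub>R b) b" using s(1)[of n] by (simp add: D_def)
    then show ?thesis using B(2) by simp
  qed
  have tr: "integrable lborel (\<lambda>x. h (x + c))" "(LINT x|lborel. h (x + c)) = (LINT x|lborel. h x)" for c
  proof -
    have "integrable (distr lborel borel ((+) c)) h" using inth by (simp add: lborel_distr_plus)
    then show "integrable lborel (\<lambda>x. h (x + c))"
      using borel_measurable_integrable[OF inth] by (subst (asm) integrable_distr_eq) (auto simp: add.commute)
    have "(LINT x|lborel. h x) = (LINT x|distr lborel borel ((+) c). h x)" by (simp add: lborel_distr_plus)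
    also have "\<dots> = (LINT x|lborel. h (x + c))"
      using borel_measurable_integrable[OF inth] by (subst integral_distr) (auto simp: add.commute)
    finally show "(LINT x|lborel. h (x + c)) = (LINT x|lborel. h x)" by simp
  qed
  have "(LINT x|lborel. D n x) = 0" for n
    using tr inth by (simp add: D_def)
  moreover have "(\<lambda>n. LINT x|lborel. D n x) \<longlonglongrightarrow> (LINT x|lborel. h' x b)"
  proof (rule integral_dominated_convergence[where w = "\<lambda>x. B * indicator K' x"])
    show "(\<lambda>x. h' x b) \<in> borel_measurable lborel"
      using cont by (simp add: borel_measurable_continuous_onI)
    show "D n \<in> borel_measurable lborel" for n
      unfolding D_def using tr(1) inth by (auto dest!: borel_measurable_integrable)
    show "integrable lborel (\<lambda>x. B * indicator K' x)"
      using \<open>compact K'\<close> by (intro integrable_mult_right integrable_real_indicator)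
        (use emeasure_compact_finite[of K'] in \<open>auto simp: borel_compact\<close>)
    show "AE x in lborel. norm (D n x) \<le> B * indicator K' x" for n
      using D0 DB B by (auto simp: indicator_def)
    have "(\<lambda>n. D n x) \<longlonglongrightarrow> h' x b" for x
    proof -
      let ?k = "\<lambda>t. h (x + t *\<^sub>R b)"
      have "(?k has_derivative (\<lambda>v. h' (x + 0 *\<^sub>R b) (v *\<^sub>R b))) (at 0)"
        by (rule has_derivative_compose[where f = "\<lambda>t. x + t *\<^sub>R b", OF _ h]) (auto intro!: derivative_eq_intros)
      moreover have "(\<lambda>v. h' x (v *\<^sub>R b)) = (*) (h' x b)"
        using linear_scale[OF has_derivative_linear[OF h]] by auto
      ultimately have "(?k has_real_derivative h' x b) (at 0)" by (simp add: has_field_derivative_def)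
      then have "((\<lambda>t. (h (x + t *\<^sub>R b) - h x) / t) \<longlongrightarrow> h' x b) (at 0)"
        by (simp add: has_field_derivative_iff)
      then show ?thesis unfolding D_def
        by (rule filterlim_compose) (use s0 s in \<open>auto simp: filterlim_at less_imp_neq[symmetric]\<close>)
    qed
    then show "AE x in lborel. (\<lambda>n. D n x) \<longlonglongrightarrow> h' x b" by simp
  qed
  ultimately show "(LINT x|lborel. h' x b) = 0"
    by (simp add: LIMSEQ_const_iff)
qed

section \<open>The regularised Riesz kernel\<close>

lemma emeasure_ball_eq:
  fixes y :: "'a::euclidean_space"
  assumes "r \<ge> 0"
  shows "emeasure lborel (ball y r) = ennreal (r ^ DIM('a) * measure lborel (ball (0::'a) 1))"
  using content_ball_conv_unit_ball[OF assms, of y] emeasure_lborel_ball_finite[of y r]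
  by (subst emeasure_eq_ennreal_measure) auto

lemma content_unit_ball_pos: "measure lborel (ball (0::'a::euclidean_space) 1) > 0"
  using content_ball_pos[of 1 "0::'a"] by simp

text \<open>The field \<open>z \<mapsto> (|z|\<^sup>2 + \<eta>)\<^bsup>-N/2\<^esup> z\<close> has the nonnegative divergence
  \<open>N \<eta> (|z|\<^sup>2 + \<eta>)\<^bsup>-N/2-1\<^esup>\<close>, which concentrates at the origin as \<open>\<eta>\<close> tends to 0.\<close>

lemma riesz_kernel_integral_eq:
  fixes w :: "'a::euclidean_space \<Rightarrow> real"
  assumes w: "\<And>x. (w has_derivative (\<lambda>v. g x \<bullet> v)) (at x)" and g: "continuous_on UNIV g"
    and K: "compact K" "\<And>x. x \<notin> K \<Longrightarrow> w x = 0" and \<eta>: "\<eta> > 0"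
  defines "N \<equiv> real DIM('a)"
  shows "(LINT x|lborel. w x * (N * \<eta> * ((norm (x - y))\<^sup>2 + \<eta>) powr (- N / 2 - 1)))
     = - (LINT x|lborel. (g x \<bullet> (x - y)) * ((norm (x - y))\<^sup>2 + \<eta>) powr (- N / 2))"
proof -
  define r where "r x = (x - y) \<bullet> (x - y) + \<eta>" for x
  have rpos: "r x > 0" for x using \<eta> by (simp add: r_def add_nonneg_pos)
  have rn: "(norm (x - y))\<^sup>2 + \<eta> = r x" for x by (simp add: r_def power2_norm_eq_inner)
  have contw: "continuous_on UNIV w"
    using has_derivative_continuous[OF w] by (simp add: continuous_on_eq_continuous_at)
  have contr: "continuous_on UNIV r" unfolding r_def by (intro continuous_intros)
  have g0: "g x = 0" if "x \<notin> K" for x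
  proof -
    have "g x \<bullet> g x = 0"
      using has_derivative_0_off_support[OF w compact_imp_closed[OF K(1)] K(2) that] by blast
    then show ?thesis by simp
  qed
  \<comment> \<open>\<open>H b\<close> is the component along b of w times the kernel field. Summing
    its derivatives in direction b over the basis gives a divergence, and each summand has integral
    0.\<close>
  define H where "H b x = w x * (((x - y) \<bullet> b) * r x powr (- N / 2))" for b x
  define H' where "H' b x v = w x * (((x - y) \<bullet> b) * ((- N / 2) * r x powr (- N / 2 - 1) * (2 * ((x - y) \<bullet> v)))
      + (v \<bullet> b) * r x powr (- N / 2)) + (g x \<bullet> v) * (((x - y) \<bullet> b) * r x powr (- N / 2))" for b x v
  have dr: "((\<lambda>x. r x powr (- N / 2)) has_derivative
      (\<lambda>v. (- N / 2) * r x powr (- N / 2 - 1) * (2 * ((x - y) \<bullet> v)))) (at x)" for x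
  proof -
    have 1: "(r has_derivative (\<lambda>v. 2 * ((x - y) \<bullet> v))) (at x)"
      unfolding r_def by (auto intro!: derivative_eq_intros simp: inner_commute)
    have 2: "((\<lambda>t. t powr (- N / 2)) has_derivative (*) ((- N / 2) * r x powr (- N / 2 - 1))) (at (r x))"
      using has_real_derivative_powr[OF rpos, of "-N/2" x] by (simp add: has_field_derivative_def)
    show ?thesis using has_derivative_compose[OF 1 2] by simp
  qed
  have H: "(H b has_derivative H' b x) (at x)" for b x
    unfolding H_def H'_def
    by (intro has_derivative_mult w dr) (auto intro!: derivative_eq_intros)
  have contH': "continuous_on UNIV (\<lambda>x. H' b x b)" for b
    unfolding H'_def using rpos
    by (intro continuous_intros contw g contr) (auto simp: less_imp_neq[symmetric])
  have H0: "H b x = 0" if "x \<notin> K" for b x using K(2)[OF that] by (simp add: H_def)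
  note IH = integral_directional_derivative_eq_0[OF H contH' K(1) H0]
  have sum: "(\<Sum>b\<in>Basis. H' b x b) = w x * (N * \<eta> * r x powr (- N / 2 - 1)) + (g x \<bullet> (x - y)) * r x powr (- N / 2)" for x
  proof -
    have aux: "w * (z * ((- M / 2) * P * (2 * z)) + 1 * Q) + h * (z * Q)
        = w * (- M * P) * (z * z) + w * Q + Q * (h * z)" for w z M P Q h :: real
      by algebra
    have "(\<Sum>b\<in>Basis. H' b x b) = (\<Sum>b\<in>Basis. w x * (-N * r x powr (-N/2-1)) * (((x - y) \<bullet> b) * ((x-y) \<bullet> b))
        + w x * r x powr (-N/2) + r x powr (-N/2) * ((g x \<bullet> b) * ((x - y) \<bullet> b)))"
      by (rule sum.cong[OF refl], unfold H'_def, subst aux[symmetric], simp)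
    also have "\<dots> = w x * (-N * r x powr (-N/2-1)) * ((x - y) \<bullet> (x-y)) + N * (w x * r x powr (-N/2))
        + r x powr (-N/2) * (g x \<bullet> (x - y))"
      by (simp add: sum.distrib sum_subtractf sum_distrib_left[symmetric] euclidean_inner[symmetric] N_def)
    \<comment> \<open>Since \<open>r x\<close> is the squared distance plus \<eta>, the power with
      exponent -N/2 is \<open>r x\<close> times the one with exponent -N/2-1. The squared distances
      cancel and only the part with \<eta> survives.\<close>
    also have "\<dots> = w x * (N * \<eta> * r x powr (- N / 2 - 1)) + (g x \<bullet> (x - y)) * r x powr (- N / 2)"
    proof -
      have "w * (- N * P) * Z + N * (w * Q) + Q * h = w * (N * \<eta> * P) + h * Q"
        if "Q = (Z + \<eta>) * P" for w P Z Q h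
        by (simp add: that algebra_simps)
      moreover have "r x powr (-N/2) = ((x - y) \<bullet> (x - y) + \<eta>) * r x powr (-N/2-1)"
        using rpos[of x] by (simp add: powr_diff r_def)
      ultimately show ?thesis by blast
    qed
    finally show ?thesis .
  qed
  have i1: "integrable lborel (\<lambda>x. w x * (N * \<eta> * r x powr (- N / 2 - 1)))"
    by (rule integrable_continuous_compact_support[OF _ K(1)])
      (use rpos K in \<open>auto intro!: continuous_intros contw contr simp: less_imp_neq[symmetric]\<close>)
  have i2: "integrable lborel (\<lambda>x. (g x \<bullet> (x - y)) * r x powr (- N / 2))"
    by (rule integrable_continuous_compact_support[OF _ K(1)])
      (use rpos g0 in \<open>auto intro!: continuous_intros g contr simp: less_imp_neq[symmetric]\<close>)
  have "0 = (\<Sum>b\<in>Basis. (LINT x|lborel. H' b x b))" using IH(2) by simp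
  also have "\<dots> = (LINT x|lborel. (\<Sum>b\<in>Basis. H' b x b))" using IH(1) by (simp add: Bochner_Integration.integral_sum)
  also have "\<dots> = (LINT x|lborel. w x * (N * \<eta> * r x powr (- N / 2 - 1)))
      + (LINT x|lborel. (g x \<bullet> (x - y)) * r x powr (- N / 2))"
    unfolding sum using i1 i2 by simp
  finally show ?thesis unfolding rn by simp
qed

text \<open>If w exceeds m on the ball of radius d around y, take \<eta> = d^2. On this ball the
  divergence of the kernel field is at least N \<eta> (2 \<eta>)^{-N/2-1}, and this times the volume
  of the ball no longer contains d, which explains \<open>c\<close>. The rest of the integral is
  nonnegative and is dropped. So no limit of \<eta> to 0 is taken; only m approaches w y. The field
  itself is dominated by |x - y|^{1-N}.\<close>

lemma riesz_representation_bound: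
  fixes w :: "'a::euclidean_space \<Rightarrow> real"
  assumes w: "\<And>x. (w has_derivative (\<lambda>v. g x \<bullet> v)) (at x)" and g: "continuous_on UNIV g"
    and K: "compact K" "\<And>x. x \<notin> K \<Longrightarrow> w x = 0" and nonneg: "\<And>x. 0 \<le> w x"
  defines "N \<equiv> real DIM('a)"
  defines "c \<equiv> N * 2 powr (- N / 2 - 1) * measure lborel (ball (0::'a) 1)"
  shows "ennreal (c * w y) \<le> (\<integral>\<^sup>+x. ennreal (norm (g x) * norm (x - y) powr (1 - N)) \<partial>lborel)" (is "_ \<le> ?R")
proof -
  have N: "N > 0" by (simp add: N_def)
  have c: "c > 0" unfolding c_def using content_unit_ball_pos[where 'a='a] N by simp
  have contw: "continuous_on UNIV w"
    using has_derivative_continuous[OF w] by (simp add: continuous_on_eq_continuous_at)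
  have g0: "g x = 0" if "x \<notin> K" for x
  proof -
    have "g x \<bullet> g x = 0"
      using has_derivative_0_off_support[OF w compact_imp_closed[OF K(1)] K(2) that] by blast
    then show ?thesis by simp
  qed
  have step: "ennreal (c * m) \<le> ?R" if m: "0 \<le> m" "m < w y" for m
  proof -
    have "isCont w y" using contw by (simp add: continuous_on_eq_continuous_at)
    then have "eventually (\<lambda>x. m < w x) (nhds y)"
      using m by (auto simp: isCont_def tendsto_at_iff_tendsto_nhds intro: order_tendstoD)
    then obtain d where d: "d > 0" "\<And>x. x \<in> ball y d \<Longrightarrow> m < w x"
      unfolding eventually_nhds_metric by (auto simp: dist_commute)
    define \<eta> where "\<eta> = d\<^sup>2"
    have \<eta>: "\<eta> > 0" using d by (simp add: \<eta>_def)
    define r where "r x = (norm (x - y))\<^sup>2 + \<eta>" for x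
    have rpos: "r x > 0" for x using \<eta> by (simp add: r_def add_nonneg_pos)
    have contr: "continuous_on UNIV r" unfolding r_def by (intro continuous_intros)
    let ?k = "\<lambda>x. N * \<eta> * r x powr (- N / 2 - 1)"
    have kc: "continuous_on UNIV ?k"
      using rpos by (intro continuous_intros contr) (auto simp: less_imp_neq[symmetric])
    have i1: "integrable lborel (\<lambda>x. w x * ?k x)"
      by (rule integrable_continuous_compact_support[OF continuous_on_mult[OF contw kc] K(1)])
        (use K in simp)
    have i2: "integrable lborel (\<lambda>x. norm (g x) * norm (x - y) * r x powr (- N / 2))"
      by (rule integrable_continuous_compact_support[OF _ K(1)])
        (use rpos g0 in \<open>auto intro!: continuous_intros g contr simp: less_imp_neq[symmetric]\<close>)
    have i3: "integrable lborel (\<lambda>x. (g x \<bullet> (x - y)) * r x powr (- N / 2))"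
      by (rule integrable_continuous_compact_support[OF _ K(1)])
        (use rpos g0 in \<open>auto intro!: continuous_intros g contr simp: less_imp_neq[symmetric]\<close>)
    have kb: "?k x \<ge> N * \<eta> * (2 * \<eta>) powr (- N / 2 - 1)" if "x \<in> ball y d" for x
    proof -
      have "norm (x - y) < d" using that by (simp add: dist_norm norm_minus_commute)
      then have "(norm (x - y))\<^sup>2 \<le> d\<^sup>2" by (intro power_mono) auto
      then have "r x \<le> 2 * \<eta>" by (simp add: r_def \<eta>_def)
      then show ?thesis using rpos[of x] N \<eta>
        by (intro mult_left_mono powr_mono2') auto
    qed
    have dN: "d ^ DIM('a) = \<eta> powr (N / 2)"
      using d powr_powr[of d 2 "N / 2"] powr_realpow[of d "DIM('a)"] by (simp add: \<eta>_def N_def)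
    have "c * m = m * (N * \<eta> * (2 * \<eta>) powr (- N / 2 - 1)) * measure lborel (ball y d)"
    proof -
      have "\<eta> * \<eta> powr (- N / 2 - 1) * \<eta> powr (N / 2) = 1"
      proof -
        have "\<eta> powr 1 * \<eta> powr (- N / 2 - 1) * \<eta> powr (N / 2) = \<eta> powr (1 + (- N / 2 - 1) + N / 2)"
          by (simp only: powr_add)
        then show ?thesis using \<eta> by simp
      qed
      then show ?thesis
        using d \<eta> unfolding content_ball_conv_unit_ball[OF less_imp_le[OF d(1)]] dN c_def
        by (simp add: powr_mult mult_ac)
    qed
    also have "\<dots> = (LINT x|lborel. m * (N * \<eta> * (2 * \<eta>) powr (- N / 2 - 1)) * indicator (ball y d) x)"
      by simp
    also have "\<dots> \<le> (LINT x|lborel. w x * ?k x)"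
    proof (rule integral_mono[OF _ i1])
      show "m * (N * \<eta> * (2 * \<eta>) powr (- N / 2 - 1)) * indicator (ball y d) x \<le> w x * ?k x" for x
      proof (cases "x \<in> ball y d")
        case True
        have "m * (N * \<eta> * (2 * \<eta>) powr (- N / 2 - 1)) \<le> w x * ?k x"
          using d(2)[OF True] m N \<eta> nonneg[of x] by (intro mult_mono kb[OF True]) simp_all
        then show ?thesis using True by simp
      next
        case False
        then show ?thesis using nonneg[of x] N \<eta> by simp
      qed
      show "integrable lborel (\<lambda>x. m * (N * \<eta> * (2 * \<eta>) powr (- N / 2 - 1)) * indicator (ball y d) x)"
        by (intro integrable_mult_right integrable_real_indicator) (use emeasure_lborel_ball_finite in auto)
    qed
    also have "\<dots> = - (LINT x|lborel. (g x \<bullet> (x - y)) * r x powr (- N / 2))"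
      using riesz_kernel_integral_eq[OF w g K \<eta>, of y] by (simp add: r_def N_def)
    also have "\<dots> \<le> (LINT x|lborel. norm (g x) * norm (x - y) * r x powr (- N / 2))"
    proof -
      have "- (LINT x|lborel. (g x \<bullet> (x - y)) * r x powr (- N / 2)) = (LINT x|lborel. - ((g x \<bullet> (x - y)) * r x powr (- N / 2)))"
        by simp
      also have "\<dots> \<le> (LINT x|lborel. norm (g x) * norm (x - y) * r x powr (- N / 2))"
      proof (rule integral_mono[OF _ i2])
        show "integrable lborel (\<lambda>x. - ((g x \<bullet> (x - y)) * r x powr (- N / 2)))" using i3 by simp
        show "- ((g x \<bullet> (x - y)) * r x powr (- N / 2)) \<le> norm (g x) * norm (x - y) * r x powr (- N / 2)" for x
          using Cauchy_Schwarz_ineq2[of "g x" "x - y"]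
          by (subst minus_mult_left) (intro mult_right_mono, auto)
      qed
      finally show ?thesis .
    qed
    finally have "ennreal (c * m) \<le> ennreal (LINT x|lborel. norm (g x) * norm (x - y) * r x powr (- N / 2))"
      by (rule ennreal_leI)
    also have "\<dots> = (\<integral>\<^sup>+x. ennreal (norm (g x) * norm (x - y) * r x powr (- N / 2)) \<partial>lborel)"
      by (rule nn_integral_eq_integral[OF i2, symmetric]) auto
    also have "\<dots> \<le> ?R"
    proof (intro nn_integral_mono ennreal_leI)
      fix x
      show "norm (g x) * norm (x - y) * r x powr (- N / 2) \<le> norm (g x) * norm (x - y) powr (1 - N)"
      proof (cases "x = y")
        case False
        then have p: "norm (x - y) > 0" by simp
        have "(norm (x - y))\<^sup>2 \<le> r x" using \<eta> by (simp add: r_def)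
        then have "r x powr (- N / 2) \<le> (norm (x - y))\<^sup>2 powr (- N / 2)"
          using p N by (intro powr_mono2') auto
        also have "\<dots> = norm (x - y) powr (- N)" using p powr_powr[of "norm (x - y)" 2 "- N / 2"] by simp
        finally have "norm (x - y) * r x powr (- N / 2) \<le> norm (x - y) * norm (x - y) powr (- N)"
          by (rule mult_left_mono) simp
        also have "\<dots> = norm (x - y) powr (1 - N)" using p by (simp add: powr_diff powr_minus field_simps)
        finally show ?thesis by (simp add: mult.assoc mult_left_mono)
      qed auto
    qed
    finally show ?thesis .
  qed
  show ?thesis
  proof (rule ccontr)
    assume "\<not> ?thesis"
    then have lt: "?R < ennreal (c * w y)" by simp
    then obtain q where q: "?R = ennreal q" "q \<ge> 0" by (cases ?R) auto
    with lt have "q < c * w y" using c nonneg[of y] by (simp add: ennreal_less_iff)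
    then have "q / c < w y" using c by (simp add: field_simps)
    then obtain m where m: "q / c < m" "m < w y" using dense by blast
    then have "m \<ge> 0" using q c by (meson divide_nonneg_pos less_eq_real_def order_le_less_trans)
    from step[OF this m(2)] q have "c * m \<le> q" using c \<open>m \<ge> 0\<close> by (simp add: q)
    with m c show False by (simp add: field_simps)
  qed
qed

section \<open>The weak-type Sobolev inequality for smooth functions\<close>

text \<open>The punctured ball is split into dyadic shells around y. On the shell between R/2^{k+1}
  and R/2^k the integrand is at most \<open>a k\<close> (the value at the inner radius), and since s
  < N the volumes shrink faster than these values grow. What is left is a geometric series of ratio
  2^{s-N}.\<close>

lemma nn_integral_ball_powr_le:
  assumes "0 < s" "s < real DIM('a::euclidean_space)"
  shows "\<exists>C>0. \<forall>(y::'a) R. R > 0 \<longrightarrow>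
    (\<integral>\<^sup>+x. ennreal (norm (x - y) powr (- s) * indicator (ball y R) x) \<partial>lborel)
      \<le> ennreal (C * R powr (real DIM('a) - s))"
proof -
  define N where "N = real DIM('a)"
  define \<omega> where "\<omega> = measure lborel (ball (0::'a) 1)"
  define q where "q = 2 powr (s - N)"
  have \<omega>: "\<omega> > 0" using content_unit_ball_pos by (simp add: \<omega>_def)
  have q: "0 < q" "q < 1" using assms by (auto simp: q_def N_def powr_less_one)
  define C where "C = \<omega> * 2 powr s / (1 - q)"
  have "C > 0" using \<omega> q by (simp add: C_def)
  moreover have "(\<integral>\<^sup>+x. ennreal (norm (x - y) powr (- s) * indicator (ball y R) x) \<partial>lborel)
      \<le> ennreal (C * R powr (N - s))" if R: "R > 0" for y :: 'a and R
  proof -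
    define a where "a k = (R / 2 ^ (k + 1)) powr (- s)" for k :: nat
    have pw: "ennreal (norm (x - y) powr (- s) * indicator (ball y R) x)
        \<le> (\<Sum>k. ennreal (a k) * indicator (ball y (R / 2 ^ k)) x)" for x
    proof (cases "x \<in> ball y R \<and> x \<noteq> y")
      case True
      define t where "t = norm (x - y)"
      have t: "0 < t" "t < R" using True by (auto simp: t_def dist_norm norm_minus_commute)
      have "(\<lambda>k. R * (1 / 2) ^ k) \<longlonglongrightarrow> R * 0"
        by (intro tendsto_mult tendsto_const LIMSEQ_power_zero) auto
      then have "eventually (\<lambda>k. R * (1 / 2) ^ k < t) sequentially"
        using t by (intro order_tendstoD) auto
      then have ex: "\<exists>k. R / 2 ^ k \<le> t"
        by (auto simp: eventually_sequentially power_one_over field_simps intro: less_imp_le)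
      \<comment> \<open>The least such index is not 0 because t < R, so its predecessor k names the
        shell of x.\<close>
      define n where "n = (LEAST k. R / 2 ^ k \<le> t)"
      have n: "R / 2 ^ n \<le> t" unfolding n_def by (rule LeastI_ex[OF ex])
      then have "n \<noteq> 0" using t by (cases n) auto
      then obtain k where k: "n = Suc k" by (cases n) auto
      have kt: "t < R / 2 ^ k"
        using not_less_Least[of k "\<lambda>k. R / 2 ^ k \<le> t"] k by (simp add: n_def not_le)
      have "t powr (- s) \<le> a k"
        unfolding a_def using n k R assms by (intro powr_mono2') auto
      then have "ennreal (norm (x - y) powr (- s) * indicator (ball y R) x)
          \<le> ennreal (a k) * indicator (ball y (R / 2 ^ k)) x"
        using True kt by (auto simp: t_def dist_norm norm_minus_commute intro!: ennreal_leI)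
      also have "\<dots> \<le> (\<Sum>k. ennreal (a k) * indicator (ball y (R / 2 ^ k)) x)"
        using sum_le_suminf[of "\<lambda>k. ennreal (a k) * indicator (ball y (R / 2 ^ k)) x" "{k}"]
        by (simp del: sum_mult_indicator)
      finally show ?thesis .
    \<comment> \<open>Outside the ball the indicator vanishes; at x = y the left side is 0 because
      \<open>0 powr (- s) = 0\<close>.\<close>
    qed (auto simp: indicator_def)
    have term_eq: "a k * ((R / 2 ^ k) ^ DIM('a) * \<omega>) = \<omega> * 2 powr s * R powr (N - s) * q ^ k" for k
    proof -
      have 2: "(2::real) ^ j = 2 powr (real j)" for j by (simp add: powr_realpow)
      have "(R / 2 ^ k) ^ DIM('a) = (R / 2 ^ k) powr N"
        using R by (simp add: N_def powr_realpow)
      also have "\<dots> = R powr N * 2 powr (- (k * N))"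
        using R by (simp add: powr_divide powr_powr powr_minus_divide 2)
      finally have A: "(R / 2 ^ k) ^ DIM('a) = R powr N * 2 powr (- (k * N))" .
      have B: "a k = R powr (- s) * 2 powr ((k + 1) * s)"
        using R by (simp add: a_def powr_divide powr_powr powr_minus_divide 2 del: power_Suc)
      have D: "q ^ k = 2 powr (k * (s - N))"
        by (simp add: q_def powr_powr powr_realpow[symmetric] mult.commute)
      have "2 powr ((k + 1) * s) * 2 powr (- (k * N)) = 2 powr s * 2 powr (k * (s - N))"
        by (simp add: powr_add[symmetric] algebra_simps)
      moreover have "R powr (- s) * R powr N = R powr (N - s)" by (simp add: powr_add[symmetric])
      ultimately show ?thesis unfolding A B D by (simp add: mult_ac)
    qed
    have "(\<integral>\<^sup>+x. ennreal (norm (x - y) powr (- s) * indicator (ball y R) x) \<partial>lborel)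
        \<le> (\<integral>\<^sup>+x. (\<Sum>k. ennreal (a k) * indicator (ball y (R / 2 ^ k)) x) \<partial>lborel)"
      by (intro nn_integral_mono pw)
    also have "\<dots> = (\<Sum>k. \<integral>\<^sup>+x. ennreal (a k) * indicator (ball y (R / 2 ^ k)) x \<partial>lborel)"
      by (intro nn_integral_suminf borel_measurable_times_ennreal borel_measurable_const borel_measurable_indicator) auto
    also have "\<dots> = (\<Sum>k. ennreal (\<omega> * 2 powr s * R powr (N - s) * q ^ k))"
    proof (rule suminf_cong)
      fix k
      have "(\<integral>\<^sup>+x. ennreal (a k) * indicator (ball y (R / 2 ^ k)) x \<partial>lborel)
          = ennreal (a k) * ennreal ((R / 2 ^ k) ^ DIM('a) * \<omega>)"
        using R by (simp add: nn_integral_cmult_indicator emeasure_ball_eq \<omega>_def)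
      also have "\<dots> = ennreal (a k * ((R / 2 ^ k) ^ DIM('a) * \<omega>))"
        by (rule ennreal_mult'[symmetric]) (simp add: a_def)
      finally show "(\<integral>\<^sup>+x. ennreal (a k) * indicator (ball y (R / 2 ^ k)) x \<partial>lborel)
          = ennreal (\<omega> * 2 powr s * R powr (N - s) * q ^ k)" unfolding term_eq .
    qed
    also have "\<dots> = ennreal (C * R powr (N - s))"
    proof -
      have "(\<lambda>k. \<omega> * 2 powr s * R powr (N - s) * q ^ k) sums (\<omega> * 2 powr s * R powr (N - s) * (1 / (1 - q)))"
        using q by (intro sums_mult geometric_sums) auto
      then show ?thesis
        using q \<omega> by (subst suminf_ennreal_eq) (auto simp: C_def mult_ac)
    qed
    finally show ?thesis .
  qed
  ultimately show ?thesis unfolding N_def by blast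
qed

text \<open>Cut at the radius R = |A|^{1/N}: inside the ball around y the bound for balls applies,
  outside it the kernel is at most R^{-s}. This R turns both contributions into multiples of
  |A|^{1-s/N}.\<close>

lemma nn_integral_riesz_potential_le:
  assumes "0 < s" "s < real DIM('a::euclidean_space)"
  shows "\<exists>C>0. \<forall>(y::'a) A. A \<in> sets lborel \<longrightarrow> emeasure lborel A < \<infinity> \<longrightarrow>
    (\<integral>\<^sup>+x. ennreal (norm (x - y) powr (- s) * indicator A x) \<partial>lborel)
      \<le> ennreal (C * measure lborel A powr (1 - s / real DIM('a)))"
proof -
  define N where "N = real DIM('a)"
  have N: "N > 0" by (simp add: N_def)
  obtain C where C: "C > 0" "\<And>(y::'a) R. R > 0 \<Longrightarrow>
    (\<integral>\<^sup>+x. ennreal (norm (x - y) powr (- s) * indicator (ball y R) x) \<partial>lborel)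
      \<le> ennreal (C * R powr (N - s))"
    using nn_integral_ball_powr_le[OF assms] unfolding N_def by blast
  have "(\<integral>\<^sup>+x. ennreal (norm (x - y) powr (- s) * indicator A x) \<partial>lborel)
      \<le> ennreal ((C + 1) * measure lborel A powr (1 - s / N))"
    if A[measurable]: "A \<in> sets lborel" and fin: "emeasure lborel A < \<infinity>" for y :: 'a and A
  proof (cases "measure lborel A = 0")
    case True
    then have "emeasure lborel A = 0" using fin by (auto simp: measure_def enn2real_eq_0_iff)
    then have "AE x in lborel. x \<notin> A" using A by (simp add: AE_iff_null null_setsI AE_not_in)
    then have "AE x in lborel. ennreal (norm (x - y) powr (- s) * indicator A x) = 0"
      by eventually_elim simp
    then have "(\<integral>\<^sup>+x. ennreal (norm (x - y) powr (- s) * indicator A x) \<partial>lborel) = (\<integral>\<^sup>+(x::'a). 0 \<partial>lborel)"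
      by (rule nn_integral_cong_AE)
    then show ?thesis by simp
  next
    case False
    define m where "m = measure lborel A"
    have m: "m > 0" using False by (simp add: m_def order_less_le)
    have em: "emeasure lborel A = ennreal m"
      using fin by (simp add: m_def emeasure_eq_ennreal_measure)
    define R where "R = m powr (1 / N)"
    have R: "R > 0" using m by (simp add: R_def)
    have "(\<integral>\<^sup>+x. ennreal (norm (x - y) powr (- s) * indicator A x) \<partial>lborel)
      \<le> (\<integral>\<^sup>+x. ennreal (norm (x - y) powr (- s) * indicator (ball y R) x)
          + ennreal (R powr (- s)) * indicator A x \<partial>lborel)"
    proof (intro nn_integral_mono)
      fix x
      show "ennreal (norm (x - y) powr (- s) * indicator A x) \<le>
        ennreal (norm (x - y) powr (- s) * indicator (ball y R) x) + ennreal (R powr (- s)) * indicator A x"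
      proof (cases "x \<in> ball y R")
        case False
        then have "norm (x - y) powr (- s) \<le> R powr (- s)"
          using R assms by (intro powr_mono2') (auto simp: dist_norm norm_minus_commute)
        then show ?thesis using False by (auto simp: indicator_def intro: ennreal_leI)
      qed (auto simp: indicator_def)
    qed
    also have "\<dots> = (\<integral>\<^sup>+x. ennreal (norm (x - y) powr (- s) * indicator (ball y R) x) \<partial>lborel)
        + ennreal (R powr (- s)) * emeasure lborel A"
    proof -
      have [measurable]: "ball y R \<in> sets borel" by simp
      show ?thesis using A by (subst nn_integral_add) (measurable, simp_all add: nn_integral_cmult_indicator)
    qed
    also have "\<dots> \<le> ennreal (C * R powr (N - s)) + ennreal (R powr (- s)) * ennreal m"
      unfolding em by (intro add_right_mono C R)
    also have "\<dots> = ennreal (C * R powr (N - s) + R powr (- s) * m)"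
      using C m by (simp add: ennreal_mult' ennreal_plus)
    also have "C * R powr (N - s) + R powr (- s) * m = (C + 1) * m powr (1 - s / N)"
    proof -
      have "R powr (N - s) = m powr (1 - s / N)"
        using N by (simp add: R_def powr_powr field_simps)
      moreover have "R powr (- s) * m powr 1 = m powr (1 - s / N)"
        unfolding R_def powr_powr powr_add[symmetric] by (simp add: field_simps)
      ultimately show ?thesis using m by (simp add: algebra_simps)
    qed
    finally show ?thesis by (simp add: m_def)
  qed
  then show ?thesis using C(1) unfolding N_def by (intro exI[of _ "C + 1"]) auto
qed

text \<open>A cutoff w of v at height t is at least 1 on A = {|v| >= t} and has gradient at most
  (L/t)|g|. Integrating the Riesz bound for w over A and exchanging the integrals leaves the
  potential of A with exponent N - 1, which is at most a multiple of |A|^{1/N}. Dividing by this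
  power of |A| produces the exponent 1 - 1/N.\<close>

lemma weak_type_estimate_smooth:
  assumes dim: "DIM('a::euclidean_space) \<ge> 2"
  shows "\<exists>C>0. \<forall>(v :: 'a \<Rightarrow> real) g K t.
    (\<forall>x. (v has_derivative (\<lambda>u. g x \<bullet> u)) (at x)) \<longrightarrow> continuous_on UNIV g \<longrightarrow>
    compact K \<longrightarrow> (\<forall>x. x \<notin> K \<longrightarrow> v x = 0) \<longrightarrow> t > 0 \<longrightarrow>
    t * measure lborel {x. t \<le> \<bar>v x\<bar>} powr (1 - 1 / real DIM('a)) \<le> C * (LINT x|lborel. norm (g x))"
proof -
  define N where "N = real DIM('a)"
  have N: "N \<ge> 2" using dim by (simp add: N_def)
  define c where "c = N * 2 powr (- N / 2 - 1) * measure lborel (ball (0::'a) 1)"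
  have c: "c > 0" using N content_unit_ball_pos[where 'a='a] by (simp add: c_def)
  obtain C1 where C1: "C1 > 0" "\<And>(y::'a) A. A \<in> sets lborel \<Longrightarrow> emeasure lborel A < \<infinity> \<Longrightarrow>
    (\<integral>\<^sup>+x. ennreal (norm (x - y) powr (- (N - 1)) * indicator A x) \<partial>lborel)
      \<le> ennreal (C1 * measure lborel A powr (1 - (N - 1) / N))"
    using nn_integral_riesz_potential_le[where 'a='a and s = "N - 1"] N unfolding N_def by auto
  obtain L where L: "L > 0" "\<And>x. 0 \<le> deriv smooth_step x" "\<And>x. deriv smooth_step x \<le> L"
    using smooth_step_deriv_bound by blast
  have "t * measure lborel {x. t \<le> \<bar>v x\<bar>} powr (1 - 1 / N) \<le> (L * C1 / c) * (LINT x|lborel. norm (g x))"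
    if v: "\<And>x. (v has_derivative (\<lambda>u. g x \<bullet> u)) (at x)" and g: "continuous_on UNIV g"
      and K: "compact K" "\<And>x. x \<notin> K \<Longrightarrow> v x = 0" and t: "t > 0" for v :: "'a \<Rightarrow> real" and g K t
  proof -
    have contv: "continuous_on UNIV v"
      using has_derivative_continuous[OF v] by (simp add: continuous_on_eq_continuous_at)
    have g0: "g x = 0" if "x \<notin> K" for x
    proof -
      have "g x \<bullet> g x = 0"
        using has_derivative_0_off_support[OF v compact_imp_closed[OF K(1)] K(2) that] by blast
      then show ?thesis by simp
    qed
    have intg: "integrable lborel (\<lambda>x. norm (g x))"
      by (rule integrable_continuous_compact_support[OF _ K(1)]) (use g0 in \<open>auto intro!: continuous_intros g\<close>)
    note D = Ck_real_deriv[OF Ck_smooth_step]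
    define \<theta>' where "\<theta>' s = (deriv smooth_step (s / t) - deriv smooth_step (- s / t)) / t" for s
    \<comment> \<open>A smooth stand-in for the minimum of |v|/t and 1. Each summand handles one
      sign of v, and the other one is then 0.\<close>
    define w where "w x = smooth_step (v x / t) + smooth_step (- v x / t)" for x
    have \<theta>: "((\<lambda>s. smooth_step (s / t) + smooth_step (- s / t)) has_real_derivative \<theta>' s) (at s)" for s
      using t by (auto intro!: derivative_eq_intros DERIV_chain2[OF D(1)] simp: \<theta>'_def field_simps)
    have w: "(w has_derivative (\<lambda>u. (\<theta>' (v x) *\<^sub>R g x) \<bullet> u)) (at x)" for x
      unfolding w_def using has_derivative_compose[OF v \<theta>[unfolded has_field_derivative_def]] by simp
    have \<theta>'b: "\<bar>\<theta>' s\<bar> \<le> L / t" for s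
    proof -
      have "\<bar>deriv smooth_step (s / t) - deriv smooth_step (- s / t)\<bar> \<le> L"
        using L(2,3)[of "s / t"] L(2,3)[of "- s / t"] by linarith
      then show ?thesis using t by (simp add: \<theta>'_def divide_right_mono)
    qed
    have cont\<theta>': "continuous_on UNIV \<theta>'"
      unfolding \<theta>'_def using t by (intro continuous_intros continuous_on_compose2[OF D(2)]) auto
    have wg: "continuous_on UNIV (\<lambda>x. \<theta>' (v x) *\<^sub>R g x)"
      by (intro continuous_intros g continuous_on_compose2[OF cont\<theta>' contv]) auto
    have w0: "w x = 0" if "x \<notin> K" for x using K(2)[OF that] by (simp add: w_def smooth_step_0)
    have wnn: "0 \<le> w x" for x by (simp add: w_def smooth_step_nonneg)
    define A where "A = {x. t \<le> \<bar>v x\<bar>}"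
    have AK: "A \<subseteq> K" using K(2) t by (force simp: A_def)
    have "closed A" unfolding A_def
      by (intro closed_Collect_le continuous_intros contv)
    then have "compact A" using compact_Int_closed[OF K(1)] AK by (metis inf.absorb2)
    then have A[measurable]: "A \<in> sets lborel" and fin: "emeasure lborel A < \<infinity>"
      using emeasure_compact_finite by (auto simp: borel_compact)
    have w1: "w x \<ge> 1" if "x \<in> A" for x
    proof -
      have "v x / t \<ge> 1 \<or> - v x / t \<ge> 1" using that t by (auto simp: A_def abs_if field_simps split: if_splits)
      then show ?thesis using smooth_step_nonneg[of "v x / t"] smooth_step_nonneg[of "- v x / t"]
        by (auto simp: w_def smooth_step_1)
    qed
    define m where "m = measure lborel A"
    have em: "emeasure lborel A = ennreal m" using fin by (simp add: m_def emeasure_eq_ennreal_measure)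
    have [measurable]: "g \<in> borel_measurable borel" using g by (rule borel_measurable_continuous_onI)
    define J where "J = (LINT x|lborel. norm (g x))"
    have J: "J \<ge> 0" by (simp add: J_def)
    have pt: "ennreal c * indicator A y \<le>
        (\<integral>\<^sup>+x. ennreal (L / t) * (ennreal (norm (g x)) * ennreal (norm (x - y) powr (1 - N) * indicator A y)) \<partial>lborel)" for y
    proof (cases "y \<in> A")
      case True
      have "ennreal c \<le> ennreal (c * w y)" using w1[OF True] c by (intro ennreal_leI) simp
      also have "\<dots> \<le> (\<integral>\<^sup>+x. ennreal (norm (\<theta>' (v x) *\<^sub>R g x) * norm (x - y) powr (1 - N)) \<partial>lborel)"
        using riesz_representation_bound[OF w wg K(1) w0 wnn, of y] by (simp add: c_def N_def)
      also have "\<dots> \<le> (\<integral>\<^sup>+x. ennreal (L / t) * (ennreal (norm (g x)) * ennreal (norm (x - y) powr (1 - N) * indicator A y)) \<partial>lborel)"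
      proof (intro nn_integral_mono)
        fix x
        have "norm (\<theta>' (v x) *\<^sub>R g x) * norm (x - y) powr (1 - N) \<le> (L / t * norm (g x)) * norm (x - y) powr (1 - N)"
          using mult_right_mono[OF \<theta>'b[of "v x"], of "norm (g x)"] by (intro mult_right_mono) auto
        then show "ennreal (norm (\<theta>' (v x) *\<^sub>R g x) * norm (x - y) powr (1 - N)) \<le>
          ennreal (L / t) * (ennreal (norm (g x)) * ennreal (norm (x - y) powr (1 - N) * indicator A y))"
          using True L t by (auto simp: ennreal_mult'[symmetric] mult.assoc intro!: ennreal_leI)
      qed
      finally show ?thesis using True by simp
    qed auto
    have "ennreal (c * m) = (\<integral>\<^sup>+y. ennreal c * indicator A y \<partial>lborel)"
      using c A by (simp add: nn_integral_cmult_indicator em ennreal_mult')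
    also have "\<dots> \<le> (\<integral>\<^sup>+y. (\<integral>\<^sup>+x. ennreal (L / t) * (ennreal (norm (g x)) * ennreal (norm (x - y) powr (1 - N) * indicator A y)) \<partial>lborel) \<partial>lborel)"
      by (intro nn_integral_mono pt)
    also have "\<dots> = (\<integral>\<^sup>+x. (\<integral>\<^sup>+y. ennreal (L / t) * (ennreal (norm (g x)) * ennreal (norm (x - y) powr (1 - N) * indicator A y)) \<partial>lborel) \<partial>lborel)"
      by (rule lborel_pair.Fubini') measurable
    also have "\<dots> \<le> (\<integral>\<^sup>+x. ennreal (L / t) * (ennreal (norm (g x)) * ennreal (C1 * m powr (1 / N))) \<partial>lborel)"
    proof (intro nn_integral_mono)
      fix x
      have "(\<integral>\<^sup>+y. ennreal (L / t) * (ennreal (norm (g x)) * ennreal (norm (x - y) powr (1 - N) * indicator A y)) \<partial>lborel)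
        = ennreal (L / t) * (ennreal (norm (g x)) * (\<integral>\<^sup>+y. ennreal (norm (y - x) powr (- (N - 1)) * indicator A y) \<partial>lborel))"
        by (simp add: nn_integral_cmult norm_minus_commute)
      also have "\<dots> \<le> ennreal (L / t) * (ennreal (norm (g x)) * ennreal (C1 * measure lborel A powr (1 - (N - 1) / N)))"
        by (intro mult_left_mono C1 A fin) auto
      also have "1 - (N - 1) / N = 1 / N" using N by (simp add: field_simps)
      finally show "(\<integral>\<^sup>+y. ennreal (L / t) * (ennreal (norm (g x)) * ennreal (norm (x - y) powr (1 - N) * indicator A y)) \<partial>lborel)
        \<le> ennreal (L / t) * (ennreal (norm (g x)) * ennreal (C1 * m powr (1 / N)))" by (simp add: m_def)
    qed
    also have "\<dots> = ennreal (L / t) * (ennreal J * ennreal (C1 * m powr (1 / N)))"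
      by (simp add: nn_integral_cmult nn_integral_multc J_def nn_integral_eq_integral[OF intg])
    also have "\<dots> = ennreal (L / t * (J * (C1 * m powr (1 / N))))"
    proof -
      have "0 \<le> C1 * m powr (1 / N)" "0 \<le> L / t" using L t C1 by auto
      then show ?thesis using J by (simp only: ennreal_mult[symmetric] mult_nonneg_nonneg)
    qed
    finally have *: "c * m \<le> L / t * (J * (C1 * m powr (1 / N)))"
      using L t J C1 by (subst (asm) ennreal_le_iff) auto
    show ?thesis
    proof (cases "m = 0")
      case True
      then show ?thesis using L C1 c J by (simp add: A_def[symmetric] m_def[symmetric] J_def[symmetric])
    next
      case False
      then have m: "m > 0" by (simp add: m_def order_less_le)
      have "c * (m powr (1 - 1 / N) * m powr (1 / N)) = c * m" using m by (simp add: powr_add[symmetric])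
      with * have "(c * m powr (1 - 1 / N)) * m powr (1 / N) \<le> (L / t * (J * C1)) * m powr (1 / N)"
        using c by (auto simp: mult_ac)
      then have "c * m powr (1 - 1 / N) \<le> L / t * (J * C1)"
        by (rule mult_right_le_imp_le) (use m in simp)
      then show ?thesis using c t by (simp add: A_def[symmetric] m_def[symmetric] J_def[symmetric] field_simps)
    qed
  qed
  then show ?thesis using L C1 c unfolding N_def by (intro exI[of _ "L * C1 / c"]) auto
qed

section \<open>Test functions and uniqueness of weak gradients\<close>

lemma test_function_derivative:
  assumes "\<phi> \<in> test_functions \<Omega>"
  shows "(\<phi> has_derivative (\<lambda>v. grad \<phi> x \<bullet> v)) (at x)"
proof -
  have "Ck (Suc 0) \<phi>" using assms by (auto simp: test_functions_def simp del: Ck.simps)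
  then have *: "(\<phi> has_derivative frechet_derivative \<phi> (at x)) (at x)" by (rule Ck_SucD(1))
  have "grad \<phi> x \<bullet> v = frechet_derivative \<phi> (at x) v" for v
  proof -
    have "frechet_derivative \<phi> (at x) v = frechet_derivative \<phi> (at x) (\<Sum>b\<in>Basis. (v \<bullet> b) *\<^sub>R b)"
      by (simp add: euclidean_representation)
    also have "\<dots> = (\<Sum>b\<in>Basis. (v \<bullet> b) * frechet_derivative \<phi> (at x) b)"
      using has_derivative_linear[OF *] by (simp add: linear_sum linear_scale)
    finally show ?thesis
      unfolding grad_def inner_sum_left inner_scaleR_left by (simp add: mult.commute inner_commute)
  qed
  with * show ?thesis by simp
qed

lemma test_function_continuous:
  assumes "\<phi> \<in> test_functions \<Omega>"
  shows "continuous_on UNIV \<phi>" "continuous_on UNIV (grad \<phi>)"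
proof -
  have "Ck (Suc 0) \<phi>" using assms by (auto simp: test_functions_def simp del: Ck.simps)
  then have "continuous_on UNIV (\<lambda>x. frechet_derivative \<phi> (at x) b)" if "b \<in> Basis" for b
    using Ck_SucD(2) that by fastforce
  then show "continuous_on UNIV (grad \<phi>)"
    unfolding grad_def[abs_def] by (intro continuous_intros)
  show "continuous_on UNIV \<phi>"
    using has_derivative_continuous[OF test_function_derivative[OF assms]]
    by (simp add: continuous_on_eq_continuous_at)
qed

lemma test_function_support:
  assumes "\<phi> \<in> test_functions \<Omega>"
  obtains K where "compact K" "K \<subseteq> \<Omega>" "\<And>x. x \<notin> K \<Longrightarrow> \<phi> x = 0" "\<And>x. x \<notin> K \<Longrightarrow> grad \<phi> x = 0"
proof
  let ?K = "closure (support_on UNIV \<phi>)"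
  show K: "compact ?K" "?K \<subseteq> \<Omega>" using assms by (auto simp: test_functions_def)
  show 0: "\<phi> x = 0" if "x \<notin> ?K" for x
    using that closure_subset[of "support_on UNIV \<phi>"] by (auto simp: support_on_def)
  show "grad \<phi> x = 0" if "x \<notin> ?K" for x
  proof -
    have "grad \<phi> x \<bullet> grad \<phi> x = 0"
      using has_derivative_0_off_support[OF test_function_derivative[OF assms] compact_imp_closed[OF K(1)] 0 that] by blast
    then show ?thesis by simp
  qed
qed

lemma test_functionI:
  assumes "\<And>k. Ck k \<phi>" "compact K" "K \<subseteq> \<Omega>" "\<And>x. x \<notin> K \<Longrightarrow> \<phi> x = 0"
  shows "\<phi> \<in> test_functions \<Omega>"
proof -
  have "support_on UNIV \<phi> \<subseteq> K" using assms(4) by (auto simp: support_on_def)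
  then have "closure (support_on UNIV \<phi>) \<subseteq> K"
    using assms(2) by (intro closure_minimal compact_imp_closed)
  moreover from this have "compact (closure (support_on UNIV \<phi>))"
    using assms(2) by (metis closed_closure compact_Int_closed inf.absorb2)
  ultimately show ?thesis using assms unfolding test_functions_def by auto
qed

section \<open>Weak gradients of test functions, and uniqueness of weak gradients\<close>

lemma integral_lebesgue_on_compact_support:
  fixes f :: "'a::euclidean_space \<Rightarrow> 'b::euclidean_space"
  assumes "continuous_on UNIV f" "compact K" "K \<subseteq> \<Omega>" "\<And>x. x \<notin> K \<Longrightarrow> f x = 0" "open \<Omega>"
  shows "integrable (lebesgue_on \<Omega>) f" "(LINT x|lebesgue_on \<Omega>. f x) = (LINT x|lborel. f x)"
proof -
  have f: "f \<in> borel_measurable lborel" using assms(1) by (simp add: borel_measurable_continuous_onI)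
  have *: "(\<lambda>x. indicator \<Omega> x *\<^sub>R f x) = f" using assms(3,4) by (intro ext) (auto simp: indicator_def)
  show "integrable (lebesgue_on \<Omega>) f"
    using integrable_continuous_compact_support[OF assms(1,2,4)] f assms(5) *
    by (simp add: integrable_restrict_space integrable_completion)
  show "(LINT x|lebesgue_on \<Omega>. f x) = (LINT x|lborel. f x)"
    using f assms(5) * by (simp add: integral_restrict_space integral_completion)
qed

text \<open>The product of the two test functions has compact support, so its directional
  derivatives have integral 0; the product rule turns this into integration by parts.\<close>

lemma is_weak_grad_test_function:
  assumes "\<phi> \<in> test_functions \<Omega>" "open \<Omega>"
  shows "is_weak_grad \<Omega> \<phi> (grad \<phi>)"
  unfolding is_weak_grad_def
proof (intro conjI allI impI ballI)
  have loc: "integrable (lebesgue_on K) f" if "compact K" "continuous_on UNIV f"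
    for K and f :: "'a \<Rightarrow> 'c::euclidean_space"
  proof -
    have "integrable lborel (\<lambda>x. indicator K x *\<^sub>R f x)"
      using borel_integrable_compact[OF that(1)] that(2) continuous_on_subset by blast
    moreover have "f \<in> borel_measurable borel" using that(2) by (rule borel_measurable_continuous_onI)
    ultimately show ?thesis using that(1)
      by (simp add: integrable_restrict_space integrable_completion borel_compact)
  qed
  fix K assume "compact K \<and> K \<subseteq> \<Omega>"
  then show "integrable (lebesgue_on K) \<phi>" "integrable (lebesgue_on K) (grad \<phi>)"
    using loc test_function_continuous[OF assms(1)] by blast+
next
  fix \<psi> and b :: 'a assume \<psi>: "\<psi> \<in> test_functions \<Omega>" and b: "b \<in> Basis"
  note c\<phi> = test_function_continuous[OF assms(1)] and c\<psi> = test_function_continuous[OF \<psi>]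
  obtain K where K: "compact K" "K \<subseteq> \<Omega>" "\<And>x. x \<notin> K \<Longrightarrow> \<psi> x = 0" "\<And>x. x \<notin> K \<Longrightarrow> grad \<psi> x = 0"
    using test_function_support[OF \<psi>] by blast
  define h' where "h' x v = \<phi> x * (grad \<psi> x \<bullet> v) + (grad \<phi> x \<bullet> v) * \<psi> x" for x v
  have h: "((\<lambda>x. \<phi> x * \<psi> x) has_derivative h' x) (at x)" for x
    unfolding h'_def[abs_def]
    by (intro has_derivative_mult test_function_derivative[OF assms(1)] test_function_derivative[OF \<psi>])
  have ch: "continuous_on UNIV (\<lambda>x. h' x b)"
    unfolding h'_def by (intro continuous_intros c\<phi> c\<psi>)
  note I = integral_directional_derivative_eq_0[OF h ch K(1)]
  have c1: "continuous_on UNIV (\<lambda>x. \<phi> x * (grad \<psi> x \<bullet> b))" by (intro continuous_intros c\<phi> c\<psi>)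
  have c2: "continuous_on UNIV (\<lambda>x. (grad \<phi> x \<bullet> b) * \<psi> x)" by (intro continuous_intros c\<phi> c\<psi>)
  note J1 = integral_lebesgue_on_compact_support[OF c1 K(1,2) _ assms(2)]
  note J2 = integral_lebesgue_on_compact_support[OF c2 K(1,2) _ assms(2)]
  note J3 = integral_lebesgue_on_compact_support[OF ch K(1,2) _ assms(2)]
  have "(LINT x|lebesgue_on \<Omega>. h' x b) = 0" using I(2) J3(2) K by (simp add: h'_def)
  then show "(LINT x|lebesgue_on \<Omega>. \<phi> x * (grad \<psi> x \<bullet> b)) = - (LINT x|lebesgue_on \<Omega>. (grad \<phi> x \<bullet> b) * \<psi> x)"
    using J1(1) J2(1) K by (simp add: h'_def)
qed

lemma integrable_mult_compact_support:
  fixes u :: "'a::euclidean_space \<Rightarrow> real"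
  assumes u: "integrable (lebesgue_on K) u" and \<phi>: "continuous_on UNIV \<phi>"
    and K: "compact K" "K \<subseteq> \<Omega>" "\<And>x. x \<notin> K \<Longrightarrow> \<phi> x = (0::real)" and \<Omega>: "open \<Omega>"
  shows "integrable (lebesgue_on \<Omega>) (\<lambda>x. u x * \<phi> x)"
proof -
  obtain B where B: "B \<ge> 0" "\<And>x. norm (\<phi> x) \<le> B"
    using bounded_continuous_compact_support[OF \<phi> K(1,3)] by auto
  have iu: "integrable lebesgue (\<lambda>x. indicator K x *\<^sub>R u x)"
    using u K(1) by (simp add: integrable_restrict_space borel_compact)
  have [measurable]: "\<phi> \<in> borel_measurable lebesgue"
    using \<phi> by (simp add: borel_measurable_continuous_onI measurable_completion)
  have "integrable lebesgue (\<lambda>x. (indicator K x *\<^sub>R u x) * \<phi> x)"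
  proof (rule Bochner_Integration.integrable_bound)
    show "integrable lebesgue (\<lambda>x. B * norm (indicator K x *\<^sub>R u x))" using iu by simp
    show "(\<lambda>x. (indicator K x *\<^sub>R u x) * \<phi> x) \<in> borel_measurable lebesgue"
      using borel_measurable_integrable[OF iu] by measurable
    show "AE x in lebesgue. norm ((indicator K x *\<^sub>R u x) * \<phi> x) \<le> norm (B * norm (indicator K x *\<^sub>R u x))"
      using B by (auto simp: abs_mult mult.commute[of B] intro!: mult_left_mono)
  qed
  moreover have "(\<lambda>x. (indicator K x *\<^sub>R u x) * \<phi> x) = (\<lambda>x. indicator \<Omega> x *\<^sub>R (u x * \<phi> x))"
    using K by (auto simp: indicator_def fun_eq_iff)
  ultimately show ?thesis using \<Omega> by (simp add: integrable_restrict_space)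
qed

text \<open>The products of the functions \<open>bump (n (x \<bullet> b - l \<bullet> b))\<close> and \<open>bump (n (r \<bullet> b - x \<bullet> b))\<close>
  increase to the indicator function of the open box.\<close>

lemma box_approximation:
  fixes l r :: "'a::euclidean_space"
  obtains \<phi> where "\<And>n k. Ck k (\<phi> n)" "\<And>n x. x \<notin> cbox l r \<Longrightarrow> \<phi> n x = 0"
    "\<And>n x. 0 \<le> \<phi> n x" "\<And>n x. \<phi> n x \<le> 1" "\<And>x. (\<lambda>n. \<phi> n x) \<longlonglongrightarrow> indicator (box l r) x"
proof
  define F where "F n b x = bump (real n * (x \<bullet> b) + (- (real n * (l \<bullet> b)))) * bump ((- real n) * (x \<bullet> b) + real n * (r \<bullet> b))"
    for n :: nat and b x :: 'a
  define \<phi> where "\<phi> n x = (\<Prod>b\<in>Basis. F n b x)" for n x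
  show "Ck k (\<phi> n)" for n k
    unfolding \<phi>_def F_def
    by (intro Ck_prod Ck_mult Ck_compose[OF Ck_bump] Ck_add Ck_const Ck_linear bounded_linear_inner_left) auto
  have F0: "F n b x = 0" if "\<not> (l \<bullet> b < x \<bullet> b \<and> x \<bullet> b < r \<bullet> b)" for n b x
  proof -
    have "real n * (x \<bullet> b) \<le> real n * (l \<bullet> b) \<or> real n * (r \<bullet> b) \<le> real n * (x \<bullet> b)"
      using that by (auto simp: not_less intro: mult_left_mono)
    then show ?thesis by (auto simp: F_def bump_def)
  qed
  then have \<phi>0: "\<phi> n x = 0" if "x \<notin> box l r" for n x
    using that unfolding \<phi>_def mem_box by (auto intro!: prod_zero)
  then show "\<phi> n x = 0" if "x \<notin> cbox l r" for n x
    using that box_subset_cbox by blast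
  show "0 \<le> \<phi> n x" for n x
    unfolding \<phi>_def F_def by (intro prod_nonneg mult_nonneg_nonneg bump_nonneg)
  show "\<phi> n x \<le> 1" for n x
    unfolding \<phi>_def F_def by (intro prod_le_1 conjI mult_nonneg_nonneg bump_nonneg mult_le_one bump_le_1)
  have lim: "(\<lambda>n. bump (real n * d)) \<longlonglongrightarrow> 1" if "d > 0" for d
  proof (rule Lim_transform_eventually)
    show "(\<lambda>n. exp (- (1 / (real n * d)))) \<longlonglongrightarrow> 1" using that by real_asymp
    show "\<forall>\<^sub>F n in sequentially. exp (- (1 / (real n * d))) = bump (real n * d)"
      using eventually_gt_at_top[of 0] by eventually_elim (use that in \<open>simp add: bump_def\<close>)
  qed
  show "(\<lambda>n. \<phi> n x) \<longlonglongrightarrow> indicator (box l r) x" for x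
  proof (cases "x \<in> box l r")
    case True
    have "(\<lambda>n. F n b x) \<longlonglongrightarrow> 1 * 1" if "b \<in> Basis" for b
    proof -
      have "F n b x = bump (real n * (x \<bullet> b - l \<bullet> b)) * bump (real n * (r \<bullet> b - x \<bullet> b))" for n
        by (simp add: F_def algebra_simps)
      then show ?thesis
        using tendsto_mult[OF lim[of "x \<bullet> b - l \<bullet> b"] lim[of "r \<bullet> b - x \<bullet> b"]] True that by (simp add: mem_box)
    qed
    then have "(\<lambda>n. \<phi> n x) \<longlonglongrightarrow> (\<Prod>b\<in>(Basis::'a set). 1)"
      unfolding \<phi>_def by (intro tendsto_prod) auto
    then show ?thesis using True by simp
  qed (simp add: \<phi>0)
qed

text \<open>The Borel sets over which f has integral 0 form a Dynkin system, and the open boxes are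
  an intersection-stable generator of the Borel sets. Integrals 0 over all Borel sets identify f
  with 0 as densities.\<close>

lemma AE_eq_0_if_box_integrals_eq_0:
  fixes f :: "'a::euclidean_space \<Rightarrow> real"
  assumes f: "integrable lborel f" and box: "\<And>l r. (LINT x:box l r|lborel. f x) = 0"
  shows "AE x in lborel. f x = 0"
proof (rule density_unique_real[OF f])
  let ?G = "range (\<lambda>(a, b). box a b :: 'a set)"
  \<comment> \<open>Complements need integral 0 over the whole space, which follows by exhausting it
    with boxes.\<close>
  have total: "(LINT x|lborel. f x) = 0"
  proof -
    have "(\<lambda>n::nat. LINT x|lborel. indicator (box (- (real n *\<^sub>R One)) (real n *\<^sub>R One)) x *\<^sub>R f x) \<longlonglongrightarrow> (LINT x|lborel. f x)"
    proof (rule integral_dominated_convergence[where w = "\<lambda>x. norm (f x)"])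
      show "AE x in lborel. (\<lambda>n::nat. indicator (box (- (real n *\<^sub>R One)) (real n *\<^sub>R One)) x *\<^sub>R f x) \<longlonglongrightarrow> f x"
      proof (rule AE_I2)
        fix x :: 'a
        obtain m :: nat where m: "x \<in> box (- (real m *\<^sub>R One)) (real m *\<^sub>R One)"
          using UN_box_eq_UNIV by blast
        have "\<forall>\<^sub>F n in sequentially. f x = indicator (box (- (real n *\<^sub>R One)) (real n *\<^sub>R One)) x *\<^sub>R f x"
          using eventually_ge_at_top[of m]
        proof eventually_elim
          case (elim n)
          then have "x \<in> box (- (real n *\<^sub>R One)) (real n *\<^sub>R One)"
            using m by (force simp: mem_box)
          then show ?case by simp
        qed
        then show "(\<lambda>n::nat. indicator (box (- (real n *\<^sub>R One)) (real n *\<^sub>R One)) x *\<^sub>R f x) \<longlonglongrightarrow> f x"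
          by (rule Lim_transform_eventually[OF tendsto_const])
      qed
      show "(\<lambda>x. indicator (box (- (real n *\<^sub>R One)) (real n *\<^sub>R One)) x *\<^sub>R f x) \<in> borel_measurable lborel" for n :: nat
        using borel_measurable_integrable[OF f] by measurable
    qed (use f in \<open>auto simp: indicator_def\<close>)
    then show ?thesis using box by (simp add: set_lebesgue_integral_def LIMSEQ_const_iff)
  qed
  fix A :: "'a set" assume "A \<in> sets lborel"
  then have A: "A \<in> sigma_sets UNIV ?G" by (simp add: borel_eq_box)
  have "Int_stable ?G" by (auto simp: Int_stable_def box_Int_box)
  moreover have "?G \<subseteq> Pow UNIV" by simp
  ultimately have "(LINT x:A|lborel. f x) = 0" using A
  proof (induction A rule: sigma_sets_induct_disjoint)
    case (basic A)
    then show ?case using box by auto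
  next
    case empty
    then show ?case by (simp add: set_lebesgue_integral_def)
  next
    case (compl A)
    then have A: "A \<in> sets lborel" by (simp add: borel_eq_box)
    have "integrable lborel (\<lambda>x. indicator A x *\<^sub>R f x)"
      using integrable_mult_indicator[OF A f] .
    moreover have "(LINT x:UNIV - A|lborel. f x) = (LINT x|lborel. f x - indicator A x *\<^sub>R f x)"
      unfolding set_lebesgue_integral_def by (intro Bochner_Integration.integral_cong) (auto simp: indicator_def)
    ultimately show ?case using compl(2) f total by (simp add: set_lebesgue_integral_def)
  next
    case (union A)
    then have A: "A i \<in> sets lborel" for i by (auto simp: borel_eq_box)
    have "set_integrable lborel (\<Union>i. A i) f"
      using integrable_mult_indicator[OF sets.countable_UN[of A UNIV lborel] f] A by (auto simp: set_integrable_def)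
    then show ?case
      using lebesgue_integral_countable_add[of A lborel f] A union(1,3) by (auto simp: disjoint_family_on_def)
  qed
  then show "(LINT x:A|lborel. f x) = (LINT x:A|lborel. 0)" by (simp add: set_lebesgue_integral_def)
qed simp

text \<open>Smooth functions converging to the indicator of a box turn the hypothesis into vanishing
  integrals of G over boxes whose closure lies in the domain. These determine G on every such box,
  and countably many closed boxes cover the domain.\<close>

lemma fundamental_lemma_variations:
  fixes G :: "'a::euclidean_space \<Rightarrow> real"
  assumes \<Omega>: "open \<Omega>" and G: "\<And>K. compact K \<Longrightarrow> K \<subseteq> \<Omega> \<Longrightarrow> integrable (lebesgue_on K) G"
    and zero: "\<And>\<phi>. \<phi> \<in> test_functions \<Omega> \<Longrightarrow> (LINT x|lebesgue_on \<Omega>. G x * \<phi> x) = 0"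
  shows "AE x in lebesgue_on \<Omega>. G x = 0"
proof -
  have intK: "integrable lebesgue (\<lambda>x. indicator K x *\<^sub>R G x)" if "compact K" "K \<subseteq> \<Omega>" for K
    using G[OF that] that(1) by (simp add: integrable_restrict_space borel_compact)
  have box0: "(LINT x|lebesgue. indicator (box l r) x * G x) = 0" if "cbox l r \<subseteq> \<Omega>" for l r
  proof -
    obtain \<phi> where \<phi>: "\<And>n k. Ck k (\<phi> n)" "\<And>n x. x \<notin> cbox l r \<Longrightarrow> \<phi> n x = 0"
      "\<And>n x. 0 \<le> \<phi> n x" "\<And>n x. \<phi> n x \<le> 1" "\<And>x. (\<lambda>n. \<phi> n x) \<longlonglongrightarrow> indicator (box l r) x"
      using box_approximation[of l r] by blast
    have "\<phi> n \<in> test_functions \<Omega>" for n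
      by (rule test_functionI[OF \<phi>(1) compact_cbox that \<phi>(2)])
    then have "(LINT x|lebesgue. indicator \<Omega> x *\<^sub>R (G x * \<phi> n x)) = 0" for n
      using zero \<Omega> by (simp add: integral_restrict_space)
    moreover have "indicator \<Omega> x *\<^sub>R (G x * \<phi> n x) = (indicator (cbox l r) x *\<^sub>R G x) * \<phi> n x" for n x
      using \<phi>(2)[of x n] that by (auto simp: indicator_def)
    ultimately have z: "(LINT x|lebesgue. (indicator (cbox l r) x *\<^sub>R G x) * \<phi> n x) = 0" for n
      by (simp only:)
    have mG: "(\<lambda>x. indicator (cbox l r) x *\<^sub>R G x) \<in> borel_measurable lebesgue"
      using borel_measurable_integrable[OF intK[OF compact_cbox that]] .
    have "(\<lambda>n. LINT x|lebesgue. (indicator (cbox l r) x *\<^sub>R G x) * \<phi> n x) \<longlonglongrightarrow>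
        (LINT x|lebesgue. indicator (box l r) x * G x)"
    proof (rule integral_dominated_convergence[where w = "\<lambda>x. norm (indicator (cbox l r) x *\<^sub>R G x)"])
      have "\<phi> n \<in> borel_measurable lebesgue" for n
        using \<phi>(1)[of 0 n] by (simp add: borel_measurable_continuous_onI measurable_completion)
      then show "(\<lambda>x. (indicator (cbox l r) x *\<^sub>R G x) * \<phi> n x) \<in> borel_measurable lebesgue" for n
        using mG by (intro borel_measurable_times)
      have eq: "indicator (box l r) x * G x = (indicator (cbox l r) x *\<^sub>R G x) * indicator (box l r) x" for x
        using box_subset_cbox[of l r] by (auto simp: indicator_def)
      show "(\<lambda>x. indicator (box l r) x * G x) \<in> borel_measurable lebesgue"
        unfolding eq using mG
        by (intro borel_measurable_times borel_measurable_indicator) (auto simp: sets_completionI_sets)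
      show "AE x in lebesgue. (\<lambda>n. (indicator (cbox l r) x *\<^sub>R G x) * \<phi> n x) \<longlonglongrightarrow> indicator (box l r) x * G x"
        unfolding eq by (intro AE_I2 tendsto_mult tendsto_const \<phi>(5))
      show "AE x in lebesgue. norm ((indicator (cbox l r) x *\<^sub>R G x) * \<phi> n x) \<le> norm (indicator (cbox l r) x *\<^sub>R G x)" for n
        using \<phi>(3,4)[of n] by (intro AE_I2) (auto simp: abs_mult intro!: mult_left_le)
      show "integrable lebesgue (\<lambda>x. norm (indicator (cbox l r) x *\<^sub>R G x))"
        by (intro integrable_norm intK compact_cbox that)
    qed
    then show ?thesis unfolding z by (simp add: LIMSEQ_const_iff)
  qed
  have AEbox: "AE x in lebesgue. x \<in> cbox a b \<longrightarrow> G x = 0" if ab: "cbox a b \<subseteq> \<Omega>" for a b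
  proof -
    define f where "f x = indicator (box a b) x * G x" for x
    have "integrable lebesgue (\<lambda>x. indicator (box a b) x *\<^sub>R (indicator (cbox a b) x *\<^sub>R G x))"
      by (intro integrable_mult_indicator intK compact_cbox ab) auto
    moreover have "(\<lambda>x. indicator (box a b) x *\<^sub>R (indicator (cbox a b) x *\<^sub>R G x)) = f"
      using box_subset_cbox[of a b] by (intro ext) (auto simp: indicator_def f_def)
    ultimately have f: "integrable lebesgue f" by simp
    \<comment> \<open>G is only Lebesgue measurable, whereas the box criterion is about
      \<open>lborel\<close>; a Borel representative bridges the two.\<close>
    then obtain f' where f'[measurable]: "f' \<in> borel_measurable lborel" and ae: "AE x in lborel. f x = f' x"
      using completion_ex_borel_measurable_real borel_measurable_integrable by blast
    have ae': "AE x in lebesgue. f x = f' x" using AE_completion[OF ae] .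
    have f'c[measurable]: "f' \<in> borel_measurable lebesgue" by (rule measurable_completion) measurable
    have "integrable lebesgue f'"
      using f ae' by (subst integrable_cong_AE[of _ _ f]) (auto dest: borel_measurable_integrable)
    then have f'i: "integrable lborel f'" using f' by (simp add: integrable_completion)
    have "(LINT x:box l r|lborel. f' x) = 0" for l r
    proof -
      have "(LINT x:box l r|lborel. f' x) = (LINT x|lebesgue. indicator (box l r) x *\<^sub>R f' x)"
        unfolding set_lebesgue_integral_def by (rule integral_completion[symmetric]) measurable
      also have "\<dots> = (LINT x|lebesgue. indicator (box l r) x *\<^sub>R f x)"
      proof (rule integral_cong_AE)
        show "(\<lambda>x. indicator (box l r) x *\<^sub>R f x) \<in> borel_measurable lebesgue"
          using borel_measurable_integrable[OF f]
          by (intro borel_measurable_scaleR borel_measurable_indicator) (auto simp: sets_completionI_sets)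
        show "(\<lambda>x. indicator (box l r) x *\<^sub>R f' x) \<in> borel_measurable lebesgue"
          using f'c by (intro borel_measurable_scaleR borel_measurable_indicator) (auto simp: sets_completionI_sets)
      qed (use ae' in auto)
      also have "\<dots> = (LINT x|lebesgue. indicator (box l r \<inter> box a b) x * G x)"
        by (simp add: f_def indicator_inter_arith mult.assoc)
      also have "\<dots> = 0"
      proof (cases "box l r \<inter> box a b = {}")
        case False
        obtain l' r' where lr: "box l r \<inter> box a b = box l' r'" by (rule that[OF box_Int_box])
        have "box l' r' \<subseteq> box a b" "box l' r' \<noteq> {}" "box a b \<noteq> {}" using lr False by auto
        then have "cbox l' r' \<subseteq> cbox a b"
          using closure_mono[of "box l' r'" "box a b"] by (simp add: closure_box)
        then show ?thesis using box0[of l' r'] ab unfolding lr by blast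
      qed simp
      finally show ?thesis .
    qed
    then have "AE x in lborel. f' x = 0" by (rule AE_eq_0_if_box_integrals_eq_0[OF f'i])
    then have "AE x in lebesgue. f' x = 0" by (rule AE_completion)
    \<comment> \<open>\<open>f\<close> was cut off to the open box, so the faces of the closed box
      remain; they form a null set.\<close>
    moreover have "AE x in lebesgue. x \<notin> cbox a b - box a b"
      using negligible_frontier_interval[of a b] by (intro AE_not_in) (simp add: negligible_iff_null_sets)
    ultimately show ?thesis using ae'
      by eventually_elim (auto simp: f_def indicator_def split: if_splits)
  qed
  obtain \<D> where D: "countable \<D>" "\<D> \<subseteq> Pow \<Omega>" "\<And>X. X \<in> \<D> \<Longrightarrow> \<exists>a b. X = cbox a b" "\<Union>\<D> = \<Omega>"
    using open_countable_Union_open_cbox[OF \<Omega>] by blast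
  have "AE x in lebesgue. \<forall>X\<in>\<D>. x \<in> X \<longrightarrow> G x = 0"
    unfolding AE_ball_countable[OF D(1)] using AEbox D(2,3) by (metis PowD subsetD)
  then have "AE x in lebesgue. x \<in> \<Omega> \<longrightarrow> G x = 0"
    by eventually_elim (use D(4) in blast)
  then show ?thesis using \<Omega> by (simp add: AE_restrict_space_iff)
qed

lemma is_weak_grad_unique:
  assumes \<Omega>: "open \<Omega>" and G: "is_weak_grad \<Omega> u G" and H: "is_weak_grad \<Omega> u H"
  shows "AE x in lebesgue_on \<Omega>. G x = H x"
proof -
  have "AE x in lebesgue_on \<Omega>. (G x - H x) \<bullet> b = 0" if b: "b \<in> Basis" for b
  proof (rule fundamental_lemma_variations[OF \<Omega>])
    show "integrable (lebesgue_on K) (\<lambda>x. (G x - H x) \<bullet> b)" if "compact K" "K \<subseteq> \<Omega>" for K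
      using G H that by (intro integrable_inner_left Bochner_Integration.integrable_diff) (auto simp: is_weak_grad_def)
    fix \<phi> assume \<phi>: "\<phi> \<in> test_functions \<Omega>"
    obtain K where K: "compact K" "K \<subseteq> \<Omega>" "\<And>x. x \<notin> K \<Longrightarrow> \<phi> x = 0"
      and "\<And>x. x \<notin> K \<Longrightarrow> grad \<phi> x = 0"
      using test_function_support[OF \<phi>] by blast
    have "integrable (lebesgue_on \<Omega>) (\<lambda>x. (G x \<bullet> b) * \<phi> x)" "integrable (lebesgue_on \<Omega>) (\<lambda>x. (H x \<bullet> b) * \<phi> x)"
      using G H K by (auto intro!: integrable_mult_compact_support[OF _ _ K \<Omega>] integrable_inner_left
          test_function_continuous[OF \<phi>] simp: is_weak_grad_def)
    moreover have "(LINT x|lebesgue_on \<Omega>. (G x \<bullet> b) * \<phi> x) = (LINT x|lebesgue_on \<Omega>. (H x \<bullet> b) * \<phi> x)"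
      using G H \<phi> b unfolding is_weak_grad_def by (metis minus_equation_iff)
    ultimately show "(LINT x|lebesgue_on \<Omega>. ((G x - H x) \<bullet> b) * \<phi> x) = 0"
      by (simp add: inner_diff_left left_diff_distrib)
  qed
  then have "AE x in lebesgue_on \<Omega>. \<forall>b\<in>Basis. (G x - H x) \<bullet> b = 0"
    by (subst AE_ball_countable) (auto simp: countable_finite)
  then show ?thesis
    by eventually_elim (auto simp: inner_diff_left intro: euclidean_eqI)
qed

text \<open>Makes the choice in \<open>weak_grad\<close> harmless: the existence of a candidate
  shows that the chosen field is a weak gradient, and uniqueness identifies it with the
  candidate.\<close>

lemma weak_grad_AE_eq:
  assumes "open \<Omega>" "is_weak_grad \<Omega> u G"
  shows "is_weak_grad \<Omega> u (weak_grad \<Omega> u)" "AE x in lebesgue_on \<Omega>. weak_grad \<Omega> u x = G x"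
proof -
  show "is_weak_grad \<Omega> u (weak_grad \<Omega> u)"
    unfolding weak_grad_def by (rule someI[of "is_weak_grad \<Omega> u", OF assms(2)])
  then show "AE x in lebesgue_on \<Omega>. weak_grad \<Omega> u x = G x"
    by (rule is_weak_grad_unique[OF assms(1) _ assms(2)])
qed

lemma borel_measurable_lebesgue_on_AE:
  fixes f g :: "'a::euclidean_space \<Rightarrow> 'b::euclidean_space"
  assumes "S \<in> sets lebesgue" "f \<in> borel_measurable (lebesgue_on S)" "AE x in lebesgue_on S. f x = g x"
  shows "g \<in> borel_measurable (lebesgue_on S)"
proof -
  have "AE x in lebesgue. (if x \<in> S then f x else 0) = (if x \<in> S then g x else 0)"
    using assms(3) assms(1) by (auto simp: AE_restrict_space_iff)
  then show ?thesis
    by (intro borel_measurable_if_D borel_measurable_AE[OF borel_measurable_if_I[OF assms(2,1)]])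
qed

section \<open>Approximation by test functions\<close>

lemma norm_diff_powr_le:
  fixes a b :: "'a::real_normed_vector"
  assumes "p \<ge> 0"
  shows "norm (a - b) powr p \<le> 2 powr p * (norm a powr p + norm b powr p)"
proof -
  have "norm (a - b) \<le> 2 * max (norm a) (norm b)"
    using norm_triangle_ineq4[of a b] by (auto simp: max_def)
  then have "norm (a - b) powr p \<le> (2 * max (norm a) (norm b)) powr p"
    using assms by (intro powr_mono2) auto
  also have "\<dots> \<le> 2 powr p * (norm a powr p + norm b powr p)"
    by (auto simp: powr_mult max_def)
  finally show ?thesis .
qed

text \<open>If a > \<delta>, then a = a^{1-p} a^p with a^{1-p} <= \<delta>^{1-p}. With its free
  parameter \<delta> this elementary bound takes the place of Hoelder's inequality.\<close>

lemma le_add_powr: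
  fixes a :: real
  assumes "a \<ge> 0" "\<delta> > 0" "p \<ge> 1"
  shows "a \<le> \<delta> + \<delta> powr (1 - p) * a powr p"
proof (cases "a \<le> \<delta>")
  case True
  then show ?thesis by (simp add: add_increasing2)
next
  case False
  then have "a powr (1 - p) \<le> \<delta> powr (1 - p)" using assms by (intro powr_mono2') auto
  then have "a powr (1 - p) * a powr p \<le> \<delta> powr (1 - p) * a powr p" by (intro mult_right_mono) auto
  moreover have "a powr (1 - p) * a powr p = a" using False assms by (simp add: powr_add[symmetric])
  ultimately show ?thesis using assms by linarith
qed

section \<open>Lebesgue spaces and \<open>W10\<close> on a bounded domain\<close>

locale bounded_domain =
  fixes \<Omega> :: "'a::euclidean_space set" and p :: real
  assumes open_\<Omega>: "open \<Omega>" and bounded_\<Omega>: "bounded \<Omega>" and p: "p > 1"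
begin

abbreviation (input) "M\<^sub>\<Omega> \<equiv> lebesgue_on \<Omega>"

lemma finite_measure_domain: "finite_measure M\<^sub>\<Omega>"
  using open_\<Omega> bounded_\<Omega> by (intro finite_measure_lebesgue_on lmeasurable_open)

sublocale finite_measure "M\<^sub>\<Omega>" by (rule finite_measure_domain)

lemma sets_domain: "\<Omega> \<in> sets lebesgue"
  using open_\<Omega> by simp

lemma Lp_measurable: "f \<in> Lp \<Omega> r \<Longrightarrow> f \<in> borel_measurable M\<^sub>\<Omega>"
  and Lp_integrable_powr: "f \<in> Lp \<Omega> r \<Longrightarrow> integrable M\<^sub>\<Omega> (\<lambda>x. norm (f x) powr r)"
  by (auto simp: Lp_def)

lemma Lp_bounded_by:
  assumes "f \<in> borel_measurable M\<^sub>\<Omega>" "g \<in> Lp \<Omega> p" "AE x in M\<^sub>\<Omega>. norm (f x) \<le> L * norm (g x)" "L \<ge> 0"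
  shows "f \<in> Lp \<Omega> p"
proof -
  have "integrable M\<^sub>\<Omega> (\<lambda>x. norm (f x) powr p)"
  proof (rule Bochner_Integration.integrable_bound)
    show "integrable M\<^sub>\<Omega> (\<lambda>x. L powr p * norm (g x) powr p)"
      using Lp_integrable_powr[OF assms(2)] by simp
    show "AE x in M\<^sub>\<Omega>. norm (norm (f x) powr p) \<le> norm (L powr p * norm (g x) powr p)"
      using assms(3)
    proof eventually_elim
      case (elim x)
      then have "norm (f x) powr p \<le> (L * norm (g x)) powr p" using p by (intro powr_mono2) auto
      then show ?case using assms(4) by (simp add: powr_mult)
    qed
    show "(\<lambda>x. norm (f x) powr p) \<in> borel_measurable M\<^sub>\<Omega>" using assms(1) by measurable
  qed
  then show ?thesis using assms(1) by (simp add: Lp_def)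
qed

lemma Lp_diff:
  fixes f g :: "'a \<Rightarrow> 'b::euclidean_space"
  assumes "f \<in> Lp \<Omega> p" "g \<in> Lp \<Omega> p"
  shows "(\<lambda>x. f x - g x) \<in> Lp \<Omega> p"
proof -
  note [measurable] = Lp_measurable[OF assms(1)] Lp_measurable[OF assms(2)]
  have "integrable M\<^sub>\<Omega> (\<lambda>x. norm (f x - g x) powr p)"
  proof (rule Bochner_Integration.integrable_bound)
    show "integrable M\<^sub>\<Omega> (\<lambda>x. 2 powr p * (norm (f x) powr p + norm (g x) powr p))"
      using Lp_integrable_powr[OF assms(1)] Lp_integrable_powr[OF assms(2)] by simp
    show "AE x in M\<^sub>\<Omega>. norm (norm (f x - g x) powr p) \<le> norm (2 powr p * (norm (f x) powr p + norm (g x) powr p))"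
      using norm_diff_powr_le[of p] p by (intro AE_I2) simp
    show "(\<lambda>x. norm (f x - g x) powr p) \<in> borel_measurable M\<^sub>\<Omega>" by measurable
  qed
  then show ?thesis by (simp add: Lp_def)
qed

lemma Lp_imp_integrable:
  fixes f :: "'a \<Rightarrow> 'b::euclidean_space"
  assumes "f \<in> Lp \<Omega> r" "r \<ge> 1"
  shows "integrable M\<^sub>\<Omega> f"
proof (rule Bochner_Integration.integrable_bound)
  show "integrable M\<^sub>\<Omega> (\<lambda>x. 1 + norm (f x) powr r)" using Lp_integrable_powr[OF assms(1)] by simp
  show "AE x in M\<^sub>\<Omega>. norm (f x) \<le> norm (1 + norm (f x) powr r)"
    using le_add_powr[of _ 1 r] assms(2) by (intro AE_I2) simp
qed (rule Lp_measurable[OF assms(1)])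

text \<open>On a space of finite measure, integrating \<open>le_add_powr\<close> bounds the L^1 norm
  by a multiple of \<delta> plus a multiple of the integral of the p-th power. First \<delta> is
  made small, then n large.\<close>

lemma L1_tendsto_of_Lp_tendsto:
  fixes f :: "nat \<Rightarrow> 'a \<Rightarrow> 'b::euclidean_space"
  assumes f: "\<And>n. f n \<in> Lp \<Omega> p" and lim: "(\<lambda>n. LINT x|M\<^sub>\<Omega>. norm (f n x) powr p) \<longlonglongrightarrow> 0"
  shows "(\<lambda>n. LINT x|M\<^sub>\<Omega>. norm (f n x)) \<longlonglongrightarrow> 0"
proof (rule LIMSEQ_I)
  fix e :: real assume e: "e > 0"
  define m where "m = measure M\<^sub>\<Omega> \<Omega>"
  \<comment> \<open>Adding 1 keeps the denominator positive even when the domain has measure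
    0.\<close>
  define \<delta> where "\<delta> = e / (2 * (m + 1))"
  have m: "m \<ge> 0" and \<delta>: "\<delta> > 0" using e by (auto simp: m_def \<delta>_def intro!: divide_pos_pos add_nonneg_pos)
  have b: "(LINT x|M\<^sub>\<Omega>. norm (f n x)) \<le> \<delta> * m + \<delta> powr (1 - p) * (LINT x|M\<^sub>\<Omega>. norm (f n x) powr p)" for n
  proof -
    have "(LINT x|M\<^sub>\<Omega>. norm (f n x)) \<le> (LINT x|M\<^sub>\<Omega>. \<delta> + \<delta> powr (1 - p) * norm (f n x) powr p)"
      using Lp_imp_integrable[OF f] Lp_integrable_powr[OF f] p \<delta>
      by (intro integral_mono integrable_norm Bochner_Integration.integrable_add integrable_mult_right le_add_powr) auto
    also have "\<dots> = \<delta> * m + \<delta> powr (1 - p) * (LINT x|M\<^sub>\<Omega>. norm (f n x) powr p)"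
      using Lp_integrable_powr[OF f] by (simp add: m_def)
    finally show ?thesis .
  qed
  have "(\<lambda>n. \<delta> * m + \<delta> powr (1 - p) * (LINT x|M\<^sub>\<Omega>. norm (f n x) powr p)) \<longlonglongrightarrow> \<delta> * m + \<delta> powr (1 - p) * 0"
    by (intro tendsto_intros lim)
  moreover have "\<delta> * m + \<delta> powr (1 - p) * 0 < e"
  proof -
    have "\<delta> * m \<le> \<delta> * (m + 1)" using \<delta> by simp
    also have "\<dots> = e / 2" using m by (simp add: \<delta>_def field_simps)
    finally show ?thesis using e by simp
  qed
  ultimately have "\<forall>\<^sub>F n in sequentially. \<delta> * m + \<delta> powr (1 - p) * (LINT x|M\<^sub>\<Omega>. norm (f n x) powr p) < e"
    by (rule order_tendstoD)
  then have "\<forall>\<^sub>F n in sequentially. norm ((LINT x|M\<^sub>\<Omega>. norm (f n x)) - 0) < e"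
  proof eventually_elim
    case (elim n)
    have "0 \<le> (LINT x|M\<^sub>\<Omega>. norm (f n x))" by simp
    then show ?case using elim b[of n] by simp
  qed
  then show "\<exists>no. \<forall>n\<ge>no. norm ((LINT x|M\<^sub>\<Omega>. norm (f n x)) - 0) < e"
    by (simp add: eventually_sequentially)
qed

lemma continuous_compact_support_Lp:
  fixes f :: "'a \<Rightarrow> 'b::euclidean_space"
  assumes "continuous_on UNIV f" "compact K" "\<And>x. x \<notin> K \<Longrightarrow> f x = 0"
  shows "f \<in> Lp \<Omega> p"
proof -
  obtain B where B: "B \<ge> 0" "\<And>x. norm (f x) \<le> B"
    using bounded_continuous_compact_support[OF assms] by auto
  have m: "f \<in> borel_measurable M\<^sub>\<Omega>"
    using assms(1) by (intro measurable_restrict_space1 measurable_completion) (simp add: borel_measurable_continuous_onI)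
  have "integrable M\<^sub>\<Omega> (\<lambda>x. norm (f x) powr p)"
  proof (rule integrable_const_bound[where B = "B powr p"])
    show "AE x in M\<^sub>\<Omega>. norm (norm (f x) powr p) \<le> B powr p"
      using B p by (intro AE_I2) (simp add: powr_mono2)
    show "(\<lambda>x. norm (f x) powr p) \<in> borel_measurable M\<^sub>\<Omega>" using m by measurable
  qed
  then show ?thesis using m by (simp add: Lp_def)
qed

lemma test_function_Lp:
  assumes "\<phi> \<in> test_functions \<Omega>"
  shows "\<phi> \<in> Lp \<Omega> p" "grad \<phi> \<in> Lp \<Omega> p"
proof -
  obtain K where K: "compact K" "K \<subseteq> \<Omega>" "\<And>x. x \<notin> K \<Longrightarrow> \<phi> x = 0" "\<And>x. x \<notin> K \<Longrightarrow> grad \<phi> x = 0"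
    using test_function_support[OF assms] by blast
  show "\<phi> \<in> Lp \<Omega> p" "grad \<phi> \<in> Lp \<Omega> p"
    using continuous_compact_support_Lp[OF _ K(1)] test_function_continuous[OF assms] K by auto
qed

lemma W10_approx:
  assumes u: "u \<in> W10 \<Omega> p"
  obtains \<phi> where "\<And>n. \<phi> n \<in> test_functions \<Omega>"
    "(\<lambda>n. LINT x|M\<^sub>\<Omega>. norm (u x - \<phi> n x) powr p) \<longlonglongrightarrow> 0"
    "(\<lambda>n. LINT x|M\<^sub>\<Omega>. norm (weak_grad \<Omega> u x - grad (\<phi> n) x) powr p) \<longlonglongrightarrow> 0"
proof -
  have "\<forall>n. \<exists>\<phi>\<in>test_functions \<Omega>. Lp_norm \<Omega> p (\<lambda>x. u x - \<phi> x)
      + Lp_norm \<Omega> p (\<lambda>x. weak_grad \<Omega> u x - grad \<phi> x) < 1 / real (Suc n)"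
    using u unfolding W10_def by simp
  then obtain \<phi> where \<phi>: "\<And>n. \<phi> n \<in> test_functions \<Omega>"
    "\<And>n. Lp_norm \<Omega> p (\<lambda>x. u x - \<phi> n x) + Lp_norm \<Omega> p (\<lambda>x. weak_grad \<Omega> u x - grad (\<phi> n) x) < 1 / real (Suc n)"
    by metis
  have *: "(\<lambda>n. I n) \<longlonglongrightarrow> 0" if "\<And>n. I n \<ge> 0" "\<And>n. I n powr (1 / p) \<le> 1 / real (Suc n)" for I :: "nat \<Rightarrow> real"
  proof (rule tendsto_sandwich[OF _ _ tendsto_const])
    show "(\<lambda>n. (1 / real (Suc n)) powr p) \<longlonglongrightarrow> 0"
      using p by (intro tendsto_zero_powrI[where b = p] LIMSEQ_inverse_real_of_nat[unfolded inverse_eq_divide] tendsto_const) auto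
    have "I n \<le> (1 / real (Suc n)) powr p" for n
    proof -
      have "(I n powr (1 / p)) powr p \<le> (1 / real (Suc n)) powr p"
        using that p by (intro powr_mono2) auto
      then show ?thesis using that(1)[of n] p by (simp add: powr_powr)
    qed
    then show "\<forall>\<^sub>F n in sequentially. I n \<le> (1 / real (Suc n)) powr p" by simp
  qed (use that in simp)
  have nn: "0 \<le> Lp_norm \<Omega> p g" for g :: "'a \<Rightarrow> 'c::euclidean_space" by (simp add: Lp_norm_def)
  show ?thesis
  proof (rule that[OF \<phi>(1)]; rule *)
    fix n
    show "(LINT x|M\<^sub>\<Omega>. norm (u x - \<phi> n x) powr p) powr (1 / p) \<le> 1 / real (Suc n)"
      using \<phi>(2)[of n] nn[of "\<lambda>x. weak_grad \<Omega> u x - grad (\<phi> n) x"] unfolding Lp_norm_def by linarith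
    show "(LINT x|M\<^sub>\<Omega>. norm (weak_grad \<Omega> u x - grad (\<phi> n) x) powr p) powr (1 / p) \<le> 1 / real (Suc n)"
      using \<phi>(2)[of n] nn[of "\<lambda>x. u x - \<phi> n x"] unfolding Lp_norm_def by linarith
  qed auto
qed

lemma W10_Lp:
  assumes u: "u \<in> W10 \<Omega> p"
  shows "u \<in> Lp \<Omega> p" "weak_grad \<Omega> u \<in> Lp \<Omega> p" "is_weak_grad \<Omega> u (weak_grad \<Omega> u)"
proof -
  obtain G where G: "G \<in> Lp \<Omega> p" "is_weak_grad \<Omega> u G"
    using u by (auto simp: W10_def W1_def)
  show "u \<in> Lp \<Omega> p" using u by (simp add: W10_def W1_def)
  show "is_weak_grad \<Omega> u (weak_grad \<Omega> u)" by (rule weak_grad_AE_eq[OF open_\<Omega> G(2)])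
  have ae: "AE x in M\<^sub>\<Omega>. weak_grad \<Omega> u x = G x" by (rule weak_grad_AE_eq[OF open_\<Omega> G(2)])
  have "weak_grad \<Omega> u \<in> borel_measurable M\<^sub>\<Omega>"
    by (rule borel_measurable_lebesgue_on_AE[OF sets_domain Lp_measurable[OF G(1)]]) (use ae in auto)
  then show "weak_grad \<Omega> u \<in> Lp \<Omega> p"
    by (rule Lp_bounded_by[OF _ G(1), where L = 1]) (use ae in auto)
qed

text \<open>The defining identity of the weak gradient survives the limit because test functions and
  their gradients are bounded, so that convergence in L^1 is enough. The second claim is the means
  by which weak gradients of composed functions are computed.\<close>

lemma W10_limit:
  assumes w: "w \<in> Lp \<Omega> p" and G: "G \<in> Lp \<Omega> p" and \<phi>: "\<And>n. \<phi> n \<in> test_functions \<Omega>"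
    and lim_w: "(\<lambda>n. LINT x|M\<^sub>\<Omega>. norm (w x - \<phi> n x) powr p) \<longlonglongrightarrow> 0"
    and lim_G: "(\<lambda>n. LINT x|M\<^sub>\<Omega>. norm (G x - grad (\<phi> n) x) powr p) \<longlonglongrightarrow> 0"
  shows "w \<in> W10 \<Omega> p" "AE x in M\<^sub>\<Omega>. weak_grad \<Omega> w x = G x"
proof -
  have dw: "(\<lambda>x. w x - \<phi> n x) \<in> Lp \<Omega> p" for n by (intro Lp_diff w test_function_Lp \<phi>)
  have dG: "(\<lambda>x. G x - grad (\<phi> n) x) \<in> Lp \<Omega> p" for n by (intro Lp_diff G test_function_Lp \<phi>)
  note w1 = L1_tendsto_of_Lp_tendsto[OF dw lim_w] and G1 = L1_tendsto_of_Lp_tendsto[OF dG lim_G]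
  note iw = Lp_imp_integrable[OF w less_imp_le[OF p]] and iG = Lp_imp_integrable[OF G less_imp_le[OF p]]
  have conv: "(\<lambda>n. LINT x|M\<^sub>\<Omega>. f n x * \<psi> x) \<longlonglongrightarrow> (LINT x|M\<^sub>\<Omega>. f0 x * \<psi> x)"
    if f: "\<And>n. integrable M\<^sub>\<Omega> (f n)" "integrable M\<^sub>\<Omega> f0" and l: "(\<lambda>n. LINT x|M\<^sub>\<Omega>. norm (f0 x - f n x)) \<longlonglongrightarrow> 0"
      and \<psi>: "\<And>x. norm (\<psi> x) \<le> B" "\<psi> \<in> borel_measurable M\<^sub>\<Omega>" for f0 \<psi> :: "'a \<Rightarrow> real" and f :: "nat \<Rightarrow> 'a \<Rightarrow> real" and B
  proof -
    have B: "B \<ge> 0" using \<psi>(1) norm_ge_zero order_trans by blast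
    have im: "integrable M\<^sub>\<Omega> (\<lambda>x. g x * \<psi> x)" if "integrable M\<^sub>\<Omega> g" for g
    proof (rule Bochner_Integration.integrable_bound)
      show "integrable M\<^sub>\<Omega> (\<lambda>x. B * norm (g x))" using that by simp
      show "AE x in M\<^sub>\<Omega>. norm (g x * \<psi> x) \<le> norm (B * norm (g x))"
        using \<psi>(1) B by (intro AE_I2) (simp add: abs_mult mult.commute[of B] mult_left_mono)
    qed (use that \<psi>(2) in auto)
    have "(\<lambda>n. (LINT x|M\<^sub>\<Omega>. f n x * \<psi> x) - (LINT x|M\<^sub>\<Omega>. f0 x * \<psi> x)) \<longlonglongrightarrow> 0"
    proof (rule Lim_null_comparison)
      show "(\<lambda>n. B * (LINT x|M\<^sub>\<Omega>. norm (f0 x - f n x))) \<longlonglongrightarrow> 0" using tendsto_mult_right_zero[OF l] by simp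
      show "\<forall>\<^sub>F n in sequentially. norm ((LINT x|M\<^sub>\<Omega>. f n x * \<psi> x) - (LINT x|M\<^sub>\<Omega>. f0 x * \<psi> x))
          \<le> B * (LINT x|M\<^sub>\<Omega>. norm (f0 x - f n x))"
      proof (rule always_eventually, rule allI)
        fix n
        have "(LINT x|M\<^sub>\<Omega>. f n x * \<psi> x) - (LINT x|M\<^sub>\<Omega>. f0 x * \<psi> x) = (LINT x|M\<^sub>\<Omega>. f n x * \<psi> x - f0 x * \<psi> x)"
          using im f by simp
        also have "norm \<dots> \<le> (LINT x|M\<^sub>\<Omega>. norm (f n x * \<psi> x - f0 x * \<psi> x))" by (rule integral_norm_bound)
        also have "\<dots> \<le> (LINT x|M\<^sub>\<Omega>. B * norm (f0 x - f n x))"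
        proof (rule integral_mono)
          show "integrable M\<^sub>\<Omega> (\<lambda>x. norm (f n x * \<psi> x - f0 x * \<psi> x))" using im f by simp
          show "integrable M\<^sub>\<Omega> (\<lambda>x. B * norm (f0 x - f n x))" using f by simp
          fix x
          have "norm (f n x * \<psi> x - f0 x * \<psi> x) = norm (f0 x - f n x) * norm (\<psi> x)"
            by (simp add: left_diff_distrib[symmetric] abs_mult abs_minus_commute)
          also have "\<dots> \<le> norm (f0 x - f n x) * B" by (intro mult_left_mono \<psi>) auto
          finally show "norm (f n x * \<psi> x - f0 x * \<psi> x) \<le> B * norm (f0 x - f n x)" by (simp add: mult.commute)
        qed
        finally show "norm ((LINT x|M\<^sub>\<Omega>. f n x * \<psi> x) - (LINT x|M\<^sub>\<Omega>. f0 x * \<psi> x))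
          \<le> B * (LINT x|M\<^sub>\<Omega>. norm (f0 x - f n x))" using f by simp
      qed
    qed
    then show ?thesis by (simp add: LIM_zero_iff)
  qed
  have wg: "is_weak_grad \<Omega> w G"
    unfolding is_weak_grad_def
  proof (intro conjI allI impI ballI)
    have sub: "integrable (lebesgue_on K) g" if "integrable M\<^sub>\<Omega> g" "compact K \<and> K \<subseteq> \<Omega>"
      for g :: "'a \<Rightarrow> 'c::euclidean_space" and K
    proof -
      have "integrable lebesgue (\<lambda>x. indicator K x *\<^sub>R (indicator \<Omega> x *\<^sub>R g x))"
        using that sets_domain by (intro integrable_mult_indicator[where f = "\<lambda>x. indicator \<Omega> x *\<^sub>R g x"]) (auto simp: integrable_restrict_space borel_compact)
      moreover have "(\<lambda>x. indicator K x *\<^sub>R (indicator \<Omega> x *\<^sub>R g x)) = (\<lambda>x. indicator K x *\<^sub>R g x)"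
        using that by (intro ext) (auto simp: indicator_def)
      ultimately show ?thesis using that(2) by (simp add: integrable_restrict_space borel_compact)
    qed
    fix K assume K: "compact K \<and> K \<subseteq> \<Omega>"
    show "integrable (lebesgue_on K) w" by (rule sub[OF iw K])
    show "integrable (lebesgue_on K) G" by (rule sub[OF iG K])
  next
    fix \<psi> and b :: 'a assume \<psi>: "\<psi> \<in> test_functions \<Omega>" and b: "b \<in> Basis"
    obtain K where K: "compact K" "K \<subseteq> \<Omega>" "\<And>x. x \<notin> K \<Longrightarrow> \<psi> x = 0" "\<And>x. x \<notin> K \<Longrightarrow> grad \<psi> x = 0"
      using test_function_support[OF \<psi>] by blast
    obtain B1 where B1: "\<And>x. norm (\<psi> x) \<le> B1"
      using bounded_continuous_compact_support[OF test_function_continuous(1)[OF \<psi>] K(1,3)] by auto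
    obtain B2 where B2: "\<And>x. norm (grad \<psi> x) \<le> B2"
      using bounded_continuous_compact_support[OF test_function_continuous(2)[OF \<psi>] K(1,4)] by auto
    have B2': "norm (grad \<psi> x \<bullet> b) \<le> B2" for x
      using Basis_le_norm[OF b, of "grad \<psi> x"] B2[of x] by simp
    note [measurable] = Lp_measurable[OF test_function_Lp(1)[OF \<psi>]] Lp_measurable[OF test_function_Lp(2)[OF \<psi>]]
    have i\<phi>: "integrable M\<^sub>\<Omega> (\<phi> n)" "integrable M\<^sub>\<Omega> (grad (\<phi> n))" for n
      using Lp_imp_integrable[OF _ less_imp_le[OF p]] test_function_Lp[OF \<phi>] by auto
    have "(\<lambda>n. LINT x|M\<^sub>\<Omega>. \<phi> n x * (grad \<psi> x \<bullet> b)) \<longlonglongrightarrow> (LINT x|M\<^sub>\<Omega>. w x * (grad \<psi> x \<bullet> b))"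
      by (rule conv[OF i\<phi>(1) iw w1 B2']) measurable
    moreover have "(\<lambda>n. LINT x|M\<^sub>\<Omega>. (grad (\<phi> n) x \<bullet> b) * \<psi> x) \<longlonglongrightarrow> (LINT x|M\<^sub>\<Omega>. (G x \<bullet> b) * \<psi> x)"
    proof (rule conv[OF _ _ _ B1])
      show "(\<lambda>n. LINT x|M\<^sub>\<Omega>. norm (G x \<bullet> b - grad (\<phi> n) x \<bullet> b)) \<longlonglongrightarrow> 0"
      proof (rule tendsto_sandwich[OF _ _ tendsto_const G1])
        show "\<forall>\<^sub>F n in sequentially. (LINT x|M\<^sub>\<Omega>. norm (G x \<bullet> b - grad (\<phi> n) x \<bullet> b)) \<le> (LINT x|M\<^sub>\<Omega>. norm (G x - grad (\<phi> n) x))"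
        proof (intro always_eventually allI integral_mono)
          fix n x
          show "norm (G x \<bullet> b - grad (\<phi> n) x \<bullet> b) \<le> norm (G x - grad (\<phi> n) x)"
            using Basis_le_norm[OF b, of "G x - grad (\<phi> n) x"] by (simp add: inner_diff_left)
        qed (use i\<phi> iG in \<open>auto intro!: integrable_norm\<close>)
      qed simp
    qed (use i\<phi> iG in auto)
    moreover have "(LINT x|M\<^sub>\<Omega>. \<phi> n x * (grad \<psi> x \<bullet> b)) = - (LINT x|M\<^sub>\<Omega>. (grad (\<phi> n) x \<bullet> b) * \<psi> x)" for n
      using is_weak_grad_test_function[OF \<phi> open_\<Omega>] \<psi> b by (simp add: is_weak_grad_def)
    ultimately have "(\<lambda>n. - (LINT x|M\<^sub>\<Omega>. (grad (\<phi> n) x \<bullet> b) * \<psi> x)) \<longlonglongrightarrow> (LINT x|M\<^sub>\<Omega>. w x * (grad \<psi> x \<bullet> b))"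
      "(\<lambda>n. - (LINT x|M\<^sub>\<Omega>. (grad (\<phi> n) x \<bullet> b) * \<psi> x)) \<longlonglongrightarrow> - (LINT x|M\<^sub>\<Omega>. (G x \<bullet> b) * \<psi> x)"
      by (auto intro: tendsto_minus)
    then show "(LINT x|M\<^sub>\<Omega>. w x * (grad \<psi> x \<bullet> b)) = - (LINT x|M\<^sub>\<Omega>. (G x \<bullet> b) * \<psi> x)"
      by (rule LIMSEQ_unique)
  qed
  \<comment> \<open>\<open>W10\<close> is defined through the chosen \<open>weak_grad\<close>, so
    this field has to replace G under the integrals before membership can be concluded.\<close>
  show ae: "AE x in M\<^sub>\<Omega>. weak_grad \<Omega> w x = G x" by (rule weak_grad_AE_eq[OF open_\<Omega> wg])
  have mw: "weak_grad \<Omega> w \<in> borel_measurable M\<^sub>\<Omega>"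
    by (rule borel_measurable_lebesgue_on_AE[OF sets_domain Lp_measurable[OF G]]) (use ae in auto)
  note [measurable] = Lp_measurable[OF G] Lp_measurable[OF test_function_Lp(2)[OF \<phi>]] mw
  have eq: "(LINT x|M\<^sub>\<Omega>. norm (weak_grad \<Omega> w x - grad (\<phi> n) x) powr p) = (LINT x|M\<^sub>\<Omega>. norm (G x - grad (\<phi> n) x) powr p)" for n
    by (rule integral_cong_AE) (use ae in auto)
  have lim0: "(\<lambda>n. I n powr (1 / p)) \<longlonglongrightarrow> 0" if "I \<longlonglongrightarrow> 0" "\<And>n. 0 \<le> I n" for I :: "nat \<Rightarrow> real"
    using that p by (intro tendsto_zero_powrI[where b = "1 / p"] tendsto_const) auto
  have "(\<lambda>n. Lp_norm \<Omega> p (\<lambda>x. w x - \<phi> n x) + Lp_norm \<Omega> p (\<lambda>x. weak_grad \<Omega> w x - grad (\<phi> n) x)) \<longlonglongrightarrow> 0 + 0"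
    unfolding Lp_norm_def eq by (intro tendsto_add lim0 lim_w lim_G) auto
  note sum0 = this
  have "\<exists>\<phi>\<in>test_functions \<Omega>. Lp_norm \<Omega> p (\<lambda>x. w x - \<phi> x) + Lp_norm \<Omega> p (\<lambda>x. weak_grad \<Omega> w x - grad \<phi> x) < \<epsilon>"
    if "\<epsilon> > 0" for \<epsilon>
  proof -
    have "\<forall>\<^sub>F n in sequentially. Lp_norm \<Omega> p (\<lambda>x. w x - \<phi> n x) + Lp_norm \<Omega> p (\<lambda>x. weak_grad \<Omega> w x - grad (\<phi> n) x) < \<epsilon>"
      using order_tendstoD(2)[OF sum0] that by simp
    then show ?thesis using \<phi> by (auto simp: eventually_sequentially)
  qed
  then show "w \<in> W10 \<Omega> p" using w G wg by (auto simp: W10_def W1_def)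
qed

end

section \<open>The chain rule and the weak-type inequality in \<open>W10\<close>\<close>

lemma test_function_compose:
  assumes "\<phi> \<in> test_functions \<Omega>" "\<And>k. Ck k F" "F 0 = 0"
  shows "(\<lambda>x. F (\<phi> x)) \<in> test_functions \<Omega>" "grad (\<lambda>x. F (\<phi> x)) x = deriv F (\<phi> x) *\<^sub>R grad \<phi> x"
proof -
  obtain K where K: "compact K" "K \<subseteq> \<Omega>" "\<And>x. x \<notin> K \<Longrightarrow> \<phi> x = 0" "\<And>x. x \<notin> K \<Longrightarrow> grad \<phi> x = 0"
    using test_function_support[OF assms(1)] by blast
  have "Ck k \<phi>" for k using assms(1) by (auto simp: test_functions_def)
  then have "Ck k (\<lambda>x. F (\<phi> x))" for k by (rule Ck_compose[OF assms(2)])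
  \<comment> \<open>F 0 = 0 makes the composite vanish wherever \<phi> does, so its support stays
    inside the compact set K.\<close>
  then show t: "(\<lambda>x. F (\<phi> x)) \<in> test_functions \<Omega>"
    by (rule test_functionI[OF _ K(1,2)]) (simp add: K(3) assms(3))
  have "((\<lambda>x. F (\<phi> x)) has_derivative (\<lambda>v. (deriv F (\<phi> x) *\<^sub>R grad \<phi> x) \<bullet> v)) (at x)"
    using has_derivative_compose[OF test_function_derivative[OF assms(1)]
        Ck_real_deriv(1)[OF assms(2), unfolded has_field_derivative_def]] by simp
  from has_derivative_unique[OF test_function_derivative[OF t] this]
  have "grad (\<lambda>x. F (\<phi> x)) x \<bullet> v = (deriv F (\<phi> x) *\<^sub>R grad \<phi> x) \<bullet> v" for v by (rule fun_cong)
  then show "grad (\<lambda>x. F (\<phi> x)) x = deriv F (\<phi> x) *\<^sub>R grad \<phi> x"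
    by (auto intro: euclidean_eqI)
qed

context bounded_domain
begin

text \<open>If \<phi> n approximates u, then F(\<phi> n) are test functions approximating F(u). The
  error of the gradients splits into (F'(u) - F'(\<phi> n)) grad u, which tends to 0 by dominated
  convergence, and F'(\<phi> n) (grad u - grad (\<phi> n)), which the bound L controls.
  \<open>W10_limit\<close> then gives both claims.\<close>

lemma W10_chain_rule:
  assumes u: "u \<in> W10 \<Omega> p" and F: "\<And>k. Ck k F" "F 0 = 0" "\<And>s. \<bar>deriv F s\<bar> \<le> L"
  shows "(\<lambda>x. F (u x)) \<in> W10 \<Omega> p"
    "AE x in lebesgue_on \<Omega>. weak_grad \<Omega> (\<lambda>x. F (u x)) x = deriv F (u x) *\<^sub>R weak_grad \<Omega> u x"
proof -
  let ?M = "lebesgue_on \<Omega>" and ?G = "weak_grad \<Omega> u"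
  note DF = Ck_real_deriv[OF F(1)]
  have L: "L \<ge> 0" using F(3)[of 0] by linarith
  note uL = W10_Lp(1)[OF u] and GL = W10_Lp(2)[OF u]
  have contF: "continuous_on UNIV F" using F(1)[of 0] by simp
  have lip: "\<bar>F s - F t\<bar> \<le> L * \<bar>s - t\<bar>" for s t
  proof -
    have "norm (F s - F t) \<le> L * norm (s - t)"
      by (rule field_differentiable_bound[OF convex_UNIV, of F "deriv F" L]) (simp_all add: DF(1) F(3))
    then show ?thesis by simp
  qed
  have lip0: "\<bar>F s\<bar> \<le> L * \<bar>s\<bar>" for s using lip[of s 0] F(2) by simp
  obtain \<phi>0 where \<phi>0: "\<And>n. \<phi>0 n \<in> test_functions \<Omega>"
    "(\<lambda>n. LINT x|?M. norm (u x - \<phi>0 n x) powr p) \<longlonglongrightarrow> 0"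
    "(\<lambda>n. LINT x|?M. norm (?G x - grad (\<phi>0 n) x) powr p) \<longlonglongrightarrow> 0"
    by (rule W10_approx[OF u]) (rule that)
  have uphi0: "integrable ?M (\<lambda>x. norm (u x - \<phi>0 n x) powr p)" for n
    by (rule Lp_integrable_powr[OF Lp_diff[OF uL test_function_Lp(1)[OF \<phi>0(1)]]])
  \<comment> \<open>Convergence of the integrals yields pointwise convergence only along a
    subsequence; the dominated convergence for \<open>I1\<close> below needs the latter.\<close>
  obtain r where r: "strict_mono r" "AE x in ?M. (\<lambda>n. norm (u x - \<phi>0 (r n) x) powr p) \<longlonglongrightarrow> 0"
  proof -
    have "\<exists>r::nat\<Rightarrow>nat. strict_mono r \<and> (AE x in ?M. (\<lambda>n. norm (u x - \<phi>0 (r n) x) powr p) \<longlonglongrightarrow> 0)"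
      by (rule tendsto_L1_AE_subseq[where u = "\<lambda>n x. norm (u x - \<phi>0 n x) powr p"])
        (use uphi0 \<phi>0(2) in simp_all)
    then show ?thesis using that by blast
  qed
  define \<phi> where "\<phi> n = \<phi>0 (r n)" for n
  have \<phi>: "\<phi> n \<in> test_functions \<Omega>" for n by (simp add: \<phi>_def \<phi>0)
  have \<phi>u: "(\<lambda>n. LINT x|?M. norm (u x - \<phi> n x) powr p) \<longlonglongrightarrow> 0"
    using LIMSEQ_subseq_LIMSEQ[OF \<phi>0(2) r(1)] by (simp add: \<phi>_def o_def)
  have \<phi>G: "(\<lambda>n. LINT x|?M. norm (?G x - grad (\<phi> n) x) powr p) \<longlonglongrightarrow> 0"
    using LIMSEQ_subseq_LIMSEQ[OF \<phi>0(3) r(1)] by (simp add: \<phi>_def o_def)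
  have ae: "AE x in ?M. (\<lambda>n. \<phi> n x) \<longlonglongrightarrow> u x"
    using r(2)
  proof eventually_elim
    case (elim x)
    have "(\<lambda>n. (norm (u x - \<phi> n x) powr p) powr (1 / p)) \<longlonglongrightarrow> 0"
      using elim p unfolding \<phi>_def
      by (intro tendsto_zero_powrI[where f = "\<lambda>n. norm (u x - \<phi>0 (r n) x) powr p" and b = "1 / p"] tendsto_const) auto
    then have "(\<lambda>n. norm (u x - \<phi> n x)) \<longlonglongrightarrow> 0" using p by (simp add: powr_powr)
    then have "(\<lambda>n. u x - \<phi> n x) \<longlonglongrightarrow> 0" by (rule tendsto_norm_zero_cancel)
    from tendsto_diff[OF tendsto_const[of "u x"] this] show ?case by simp
  qed
  note dgm[measurable] = borel_measurable_continuous_onI[OF DF(2)] borel_measurable_continuous_onI[OF contF]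
  have um[measurable]: "u \<in> borel_measurable ?M" "?G \<in> borel_measurable ?M"
    by (rule Lp_measurable[OF uL] Lp_measurable[OF GL])+
  have \<phi>m[measurable]: "\<phi> n \<in> borel_measurable ?M" "grad (\<phi> n) \<in> borel_measurable ?M" for n
    by (rule Lp_measurable[OF test_function_Lp(1)[OF \<phi>]] Lp_measurable[OF test_function_Lp(2)[OF \<phi>]])+
  define H where "H x = deriv F (u x) *\<^sub>R ?G x" for x
  have wL: "(\<lambda>x. F (u x)) \<in> Lp \<Omega> p"
    by (rule Lp_bounded_by[OF _ uL _ L]) (use lip0 in auto)
  have HL: "H \<in> Lp \<Omega> p" unfolding H_def
    by (rule Lp_bounded_by[OF _ GL _ L]) (use F(3) in \<open>auto intro!: mult_right_mono\<close>)
  note T = test_function_compose[OF \<phi> F(1,2)]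
  have uphi: "integrable ?M (\<lambda>x. norm (u x - \<phi> n x) powr p)" for n
    by (rule Lp_integrable_powr[OF Lp_diff[OF uL test_function_Lp(1)[OF \<phi>]]])
  have Gphi: "integrable ?M (\<lambda>x. norm (?G x - grad (\<phi> n) x) powr p)" for n
    by (rule Lp_integrable_powr[OF Lp_diff[OF GL test_function_Lp(2)[OF \<phi>]]])
  have 1: "(\<lambda>n. LINT x|?M. norm (F (u x) - F (\<phi> n x)) powr p) \<longlonglongrightarrow> 0"
  proof (rule tendsto_sandwich[OF _ _ tendsto_const])
    show "(\<lambda>n. L powr p * (LINT x|?M. norm (u x - \<phi> n x) powr p)) \<longlonglongrightarrow> 0"
      using tendsto_mult_right_zero[OF \<phi>u] by simp
    have "(LINT x|?M. norm (F (u x) - F (\<phi> n x)) powr p) \<le> (LINT x|?M. L powr p * norm (u x - \<phi> n x) powr p)" for n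
    proof (rule integral_mono)
      show "integrable ?M (\<lambda>x. norm (F (u x) - F (\<phi> n x)) powr p)"
        by (rule Lp_integrable_powr[OF Lp_diff[OF wL test_function_Lp(1)[OF T(1)]]])
      show "integrable ?M (\<lambda>x. L powr p * norm (u x - \<phi> n x) powr p)" using uphi by simp
      show "norm (F (u x) - F (\<phi> n x)) powr p \<le> L powr p * norm (u x - \<phi> n x) powr p" for x
      proof -
        have "norm (F (u x) - F (\<phi> n x)) powr p \<le> (L * norm (u x - \<phi> n x)) powr p"
          using lip p by (intro powr_mono2) auto
        then show ?thesis using L by (simp add: powr_mult)
      qed
    qed
    then show "\<forall>\<^sub>F n in sequentially. (LINT x|?M. norm (F (u x) - F (\<phi> n x)) powr p) \<le> L powr p * (LINT x|?M. norm (u x - \<phi> n x) powr p)"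
      by simp
  qed simp
  define I1 where "I1 n = (LINT x|?M. norm ((deriv F (u x) - deriv F (\<phi> n x)) *\<^sub>R ?G x) powr p)" for n
  have d2: "\<bar>deriv F s - deriv F t\<bar> \<le> 2 * L" for s t using F(3)[of s] F(3)[of t] by linarith
  have i1L: "(\<lambda>x. (deriv F (u x) - deriv F (\<phi> n x)) *\<^sub>R ?G x) \<in> Lp \<Omega> p" for n
    by (rule Lp_bounded_by[OF _ GL, where L = "2 * L"]) (use d2 L in \<open>auto intro!: mult_right_mono\<close>)
  have I1: "I1 \<longlonglongrightarrow> 0"
  proof -
    have "I1 \<longlonglongrightarrow> (LINT x|?M. 0)" unfolding I1_def
    proof (rule integral_dominated_convergence[where w = "\<lambda>x. (2 * L) powr p * norm (?G x) powr p"])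
      show "integrable ?M (\<lambda>x. (2 * L) powr p * norm (?G x) powr p)"
        using Lp_integrable_powr[OF GL] by simp
      show "AE x in ?M. norm (norm ((deriv F (u x) - deriv F (\<phi> n x)) *\<^sub>R ?G x) powr p) \<le> (2 * L) powr p * norm (?G x) powr p" for n
      proof (rule AE_I2)
        fix x
        have "norm ((deriv F (u x) - deriv F (\<phi> n x)) *\<^sub>R ?G x) powr p \<le> ((2 * L) * norm (?G x)) powr p"
          using p d2 by (intro powr_mono2) (auto intro!: mult_right_mono)
        also have "\<dots> = (2 * L) powr p * norm (?G x) powr p" using L by (intro powr_mult)
        finally show "norm (norm ((deriv F (u x) - deriv F (\<phi> n x)) *\<^sub>R ?G x) powr p) \<le> (2 * L) powr p * norm (?G x) powr p"
          by simp
      qed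
      show "AE x in ?M. (\<lambda>n. norm ((deriv F (u x) - deriv F (\<phi> n x)) *\<^sub>R ?G x) powr p) \<longlonglongrightarrow> 0"
        using ae
      proof eventually_elim
        case (elim x)
        have "isCont (deriv F) (u x)" using DF(2) by (simp add: continuous_on_eq_continuous_at)
        then have "(\<lambda>n. deriv F (\<phi> n x)) \<longlonglongrightarrow> deriv F (u x)" using elim by (rule isCont_tendsto_compose)
        then have "(\<lambda>n. norm ((deriv F (u x) - deriv F (\<phi> n x)) *\<^sub>R ?G x)) \<longlonglongrightarrow> norm ((deriv F (u x) - deriv F (u x)) *\<^sub>R ?G x)"
          by (intro tendsto_intros)
        then show ?case using p by (intro tendsto_zero_powrI[where b = p] tendsto_const) auto
      qed
    qed auto
    then show ?thesis by simp
  qed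
  have 2: "(\<lambda>n. LINT x|?M. norm (H x - grad (\<lambda>x. F (\<phi> n x)) x) powr p) \<longlonglongrightarrow> 0"
  proof (rule tendsto_sandwich[OF _ _ tendsto_const])
    show "(\<lambda>n. 2 powr p * (I1 n + L powr p * (LINT x|?M. norm (?G x - grad (\<phi> n) x) powr p))) \<longlonglongrightarrow> 0"
      using tendsto_mult_right_zero[OF tendsto_add_zero[OF I1 tendsto_mult_right_zero[OF \<phi>G]]] by simp
    have "(LINT x|?M. norm (H x - grad (\<lambda>x. F (\<phi> n x)) x) powr p) \<le>
      (LINT x|?M. 2 powr p * (norm ((deriv F (u x) - deriv F (\<phi> n x)) *\<^sub>R ?G x) powr p + L powr p * norm (?G x - grad (\<phi> n) x) powr p))" for n
    proof (rule integral_mono)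
      show "integrable ?M (\<lambda>x. norm (H x - grad (\<lambda>x. F (\<phi> n x)) x) powr p)"
        by (rule Lp_integrable_powr[OF Lp_diff[OF HL test_function_Lp(2)[OF T(1)]]])
      show "integrable ?M (\<lambda>x. 2 powr p * (norm ((deriv F (u x) - deriv F (\<phi> n x)) *\<^sub>R ?G x) powr p + L powr p * norm (?G x - grad (\<phi> n) x) powr p))"
        using Gphi Lp_integrable_powr[OF i1L] by simp
      fix x
      \<comment> \<open>The sum of the two error terms is written as a difference, with the sign
        moved into the scalar, to fit \<open>norm_diff_powr_le\<close>.\<close>
      have "H x - grad (\<lambda>x. F (\<phi> n x)) x = (deriv F (u x) - deriv F (\<phi> n x)) *\<^sub>R ?G x - (- deriv F (\<phi> n x)) *\<^sub>R (?G x - grad (\<phi> n) x)"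
        by (simp add: H_def T(2) algebra_simps)
      then have "norm (H x - grad (\<lambda>x. F (\<phi> n x)) x) powr p
          \<le> 2 powr p * (norm ((deriv F (u x) - deriv F (\<phi> n x)) *\<^sub>R ?G x) powr p + norm ((- deriv F (\<phi> n x)) *\<^sub>R (?G x - grad (\<phi> n) x)) powr p)"
        using norm_diff_powr_le[OF order_less_imp_le[OF order_less_trans[OF zero_less_one p]]] by (simp only:)
      also have "norm ((- deriv F (\<phi> n x)) *\<^sub>R (?G x - grad (\<phi> n) x)) powr p \<le> (L * norm (?G x - grad (\<phi> n) x)) powr p"
        using p F(3) by (intro powr_mono2) (auto intro!: mult_right_mono)
      also have "\<dots> = L powr p * norm (?G x - grad (\<phi> n) x) powr p" using L by (intro powr_mult)
      finally show "norm (H x - grad (\<lambda>x. F (\<phi> n x)) x) powr p \<le> 2 powr p * (norm ((deriv F (u x) - deriv F (\<phi> n x)) *\<^sub>R ?G x) powr p + L powr p * norm (?G x - grad (\<phi> n) x) powr p)"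
        by simp
    qed
    then show "\<forall>\<^sub>F n in sequentially. (LINT x|?M. norm (H x - grad (\<lambda>x. F (\<phi> n x)) x) powr p) \<le> 2 powr p * (I1 n + L powr p * (LINT x|?M. norm (?G x - grad (\<phi> n) x) powr p))"
      using Gphi Lp_integrable_powr[OF i1L] by (simp add: I1_def)
  qed simp
  show "(\<lambda>x. F (u x)) \<in> W10 \<Omega> p" by (rule W10_limit(1)[OF wL HL T(1) 1 2])
  show "AE x in ?M. weak_grad \<Omega> (\<lambda>x. F (u x)) x = deriv F (u x) *\<^sub>R ?G x"
    using W10_limit(2)[OF wL HL T(1) 1 2] by (simp add: H_def)
qed

text \<open>Where |w| >= t, either |\<phi> n| >= s or |w - \<phi> n| >= t - s, for any s < t. The
  measure of the second set tends to 0 by Chebyshev's inequality, and the first obeys the estimate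
  for smooth functions. The gap between s and t is closed at the very end.\<close>

lemma weak_type_estimate_W10:
  assumes C: "C > 0" "\<And>(v :: 'a \<Rightarrow> real) g K t. (\<And>x. (v has_derivative (\<lambda>u. g x \<bullet> u)) (at x)) \<Longrightarrow> continuous_on UNIV g \<Longrightarrow>
    compact K \<Longrightarrow> (\<And>x. x \<notin> K \<Longrightarrow> v x = 0) \<Longrightarrow> t > 0 \<Longrightarrow>
    t * measure lborel {x. t \<le> \<bar>v x\<bar>} powr \<kappa> \<le> C * (LINT x|lborel. norm (g x))"
    and \<kappa>: "\<kappa> > 0"
    and w: "w \<in> W10 \<Omega> p" and t: "t > 0"
  shows "t * measure lebesgue {x\<in>\<Omega>. t \<le> \<bar>w x\<bar>} powr \<kappa> \<le> C * (LINT x|lebesgue_on \<Omega>. norm (weak_grad \<Omega> w x))"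
proof -
  let ?M = "lebesgue_on \<Omega>" and ?G = "weak_grad \<Omega> w"
  note wL = W10_Lp(1)[OF w] and GL = W10_Lp(2)[OF w]
  define J where "J = (LINT x|?M. norm (?G x))"
  have J: "J \<ge> 0" by (simp add: J_def)
  obtain \<phi> where \<phi>: "\<And>n. \<phi> n \<in> test_functions \<Omega>"
    "(\<lambda>n. LINT x|?M. norm (w x - \<phi> n x) powr p) \<longlonglongrightarrow> 0"
    "(\<lambda>n. LINT x|?M. norm (?G x - grad (\<phi> n) x) powr p) \<longlonglongrightarrow> 0"
    by (rule W10_approx[OF w]) (rule that)
  note wm[measurable] = Lp_measurable[OF wL] Lp_measurable[OF test_function_Lp(1)[OF \<phi>(1)]]
  have GphiL: "(\<lambda>x. ?G x - grad (\<phi> n) x) \<in> Lp \<Omega> p" for n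
    by (rule Lp_diff[OF GL test_function_Lp(2)[OF \<phi>(1)]])
  have wphi: "integrable ?M (\<lambda>x. norm (w x - \<phi> n x) powr p)" for n
    by (rule Lp_integrable_powr[OF Lp_diff[OF wL test_function_Lp(1)[OF \<phi>(1)]]])
  have iG: "integrable ?M ?G" and ig: "integrable ?M (grad (\<phi> n))" for n
    using Lp_imp_integrable[OF _ less_imp_le[OF p]] GL test_function_Lp(2)[OF \<phi>(1)] by auto
  define J' where "J' n = (LINT x|?M. norm (grad (\<phi> n) x))" for n
  have J': "J' \<longlonglongrightarrow> J"
  proof -
    have "(\<lambda>n. J' n - J) \<longlonglongrightarrow> 0"
    proof (rule Lim_null_comparison)
      show "(\<lambda>n. LINT x|?M. norm (?G x - grad (\<phi> n) x)) \<longlonglongrightarrow> 0"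
        by (rule L1_tendsto_of_Lp_tendsto[OF GphiL \<phi>(3)])
      show "\<forall>\<^sub>F n in sequentially. norm (J' n - J) \<le> (LINT x|?M. norm (?G x - grad (\<phi> n) x))"
      proof (intro always_eventually allI)
        fix n
        have "J' n - J = (LINT x|?M. norm (grad (\<phi> n) x) - norm (?G x))"
          using iG ig by (simp add: J_def J'_def)
        also have "norm \<dots> \<le> (LINT x|?M. norm (norm (grad (\<phi> n) x) - norm (?G x)))" by (rule integral_norm_bound)
        also have "\<dots> \<le> (LINT x|?M. norm (?G x - grad (\<phi> n) x))"
          using iG ig by (intro integral_mono) (auto intro!: integrable_norm simp: norm_minus_commute intro: norm_triangle_ineq3)
        finally show "norm (J' n - J) \<le> (LINT x|?M. norm (?G x - grad (\<phi> n) x))" .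
      qed
    qed
    then show ?thesis by (simp add: LIM_zero_iff)
  qed
  define m where "m = measure ?M {x\<in>\<Omega>. t \<le> \<bar>w x\<bar>}"
  have mm: "measure lebesgue {x\<in>\<Omega>. t \<le> \<bar>w x\<bar>} = m"
    unfolding m_def by (rule measure_restrict_space[symmetric]) (use open_\<Omega> in auto)
  have step: "s * m powr \<kappa> \<le> C * J" if s: "0 < s" "s < t" for s
  proof -
    define b where "b n = (t - s) powr (- p) * (LINT x|?M. norm (w x - \<phi> n x) powr p)" for n
    have b: "b \<longlonglongrightarrow> 0" unfolding b_def by (rule tendsto_mult_right_zero[OF \<phi>(2)])
    \<comment> \<open>Measures add up, their powers do not. So the smooth estimate is solved for the
      measure here, and the power \<kappa> is restored after the limit in n.\<close>
    have le: "m \<le> (C * J' n / s) powr (1 / \<kappa>) + b n" for n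
    proof -
      have S[measurable]: "{x \<in> \<Omega>. s \<le> \<bar>\<phi> n x\<bar>} \<in> sets ?M" "{x\<in>\<Omega>. t \<le> \<bar>w x\<bar>} \<in> sets ?M" "{x\<in>\<Omega>. t - s \<le> \<bar>w x - \<phi> n x\<bar>} \<in> sets ?M"
      proof -
        have "{x \<in> space ?M. s \<le> \<bar>\<phi> n x\<bar>} \<in> sets ?M" "{x\<in>space ?M. t \<le> \<bar>w x\<bar>} \<in> sets ?M"
          "{x\<in>space ?M. t - s \<le> \<bar>w x - \<phi> n x\<bar>} \<in> sets ?M" by measurable
        then show "{x \<in> \<Omega>. s \<le> \<bar>\<phi> n x\<bar>} \<in> sets ?M" "{x\<in>\<Omega>. t \<le> \<bar>w x\<bar>} \<in> sets ?M"
          "{x\<in>\<Omega>. t - s \<le> \<bar>w x - \<phi> n x\<bar>} \<in> sets ?M" by (simp_all add: space_restrict_space)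
      qed
      have "m \<le> measure ?M ({x \<in> \<Omega>. s \<le> \<bar>\<phi> n x\<bar>} \<union> {x\<in>\<Omega>. t - s \<le> \<bar>w x - \<phi> n x\<bar>})"
        unfolding m_def by (intro finite_measure_mono) (use S in auto)
      also have "\<dots> \<le> measure ?M {x \<in> \<Omega>. s \<le> \<bar>\<phi> n x\<bar>} + measure ?M {x\<in>\<Omega>. t - s \<le> \<bar>w x - \<phi> n x\<bar>}"
        by (intro measure_Un_le S)
      also have "measure ?M {x\<in>\<Omega>. t - s \<le> \<bar>w x - \<phi> n x\<bar>} \<le> b n"
      proof -
        have "measure ?M {x\<in>\<Omega>. t - s \<le> \<bar>w x - \<phi> n x\<bar>} = (LINT x|?M. indicator {x\<in>\<Omega>. t - s \<le> \<bar>w x - \<phi> n x\<bar>} x)"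
          using S by (simp add: space_restrict_space Int_absorb2 subset_eq)
        also have "\<dots> \<le> (LINT x|?M. (t - s) powr (- p) * norm (w x - \<phi> n x) powr p)"
        proof (rule integral_mono)
          show "integrable ?M (\<lambda>x. (t - s) powr (- p) * norm (w x - \<phi> n x) powr p)" using wphi by simp
          show "integrable ?M (indicat_real {x\<in>\<Omega>. t - s \<le> \<bar>w x - \<phi> n x\<bar>})"
            using S by (intro integrable_real_indicator) (auto simp: emeasure_eq_measure)
          show "indicat_real {x\<in>\<Omega>. t - s \<le> \<bar>w x - \<phi> n x\<bar>} x \<le> (t - s) powr (- p) * norm (w x - \<phi> n x) powr p" for x
          proof (cases "t - s \<le> \<bar>w x - \<phi> n x\<bar>")
            case True
            have "1 = (t - s) powr (- p) * (t - s) powr p" using s by (simp add: powr_add[symmetric])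
            also have "\<dots> \<le> (t - s) powr (- p) * norm (w x - \<phi> n x) powr p"
              using True s p by (intro mult_left_mono powr_mono2) auto
            finally show ?thesis by (auto simp: indicator_def)
          qed auto
        qed
        finally show ?thesis by (simp add: b_def)
      qed
      also have "measure ?M {x \<in> \<Omega>. s \<le> \<bar>\<phi> n x\<bar>} \<le> (C * J' n / s) powr (1 / \<kappa>)"
      proof -
        obtain K where K: "compact K" "K \<subseteq> \<Omega>" "\<And>x. x \<notin> K \<Longrightarrow> \<phi> n x = 0" "\<And>x. x \<notin> K \<Longrightarrow> grad (\<phi> n) x = 0"
          using test_function_support[OF \<phi>(1)] by blast
        note cont = test_function_continuous[OF \<phi>(1)]
        have "{x \<in> \<Omega>. s \<le> \<bar>\<phi> n x\<bar>} = {x. s \<le> \<bar>\<phi> n x\<bar>}" using K s by force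
        moreover have "{x. s \<le> \<bar>\<phi> n x\<bar>} \<in> sets lborel"
          using cont by (intro borel_closed[THEN sets_lborel[THEN equalityD2, THEN subsetD]] closed_Collect_le continuous_intros)
        ultimately have "measure ?M {x \<in> \<Omega>. s \<le> \<bar>\<phi> n x\<bar>} = measure lborel {x. s \<le> \<bar>\<phi> n x\<bar>}"
          using open_\<Omega> K(2) by (subst measure_restrict_space) auto
        moreover have "s * measure lborel {x. s \<le> \<bar>\<phi> n x\<bar>} powr \<kappa> \<le> C * (LINT x|lborel. norm (grad (\<phi> n) x))"
          by (rule C(2)[OF test_function_derivative[OF \<phi>(1)] cont(2) K(1,3) s(1)])
        moreover have "(LINT x|lborel. norm (grad (\<phi> n) x)) = J' n"
          unfolding J'_def by (rule integral_lebesgue_on_compact_support(2)[OF _ K(1,2) _ open_\<Omega>, symmetric])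
            (use cont K in \<open>auto intro!: continuous_intros\<close>)
        ultimately have "measure ?M {x \<in> \<Omega>. s \<le> \<bar>\<phi> n x\<bar>} powr \<kappa> \<le> C * J' n / s"
          using s by (simp add: field_simps)
        then have "(measure ?M {x \<in> \<Omega>. s \<le> \<bar>\<phi> n x\<bar>} powr \<kappa>) powr (1 / \<kappa>) \<le> (C * J' n / s) powr (1 / \<kappa>)"
          using \<kappa> by (intro powr_mono2) auto
        then show ?thesis using \<kappa> by (simp add: powr_powr)
      qed
      finally show ?thesis by simp
    qed
    have "(\<lambda>n. (C * J' n / s) powr (1 / \<kappa>) + b n) \<longlonglongrightarrow> (C * J / s) powr (1 / \<kappa>) + 0"
    proof (intro tendsto_add b)
      show "(\<lambda>n. (C * J' n / s) powr (1 / \<kappa>)) \<longlonglongrightarrow> (C * J / s) powr (1 / \<kappa>)"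
        using C J \<kappa> s by (intro tendsto_powr' tendsto_intros J') (auto simp: J'_def intro!: always_eventually)
    qed
    then have "m \<le> (C * J / s) powr (1 / \<kappa>)"
      using le by (intro LIMSEQ_le_const) auto
    then have "m powr \<kappa> \<le> ((C * J / s) powr (1 / \<kappa>)) powr \<kappa>"
      using \<kappa> by (intro powr_mono2) (auto simp: m_def)
    also have "\<dots> = C * J / s" using \<kappa> C J s by (simp add: powr_powr)
    finally show ?thesis using s by (simp add: field_simps)
  qed
  have "t * m powr \<kappa> \<le> C * J"
  proof (rule tendsto_le[of "at_left t"])
    show "((\<lambda>s. s * m powr \<kappa>) \<longlongrightarrow> t * m powr \<kappa>) (at_left t)" by (intro tendsto_intros)
    show "\<forall>\<^sub>F s in at_left t. s * m powr \<kappa> \<le> C * J"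
      using eventually_at_left_real[OF t] by eventually_elim (use step in auto)
  qed auto
  then show ?thesis by (simp add: mm J_def)
qed

end

section \<open>Decay of distribution functions\<close>

lemma powr_le_imp_le:
  fixes x y :: real
  assumes "x powr \<kappa> \<le> y powr \<kappa>" "\<kappa> > 0" "0 \<le> y"
  shows "x \<le> y"
proof (rule ccontr)
  assume "\<not> x \<le> y"
  then have "y powr \<kappa> < x powr \<kappa>" using assms by (intro powr_less_mono2) auto
  then show False using assms by simp
qed

text \<open>The levels are k1 + D (1 - 2^{-j}), with increments D 2^{-j-1}. The induction claims a
  factor 2^{-b} per step, and b = \<alpha>/e is the rate at which the surplus exponent e compensates
  exactly for the shrinking increments. What remains of the induction step is the inequality assumed
  for D.\<close>

lemma stampacchia_iteration:
  fixes \<Phi> :: "real \<Rightarrow> real"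
  assumes nn: "\<And>k. 0 \<le> \<Phi> k" and anti: "\<And>k l. k \<le> l \<Longrightarrow> \<Phi> l \<le> \<Phi> k"
    and pos: "\<alpha> > 0" "\<kappa> > 0" "e > 0" "C \<ge> 0" "D > 0"
    and step: "\<And>k d. k1 \<le> k \<Longrightarrow> 0 < d \<Longrightarrow> d powr \<alpha> * \<Phi> (k + d) powr \<kappa> \<le> C * \<Phi> k powr (\<kappa> + e)"
    and D: "C * \<Phi> k1 powr e * 2 powr (\<alpha> + \<alpha> * \<kappa> / e) \<le> D powr \<alpha>"
  shows "\<Phi> (k1 + D) = 0"
proof -
  define b where "b = \<alpha> / e"
  have be: "b * e = \<alpha>" using pos by (simp add: b_def)
  define K where "K j = k1 + D * (1 - 2 powr (- real j))" for j :: nat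
  have decay: "\<Phi> (K j) \<le> \<Phi> k1 * 2 powr (- (b * real j))" for j
  proof (induction j)
    case 0
    then show ?case by (simp add: K_def)
  next
    case (Suc j)
    define d where "d = D * 2 powr (- real j - 1)"
    have d: "d > 0" using pos by (simp add: d_def)
    have K: "K (Suc j) = K j + d" by (simp add: K_def d_def powr_diff powr_minus field_simps powr_add)
    have "2 powr (- real j) \<le> 1" using powr_mono[of "- real j" 0 2] by simp
    then have "k1 \<le> K j" using pos by (simp add: K_def)
    from step[OF this d]
    have 1: "d powr \<alpha> * \<Phi> (K (Suc j)) powr \<kappa> \<le> C * \<Phi> (K j) powr (\<kappa> + e)" by (simp add: K)
    also have "\<dots> \<le> C * (\<Phi> k1 * 2 powr (- (b * real j))) powr (\<kappa> + e)"
      using Suc nn pos by (intro mult_left_mono powr_mono2) auto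
    also have "\<dots> = (C * \<Phi> k1 powr e) * (\<Phi> k1 powr \<kappa> * 2 powr (- (b * real j) * (\<kappa> + e)))"
      by (simp only: powr_mult powr_powr powr_add[of "\<Phi> k1"] mult_ac)
    also have "\<dots> \<le> (D powr \<alpha> * 2 powr (- (\<alpha> + \<alpha> * \<kappa> / e))) * (\<Phi> k1 powr \<kappa> * 2 powr (- (b * real j) * (\<kappa> + e)))"
    proof (rule mult_right_mono)
      have "C * \<Phi> k1 powr e = C * \<Phi> k1 powr e * 2 powr (\<alpha> + \<alpha> * \<kappa> / e) * 2 powr (- (\<alpha> + \<alpha> * \<kappa> / e))"
        by (simp add: mult.assoc powr_add[symmetric])
      also have "\<dots> \<le> D powr \<alpha> * 2 powr (- (\<alpha> + \<alpha> * \<kappa> / e))" by (rule mult_right_mono[OF D]) simp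
      finally show "C * \<Phi> k1 powr e \<le> D powr \<alpha> * 2 powr (- (\<alpha> + \<alpha> * \<kappa> / e))" .
    qed simp
    also have "\<dots> = d powr \<alpha> * (\<Phi> k1 * 2 powr (- (b * real (Suc j)))) powr \<kappa>"
    proof -
      have "2 powr (- (\<alpha> + \<alpha> * \<kappa> / e)) * 2 powr (- (b * real j) * (\<kappa> + e))
          = 2 powr ((- real j - 1) * \<alpha>) * 2 powr (- (b * real (Suc j)) * \<kappa>)"
        unfolding powr_add[symmetric] be[symmetric]
        using pos by (intro arg_cong2[where f = "(powr)"] refl) (simp add: field_simps)
      then show ?thesis using pos nn by (simp add: d_def powr_mult powr_powr)
    qed
    finally have "\<Phi> (K (Suc j)) powr \<kappa> \<le> (\<Phi> k1 * 2 powr (- (b * real (Suc j)))) powr \<kappa>"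
      using d by (subst (asm) mult_le_cancel_left_pos) auto
    then show ?case by (rule powr_le_imp_le) (use pos nn in auto)
  qed
  have b: "b > 0" using pos by (simp add: b_def)
  have "(\<lambda>j. \<Phi> k1 * 2 powr (- (b * real j))) \<longlonglongrightarrow> \<Phi> k1 * 0"
    using b by (intro tendsto_intros) real_asymp
  moreover have "\<Phi> (k1 + D) \<le> \<Phi> k1 * 2 powr (- (b * real j))" for j
  proof -
    have "\<Phi> (k1 + D) \<le> \<Phi> (K j)" using pos by (intro anti) (simp add: K_def)
    also note decay[of j]
    finally show ?thesis .
  qed
  ultimately have "\<Phi> (k1 + D) \<le> \<Phi> k1 * 0" by (intro LIMSEQ_le_const) auto
  then show ?thesis using nn[of "k1 + D"] by simp
qed

text \<open>Isolates the real-variable part of the argument. \<Phi> stands for the distribution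
  function of |u| and \<open>S k\<close> for the integral of |f(x,u)| over {|u| > k}.
  \<open>first\<close> expresses finite energy alone, \<open>second\<close> the equation.
  \<open>source\<close> encodes subcritical growth: decay of \<Phi> with constant E at the doublings
  of k bounds \<open>S k\<close> by E/k with an arbitrarily small factor.\<close>

locale level_decay =
  fixes \<Phi> S :: "real \<Rightarrow> real" and N p \<mu> C :: real
  assumes nn: "\<And>k. 0 \<le> \<Phi> k" and anti: "\<And>k l. k \<le> l \<Longrightarrow> \<Phi> l \<le> \<Phi> k"
    and p: "1 < p" "p < N" and \<mu>: "0 < \<mu>" "\<mu> < p" and C: "C > 0"
    and S_nn: "\<And>k. 0 \<le> S k"
    and first: "\<And>k d. 0 < k \<Longrightarrow> 0 < d \<Longrightarrow> d * \<Phi> (k + d) powr (1 - 1 / N) \<le> C * \<Phi> k powr (1 - 1 / p)"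
    and second: "\<And>k d. 0 < k \<Longrightarrow> 0 < d \<Longrightarrow>
      d * \<Phi> (k + d) powr (1 - 1 / N) \<le> C * (d * S k) powr (1 / p) * \<Phi> k powr (1 - 1 / p)"
    and source: "\<And>\<delta>. \<delta> > 0 \<Longrightarrow> \<exists>k0>0. \<forall>k\<ge>k0. \<forall>E\<ge>0.
      (\<forall>i::nat. \<Phi> (2 ^ i * k) powr (1 - \<mu> / N) \<le> E * (2 ^ i * k) powr (- (N * p / (N - p) * (1 - \<mu> / N)))) \<longrightarrow>
      S k \<le> \<delta> * E / k"
begin

definition "pc = N * p / (N - p)"
definition "\<kappa> = 1 - 1 / N"
definition "\<theta> = 1 - \<mu> / N"
definition "\<gamma> = (1 - \<mu> / p) / N"

text \<open>\<open>pc\<close> is p^*, and \<open>pc * \<theta>\<close> is the critical Hardy-Sobolev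
  exponent. The fifth and sixth identities make decay of rate \<open>pc\<close> reproduce itself
  under \<open>first\<close>. By the last one, a source of order \<Phi>^\<theta> in
  \<open>second\<close> leaves the surplus \<gamma> over \<kappa>, which is positive because \<mu> <
  p.\<close>

lemma exps:
  "pc > 0" "\<kappa> > 0" "\<theta> > 0" "\<gamma> > 0"
  "1 + pc * (1 - 1 / p) = pc * \<kappa>" "\<kappa> - (1 - 1 / p) = 1 / pc" "(1 - 1 / p) + \<theta> / p = \<kappa> + \<gamma>"
proof -
  show "pc > 0" "\<kappa> > 0" "\<theta> > 0" "\<gamma> > 0"
    using p \<mu> by (auto simp: pc_def \<kappa>_def \<theta>_def \<gamma>_def intro!: divide_pos_pos mult_pos_pos)
  show "1 + pc * (1 - 1 / p) = pc * \<kappa>" using p by (simp add: pc_def \<kappa>_def field_simps)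
  show "\<kappa> - (1 - 1 / p) = 1 / pc" using p by (simp add: pc_def \<kappa>_def field_simps)
  show "(1 - 1 / p) + \<theta> / p = \<kappa> + \<gamma>" using p by (simp add: \<theta>_def \<kappa>_def \<gamma>_def field_simps)
qed

definition "lev j = (2::real) powr real j" for j :: nat

lemma lev: "lev j > 0" "lev (Suc j) = lev j + lev j" "2 ^ i * lev j = lev (i + j)"
  by (auto simp: lev_def powr_add powr_realpow)

text \<open>A weak L^{p^*} bound, obtained from \<open>first\<close> by doubling the level. The
  powers of \<open>lev j\<close> balance, while \<Lambda> occurs with exponent \<kappa> on one side
  and 1 - 1/p < \<kappa> on the other, so a large \<Lambda> absorbs the constant of the
  recursion.\<close>

lemma weak_decay: "\<exists>\<Lambda>>0. \<forall>j. \<Phi> (lev j) \<le> \<Lambda> * lev j powr (- pc)"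
proof -
  define \<Lambda> where "\<Lambda> = max (\<Phi> 1) ((C * 2 powr (pc * \<kappa>)) powr pc)"
  have \<Lambda>: "\<Lambda> > 0" using C by (simp add: \<Lambda>_def less_max_iff_disj)
  have "C * 2 powr (pc * \<kappa>) = ((C * 2 powr (pc * \<kappa>)) powr pc) powr (1 / pc)"
    using C exps by (simp add: powr_powr)
  also have "\<dots> \<le> \<Lambda> powr (1 / pc)" using exps by (intro powr_mono2) (auto simp: \<Lambda>_def)
  finally have Cb: "C * 2 powr (pc * \<kappa>) \<le> \<Lambda> powr (1 / pc)" .
  have "\<Phi> (lev j) \<le> \<Lambda> * lev j powr (- pc)" for j
  proof (induction j)
    case 0
    then show ?case by (simp add: lev_def \<Lambda>_def)
  next
    case (Suc j)
    have "lev j * \<Phi> (lev (Suc j)) powr \<kappa> \<le> C * \<Phi> (lev j) powr (1 - 1 / p)"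
      using first[OF lev(1) lev(1), of j j] by (simp add: \<kappa>_def lev)
    also have "\<dots> \<le> C * (\<Lambda> * lev j powr (- pc)) powr (1 - 1 / p)"
      using Suc C nn p by (intro mult_left_mono powr_mono2) auto
    also have "\<dots> = (C * 2 powr (pc * \<kappa>)) * \<Lambda> powr (1 - 1 / p) * (2 powr (- (pc * \<kappa>)) * lev j powr (- pc * (1 - 1 / p)))"
    proof -
      have "2 powr (pc * \<kappa>) * 2 powr (- (pc * \<kappa>)) = (1::real)" by (simp add: powr_add[symmetric])
      then have "C * (\<Lambda> * lev j powr (- pc)) powr (1 - 1 / p) = (2 powr (pc * \<kappa>) * 2 powr (- (pc * \<kappa>)))
          * (C * (\<Lambda> powr (1 - 1 / p) * lev j powr (- pc * (1 - 1 / p))))"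
        using \<Lambda> by (simp add: powr_mult powr_powr)
      then show ?thesis by (simp only: mult_ac)
    qed
    also have "\<dots> \<le> \<Lambda> powr (1 / pc) * \<Lambda> powr (1 - 1 / p) * (2 powr (- (pc * \<kappa>)) * lev j powr (- pc * (1 - 1 / p)))"
      by (intro mult_right_mono Cb) auto
    also have "\<dots> = lev j * (\<Lambda> * lev (Suc j) powr (- pc)) powr \<kappa>"
    proof -
      have "\<Lambda> powr (1 / pc) * \<Lambda> powr (1 - 1 / p) = \<Lambda> powr \<kappa>"
        by (simp add: powr_add[symmetric] exps(6)[symmetric])
      moreover have "lev j powr (- pc * (1 - 1 / p)) = lev j powr 1 * lev j powr (- (pc * \<kappa>))"
        unfolding powr_add[symmetric] exps(5)[symmetric]
        by (rule arg_cong[where f = "\<lambda>s. lev j powr s"]) simp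
      moreover have "lev (Suc j) = 2 * lev j" by (simp add: lev(2))
      ultimately show ?thesis using \<Lambda> lev(1)[of j] by (simp add: powr_mult powr_powr)
    qed
    finally have "\<Phi> (lev (Suc j)) powr \<kappa> \<le> (\<Lambda> * lev (Suc j) powr (- pc)) powr \<kappa>"
      using lev(1)[of j] by (subst (asm) mult_le_cancel_left_pos) auto
    then show ?case by (rule powr_le_imp_le) (use exps \<Lambda> in auto)
  qed
  with \<Lambda> show ?thesis by blast
qed

text \<open>With decay of rate \<open>pc\<close> the recursion \<open>second\<close> is balanced in
  the level, so the small factor of \<open>source\<close> is a pure gain: each doubling improves the
  constant by \<rho>. Bounding S uses the decay at all higher levels, hence the induction on n
  treats all j >= j0 + n together.\<close>

lemma improved_decay:
  assumes "\<rho> > 0" "\<rho> \<le> 1" and \<Lambda>: "\<Lambda> > 0" "\<And>j. \<Phi> (lev j) \<le> \<Lambda> * lev j powr (- pc)"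
  shows "\<exists>j0. \<forall>n j. j0 + n \<le> j \<longrightarrow> \<Phi> (lev j) \<le> \<Lambda> * \<rho> ^ n * lev j powr (- pc)"
proof -
  \<comment> \<open>Solved from the requirement that the constant of one step, with X^\<gamma>
    estimated by \<Lambda>^\<gamma>, equals \<rho>^\<kappa>.\<close>
  define \<delta> where "\<delta> = (\<rho> powr \<kappa> / (C * 2 powr (pc * \<kappa>) * \<Lambda> powr \<gamma>)) powr p"
  have \<delta>: "\<delta> > 0" using assms C by (simp add: \<delta>_def)
  have \<delta>p: "C * \<delta> powr (1 / p) * 2 powr (pc * \<kappa>) * \<Lambda> powr \<gamma> = \<rho> powr \<kappa>"
    using p C \<Lambda> by (simp add: \<delta>_def powr_powr)
  obtain k0 where k0: "k0 > 0" "\<And>k E. k \<ge> k0 \<Longrightarrow> E \<ge> 0 \<Longrightarrow>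
      (\<forall>i::nat. \<Phi> (2 ^ i * k) powr \<theta> \<le> E * (2 ^ i * k) powr (- (pc * \<theta>))) \<Longrightarrow> S k \<le> \<delta> * E / k"
    using source[OF \<delta>] unfolding pc_def \<theta>_def by blast
  obtain j0 :: nat where j0: "k0 < 2 ^ j0" using real_arch_pow[of 2 k0] by auto
  have lev_ge: "k0 \<le> lev j" if "j0 \<le> j" for j
  proof -
    have "k0 \<le> 2 ^ j0" using j0 by simp
    also have "(2::real) ^ j0 \<le> 2 ^ j" using that by (intro power_increasing) auto
    finally show ?thesis by (simp add: lev_def powr_realpow)
  qed
  have "\<forall>j. j0 + n \<le> j \<longrightarrow> \<Phi> (lev j) \<le> \<Lambda> * \<rho> ^ n * lev j powr (- pc)" for n
  proof (induction n)
    case 0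
    then show ?case using \<Lambda> by simp
  next
    case (Suc n)
    define X where "X = \<Lambda> * \<rho> ^ n"
    have X: "0 < X" "X \<le> \<Lambda>" using assms by (auto simp: X_def power_le_one)
    show ?case
    proof (intro allI impI)
      fix j' assume "j0 + Suc n \<le> j'"
      then obtain j where j: "j' = Suc j" "j0 + n \<le> j" by (cases j') auto
      have bd: "\<Phi> (lev i) \<le> X * lev i powr (- pc)" if "j \<le> i" for i
        using Suc.IH that j by (simp add: X_def)
      have "S (lev j) \<le> \<delta> * X powr \<theta> / lev j"
      proof (rule k0(2))
        show "k0 \<le> lev j" using lev_ge j by simp
        show "\<forall>i. \<Phi> (2 ^ i * lev j) powr \<theta> \<le> X powr \<theta> * (2 ^ i * lev j) powr (- (pc * \<theta>))"
        proof
          fix i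
          have "\<Phi> (lev (i + j)) powr \<theta> \<le> (X * lev (i + j) powr (- pc)) powr \<theta>"
            using bd[of "i + j"] nn exps by (intro powr_mono2) auto
          also have "\<dots> = X powr \<theta> * lev (i + j) powr (- (pc * \<theta>))"
            using X by (simp add: powr_mult powr_powr)
          finally show "\<Phi> (2 ^ i * lev j) powr \<theta> \<le> X powr \<theta> * (2 ^ i * lev j) powr (- (pc * \<theta>))"
            by (simp add: lev)
        qed
      qed simp
      then have Sb: "lev j * S (lev j) \<le> \<delta> * X powr \<theta>"
        using lev(1)[of j] by (simp add: field_simps)
      have "lev j * \<Phi> (lev j') powr \<kappa> \<le> C * (lev j * S (lev j)) powr (1 / p) * \<Phi> (lev j) powr (1 - 1 / p)"
        using second[OF lev(1) lev(1), of j j] by (simp add: \<kappa>_def lev j)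
      also have "\<dots> \<le> C * (\<delta> * X powr \<theta>) powr (1 / p) * (X * lev j powr (- pc)) powr (1 - 1 / p)"
        using Sb bd[of j] C nn p S_nn lev(1)[of j]
        by (intro mult_mono[OF mult_left_mono[OF powr_mono2] powr_mono2]) auto
      also have "\<dots> = C * \<delta> powr (1 / p) * (X powr (\<theta> / p) * X powr (1 - 1 / p)) * lev j powr (- pc * (1 - 1 / p))"
        using \<delta> X by (simp add: powr_mult powr_powr)
      also have "X powr (\<theta> / p) * X powr (1 - 1 / p) = X powr \<gamma> * X powr \<kappa>"
        by (simp add: powr_add[symmetric] exps(7)[symmetric] add.commute)
      also have "C * \<delta> powr (1 / p) * (X powr \<gamma> * X powr \<kappa>) * lev j powr (- pc * (1 - 1 / p))
          \<le> C * \<delta> powr (1 / p) * (\<Lambda> powr \<gamma> * X powr \<kappa>) * lev j powr (- pc * (1 - 1 / p))"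
        using X exps C by (intro mult_right_mono mult_left_mono powr_mono2) auto
      also have "\<dots> = (C * \<delta> powr (1 / p) * 2 powr (pc * \<kappa>) * \<Lambda> powr \<gamma>) * X powr \<kappa> * (2 powr (- (pc * \<kappa>)) * lev j powr (- pc * (1 - 1 / p)))"
        by (simp add: powr_minus field_simps)
      also have "\<dots> = lev j * ((\<rho> * X) * lev j' powr (- pc)) powr \<kappa>"
      proof -
        have "lev j powr (- pc * (1 - 1 / p)) = lev j powr 1 * lev j powr (- (pc * \<kappa>))"
          unfolding powr_add[symmetric] exps(5)[symmetric]
          by (rule arg_cong[where f = "\<lambda>s. lev j powr s"]) simp
        moreover have "lev j' = 2 * lev j" by (simp add: lev(2) j)
        ultimately show ?thesis using X assms lev(1)[of j] unfolding \<delta>p by (simp add: powr_mult powr_powr)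
      qed
      finally have "\<Phi> (lev j') powr \<kappa> \<le> ((\<rho> * X) * lev j' powr (- pc)) powr \<kappa>"
        using lev(1)[of j] by (subst (asm) mult_le_cancel_left_pos) auto
      then have "\<Phi> (lev j') \<le> (\<rho> * X) * lev j' powr (- pc)"
        by (rule powr_le_imp_le) (use exps X assms in auto)
      then show "\<Phi> (lev j') \<le> \<Lambda> * \<rho> ^ Suc n * lev j' powr (- pc)" by (simp add: X_def mult_ac)
    qed
  qed
  then show ?thesis by blast
qed

text \<open>A factor 2^{-\<sigma>} per doubling amounts to a factor of order t^{-\<sigma>} at level
  t, so \<sigma> = r - pc produces the rate r. Rounding t down to a dyadic level costs the factor
  2^r.\<close>

lemma polynomial_decay:
  assumes r: "r \<ge> pc"
  shows "\<exists>T A. T > 0 \<and> A > 0 \<and> (\<forall>t\<ge>T. \<Phi> t \<le> A * t powr (- r))"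
proof -
  define \<sigma> where "\<sigma> = r - pc"
  define \<rho> where "\<rho> = 2 powr (- \<sigma>)"
  have \<sigma>: "\<sigma> \<ge> 0" using r by (simp add: \<sigma>_def)
  have \<rho>: "\<rho> > 0" "\<rho> \<le> 1" using powr_mono[of "- \<sigma>" 0 2] \<sigma> by (auto simp: \<rho>_def)
  obtain \<Lambda> where \<Lambda>: "\<Lambda> > 0" "\<And>j. \<Phi> (lev j) \<le> \<Lambda> * lev j powr (- pc)" using weak_decay by blast
  obtain j0 where j0: "\<And>n j. j0 + n \<le> j \<Longrightarrow> \<Phi> (lev j) \<le> \<Lambda> * \<rho> ^ n * lev j powr (- pc)"
    using improved_decay[OF \<rho> \<Lambda>] by blast
  define A where "A = \<Lambda> * 2 powr (\<sigma> * j0) * 2 powr r"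
  have "\<Phi> t \<le> A * t powr (- r)" if t: "t \<ge> lev j0" for t
  proof -
    have "t > 0" using t lev(1)[of j0] by linarith
    have "t \<ge> 1" using t powr_mono[of 0 "real j0" 2] by (simp add: lev_def)
    define j where "j = nat \<lfloor>log 2 t\<rfloor>"
    have l0: "log 2 t \<ge> 0" using \<open>t \<ge> 1\<close> by simp
    have j: "real j \<le> log 2 t" "log 2 t < real j + 1" using l0 by (auto simp: j_def)
    have lt: "lev j \<le> t" "t \<le> 2 * lev j"
    proof -
      have tt: "t = 2 powr (log 2 t)" using \<open>t > 0\<close> by simp
      show "lev j \<le> t" unfolding lev_def by (subst tt, rule powr_mono) (use j in auto)
      have "t \<le> 2 powr (real j + 1)" by (subst tt, rule powr_mono) (use j in auto)
      then show "t \<le> 2 * lev j" by (simp add: lev_def powr_add)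
    qed
    have "j0 \<le> j"
    proof -
      have "real j0 \<le> log 2 t" using t \<open>t > 0\<close> by (simp add: lev_def le_log_iff)
      then show ?thesis using j by linarith
    qed
    then have "\<Phi> (lev j) \<le> \<Lambda> * \<rho> ^ (j - j0) * lev j powr (- pc)" by (intro j0) auto
    also have "\<rho> ^ (j - j0) = 2 powr (\<sigma> * j0) * lev j powr (- \<sigma>)"
    proof -
      have "\<rho> ^ (j - j0) = \<rho> powr real (j - j0)" using \<rho> by (simp add: powr_realpow)
      also have "\<dots> = 2 powr (\<sigma> * j0) * lev j powr (- \<sigma>)"
        using \<open>j0 \<le> j\<close> by (simp add: \<rho>_def lev_def powr_powr powr_add[symmetric] of_nat_diff algebra_simps)
      finally show ?thesis .
    qed
    also have "\<Lambda> * (2 powr (\<sigma> * j0) * lev j powr (- \<sigma>)) * lev j powr (- pc) = \<Lambda> * 2 powr (\<sigma> * j0) * lev j powr (- r)"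
      by (simp add: \<sigma>_def powr_add[symmetric] mult.assoc)
    also have "lev j powr (- r) \<le> (t / 2) powr (- r)"
      using lt \<open>t > 0\<close> r exps by (intro powr_mono2') auto
    also have "(t / 2) powr (- r) = 2 powr r * t powr (- r)"
      using \<open>t > 0\<close> by (simp add: powr_divide powr_minus field_simps)
    finally have "\<Phi> (lev j) \<le> A * t powr (- r)" using \<Lambda> by (simp add: A_def mult_ac)
    then show ?thesis using anti[OF lt(1)] by linarith
  qed
  moreover have "A > 0" using \<Lambda> by (simp add: A_def)
  ultimately show ?thesis using lev(1)[of j0] by (intro exI[of _ "lev j0"] exI[of _ A]) auto
qed

text \<open>The power \<theta> of \<Phi> at a higher level is split into exponents \<theta> - \<tau>
  and \<tau>. The first part is estimated by monotonicity through \<open>\<Phi> k\<close>, the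
  second by the fast decay of rate r = q/\<tau>, which supplies exactly the decay that
  \<open>source\<close> asks for. Hence \<open>S k\<close> is at most a multiple of
  \<open>\<Phi> k\<close> to the power \<theta> - \<tau>, and \<open>second\<close> takes the
  superlinear form required by \<open>stampacchia_iteration\<close>.\<close>

lemma vanishing_level: "\<exists>k>0. \<Phi> k = 0"
proof -
  define q where "q = pc * \<theta>"
  \<comment> \<open>\<tau> < \<theta> leaves a positive power of \<open>\<Phi> k\<close> in the
    source, and \<tau>/p < \<gamma> leaves a positive surplus \<open>e\<close>; half of the minimum
    achieves both.\<close>
  define \<tau> where "\<tau> = min \<theta> (\<gamma> * p) / 2"
  have q: "q > 0" using exps by (simp add: q_def)
  have \<tau>: "\<tau> > 0" "\<tau> < \<theta>" "\<tau> / p < \<gamma>" using exps p by (auto simp: \<tau>_def min_def field_simps)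
  define r where "r = q / \<tau>"
  have "r \<ge> pc" using \<tau> exps by (simp add: r_def q_def field_simps)
  then obtain T A where TA: "T > 0" "A > 0" "\<And>t. t \<ge> T \<Longrightarrow> \<Phi> t \<le> A * t powr (- r)"
    using polynomial_decay by blast
  obtain k0 where k0: "k0 > 0" "\<And>k E. k \<ge> k0 \<Longrightarrow> E \<ge> 0 \<Longrightarrow>
      (\<forall>i::nat. \<Phi> (2 ^ i * k) powr \<theta> \<le> E * (2 ^ i * k) powr (- q)) \<Longrightarrow> S k \<le> 1 * E / k"
    using source[OF zero_less_one] unfolding q_def pc_def \<theta>_def by blast
  define k1 where "k1 = max T (max k0 1)"
  have k1: "k1 \<ge> T" "k1 \<ge> k0" "k1 \<ge> 1" by (auto simp: k1_def)
  have Sk: "S k \<le> A powr \<tau> * \<Phi> k powr (\<theta> - \<tau>)" if k: "k \<ge> k1" for k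
  proof -
    have "S k \<le> 1 * (A powr \<tau> * \<Phi> k powr (\<theta> - \<tau>)) / k"
    proof (rule k0(2))
      show "k0 \<le> k" using k k1 by simp
      show "\<forall>i. \<Phi> (2 ^ i * k) powr \<theta> \<le> A powr \<tau> * \<Phi> k powr (\<theta> - \<tau>) * (2 ^ i * k) powr (- q)"
      proof
        fix i :: nat
        have ik: "2 ^ i * k \<ge> k" using k k1 by simp
        have "\<Phi> (2 ^ i * k) powr \<theta> = \<Phi> (2 ^ i * k) powr (\<theta> - \<tau>) * \<Phi> (2 ^ i * k) powr \<tau>"
          by (simp add: powr_add[symmetric])
        also have "\<dots> \<le> \<Phi> k powr (\<theta> - \<tau>) * (A * (2 ^ i * k) powr (- r)) powr \<tau>"
        proof (intro mult_mono powr_mono2)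
          show "\<Phi> (2 ^ i * k) \<le> \<Phi> k" by (rule anti[OF ik])
          show "\<Phi> (2 ^ i * k) \<le> A * (2 ^ i * k) powr - r" by (rule TA) (use ik k k1 in linarith)
        qed (use \<tau> nn in auto)
        also have "(A * (2 ^ i * k) powr (- r)) powr \<tau> = A powr \<tau> * (2 ^ i * k) powr (- q)"
          using TA \<tau> by (simp add: powr_mult powr_powr r_def)
        finally show "\<Phi> (2 ^ i * k) powr \<theta> \<le> A powr \<tau> * \<Phi> k powr (\<theta> - \<tau>) * (2 ^ i * k) powr (- q)"
          by (simp add: mult_ac)
      qed
    qed simp
    also have "\<dots> \<le> A powr \<tau> * \<Phi> k powr (\<theta> - \<tau>)"
    proof -
      have "x / k \<le> x" if "x \<ge> 0" for x using that k k1 by (simp add: divide_le_eq mult_le_cancel_left1)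
      then show ?thesis by simp
    qed
    finally show ?thesis .
  qed
  define C' where "C' = C * (A powr \<tau>) powr (1 / p)"
  define e where "e = \<gamma> - \<tau> / p"
  have e: "e > 0" using \<tau> by (simp add: e_def)
  have C': "C' \<ge> 0" using C by (simp add: C'_def)
  have step: "d powr (1 - 1 / p) * \<Phi> (k + d) powr \<kappa> \<le> C' * \<Phi> k powr (\<kappa> + e)" if "k \<ge> k1" "d > 0" for k d
  proof -
    have k: "k > 0" using that k1 by linarith
    have "d * \<Phi> (k + d) powr \<kappa> \<le> C * (d * S k) powr (1 / p) * \<Phi> k powr (1 - 1 / p)"
      using second[OF k that(2)] by (simp add: \<kappa>_def)
    also have "\<dots> \<le> C * (d * (A powr \<tau> * \<Phi> k powr (\<theta> - \<tau>))) powr (1 / p) * \<Phi> k powr (1 - 1 / p)"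
      using Sk[OF that(1)] C p S_nn that by (intro mult_right_mono mult_left_mono powr_mono2) auto
    also have "\<dots> = d powr (1 / p) * (C' * (\<Phi> k powr ((\<theta> - \<tau>) / p) * \<Phi> k powr (1 - 1 / p)))"
      using that by (simp add: powr_mult powr_powr C'_def)
    also have "\<Phi> k powr ((\<theta> - \<tau>) / p) * \<Phi> k powr (1 - 1 / p) = \<Phi> k powr (\<kappa> + e)"
    proof -
      have "(\<theta> - \<tau>) / p + (1 - 1 / p) = \<kappa> + e"
        using exps(7) by (simp add: e_def diff_divide_distrib)
      then show ?thesis by (simp add: powr_add[symmetric])
    qed
    finally have "d powr (1 / p) * (d powr (1 - 1 / p) * \<Phi> (k + d) powr \<kappa>) \<le> d powr (1 / p) * (C' * \<Phi> k powr (\<kappa> + e))"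
      using that by (simp add: powr_add[symmetric] mult.assoc[symmetric])
    then show ?thesis using that by (subst (asm) mult_le_cancel_left_pos) auto
  qed
  define \<alpha> where "\<alpha> = 1 - 1 / p"
  have \<alpha>: "\<alpha> > 0" using p by (simp add: \<alpha>_def)
  define R where "R = C' * \<Phi> k1 powr e * 2 powr (\<alpha> + \<alpha> * \<kappa> / e)"
  \<comment> \<open>Adding 1 makes D positive also when R = 0.\<close>
  define D where "D = (R + 1) powr (1 / \<alpha>)"
  have R: "R \<ge> 0" using C' by (simp add: R_def)
  have "\<Phi> (k1 + D) = 0"
  proof (rule stampacchia_iteration[where C = C' and \<alpha> = \<alpha> and \<kappa> = \<kappa> and e = e])
    show "C' * \<Phi> k1 powr e * 2 powr (\<alpha> + \<alpha> * \<kappa> / e) \<le> D powr \<alpha>"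
      using R \<alpha> by (simp add: D_def powr_powr R_def[symmetric])
    show "D > 0" using R by (simp add: D_def)
    show "d powr \<alpha> * \<Phi> (k + d) powr \<kappa> \<le> C' * \<Phi> k powr (\<kappa> + e)" if "k1 \<le> k" "0 < d" for k d
      using step[OF that] by (simp add: \<alpha>_def)
  qed (use nn anti \<alpha> exps e C' in auto)
  moreover have "k1 + D > 0" using k1 by (simp add: D_def add_pos_nonneg)
  ultimately show ?thesis by blast
qed

end

section \<open>Truncations\<close>

text \<open>A nonpositive x is a minimum point of the step function. This includes the end point 0,
  which corresponds to |s| = k in the truncations.\<close>

lemma deriv_smooth_step_0:
  assumes "x \<le> 0"
  shows "deriv smooth_step x = 0"
  using Ck_real_deriv(1)[OF Ck_smooth_step, of x] zero_less_one
  by (rule DERIV_local_min) (simp add: smooth_step_0[OF assms] smooth_step_nonneg)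

text \<open>\<psi> is a smooth odd version of the map that cuts |s| - k to the range from 0 to d and
  keeps the sign of s. The outer factor d cancels the 1/d from the inner scaling, so one slope bound
  serves all k and d; the recursions depend on this uniformity.\<close>

lemma truncation_exists:
  "\<exists>L>0. \<forall>k d. 0 \<le> k \<longrightarrow> 0 < d \<longrightarrow> (\<exists>\<psi>. (\<forall>j. Ck j \<psi>) \<and> \<psi> 0 = 0 \<and>
    (\<forall>s. 0 \<le> deriv \<psi> s \<and> deriv \<psi> s \<le> L) \<and> (\<forall>s. \<bar>s\<bar> \<le> k \<longrightarrow> \<psi> s = 0 \<and> deriv \<psi> s = 0) \<and>
    (\<forall>s. \<bar>\<psi> s\<bar> \<le> d) \<and> (\<forall>s. k + d \<le> \<bar>s\<bar> \<longrightarrow> \<bar>\<psi> s\<bar> = d))"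
proof -
  obtain L where L: "L > 0" "\<And>x. 0 \<le> deriv smooth_step x" "\<And>x. deriv smooth_step x \<le> L"
    using smooth_step_deriv_bound by blast
  have "\<exists>\<psi>. (\<forall>j. Ck j \<psi>) \<and> \<psi> 0 = 0 \<and>
    (\<forall>s. 0 \<le> deriv \<psi> s \<and> deriv \<psi> s \<le> 2 * L) \<and> (\<forall>s. \<bar>s\<bar> \<le> k \<longrightarrow> \<psi> s = 0 \<and> deriv \<psi> s = 0) \<and>
    (\<forall>s. \<bar>\<psi> s\<bar> \<le> d) \<and> (\<forall>s. k + d \<le> \<bar>s\<bar> \<longrightarrow> \<bar>\<psi> s\<bar> = d)" if k: "0 \<le> k" and d: "0 < d" for k d
  proof (intro exI conjI allI impI)
    define \<psi> where "\<psi> s = d * (smooth_step ((s - k) / d) - smooth_step ((- s - k) / d))" for s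
    have \<psi>: "(\<psi> has_real_derivative deriv smooth_step ((s - k) / d) + deriv smooth_step ((- s - k) / d)) (at s)" for s
      unfolding \<psi>_def[abs_def] using d
      by (auto intro!: derivative_eq_intros DERIV_chain2[OF Ck_real_deriv(1)[OF Ck_smooth_step]] simp: field_simps)
    note d\<psi> = DERIV_imp_deriv[OF \<psi>]
    show "Ck j \<psi>" for j
    proof -
      have "Ck j (\<lambda>s. d * (smooth_step ((1 / d) * s + (- k / d)) + (- 1) * smooth_step ((- 1 / d) * s + (- k / d))))"
        by (intro Ck_mult Ck_add Ck_const Ck_compose[OF Ck_smooth_step] Ck_real_affine)
      then show ?thesis by (simp add: \<psi>_def[abs_def] diff_divide_distrib)
    qed
    show "\<psi> 0 = 0" by (simp add: \<psi>_def)
    show "0 \<le> deriv \<psi> s" "deriv \<psi> s \<le> 2 * L" for s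
      unfolding d\<psi> using L(2,3)[of "(s - k) / d"] L(2,3)[of "(- s - k) / d"] by linarith+
    show "\<psi> s = 0" "deriv \<psi> s = 0" if "\<bar>s\<bar> \<le> k" for s
    proof -
      have "(s - k) / d \<le> 0" "(- s - k) / d \<le> 0" using that d by (auto simp: divide_le_0_iff)
      then show "\<psi> s = 0" "deriv \<psi> s = 0" by (simp_all add: \<psi>_def d\<psi> smooth_step_0 deriv_smooth_step_0)
    qed
    show "\<bar>\<psi> s\<bar> \<le> d" for s
    proof -
      have "\<bar>smooth_step ((s - k) / d) - smooth_step ((- s - k) / d)\<bar> \<le> 1"
        using smooth_step_nonneg[of "(s - k) / d"] smooth_step_le_1[of "(s - k) / d"]
          smooth_step_nonneg[of "(- s - k) / d"] smooth_step_le_1[of "(- s - k) / d"] by linarith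
      then show ?thesis using d by (simp add: \<psi>_def abs_mult)
    qed
    show "\<bar>\<psi> s\<bar> = d" if "k + d \<le> \<bar>s\<bar>" for s
    proof (cases "s \<ge> 0")
      case True
      then have "(s - k) / d \<ge> 1" "(- s - k) / d \<le> 0" using that d k by (auto simp: field_simps)
      then show ?thesis using d by (simp add: \<psi>_def smooth_step_0 smooth_step_1)
    next
      case False
      then have "(- s - k) / d \<ge> 1" "(s - k) / d \<le> 0" using that d k by (auto simp: field_simps)
      then show ?thesis using d by (simp add: \<psi>_def smooth_step_0 smooth_step_1)
    qed
  qed
  then show ?thesis using L(1) by (intro exI[of _ "2 * L"]) auto
qed

text \<open>The choice \<delta> = (A/B)^{1/p} makes both terms equal to the geometric mean, hence
  the factor 2. Together with \<open>le_add_powr\<close> this gives Hoelder's inequality up to that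
  factor. If A = 0 a small \<delta>, and if B = 0 a large one, forces x <= 0.\<close>

lemma le_geometric_mean_of_le_sums:
  fixes x A B p :: real
  assumes nn: "0 \<le> A" "0 \<le> B" and p: "p > 1"
    and le: "\<And>\<delta>. \<delta> > 0 \<Longrightarrow> x \<le> \<delta> * B + \<delta> powr (1 - p) * A"
  shows "x \<le> 2 * A powr (1 / p) * B powr (1 - 1 / p)"
proof (cases "A = 0 \<or> B = 0")
  case False
  then have AB: "A > 0" "B > 0" using nn by auto
  define \<delta> where "\<delta> = (A / B) powr (1 / p)"
  have \<delta>: "\<delta> > 0" using AB by (simp add: \<delta>_def)
  have "\<delta> * B = A powr (1 / p) * B powr (1 - 1 / p)"
    using AB by (simp add: \<delta>_def powr_divide powr_diff)
  moreover have "\<delta> powr (1 - p) * A = A powr (1 / p) * B powr (1 - 1 / p)"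
  proof -
    have "\<delta> powr (1 - p) = A powr (1 / p - 1) * B powr (1 - 1 / p)"
    proof -
      have "\<delta> powr (1 - p) = (A / B) powr (1 / p - 1)" using p by (simp add: \<delta>_def powr_powr diff_divide_distrib)
      also have "\<dots> = A powr (1 / p - 1) * B powr (- (1 / p - 1))"
        by (simp only: powr_divide powr_minus_divide times_divide_eq_right mult_1_right)
      finally show ?thesis by simp
    qed
    moreover have "A powr (1 / p - 1) * A = A powr (1 / p)" using AB by (simp add: powr_diff)
    ultimately show ?thesis by (simp add: mult_ac)
  qed
  ultimately show ?thesis using le[OF \<delta>] by simp
next
  case True
  have "x \<le> 0"
  proof (rule ccontr)
    assume "\<not> x \<le> 0"
    then have x: "x > 0" by simp
    show False
    proof (cases "A = 0")
      case True
      have "x \<le> x / (2 * (B + 1)) * B" using le[of "x / (2 * (B + 1))"] x nn True by simp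
      also have "\<dots> \<le> x / (2 * (B + 1)) * (B + 1)" using x nn by (intro mult_left_mono) auto
      also have "\<dots> = x / 2" using nn by (simp add: field_simps)
      finally show False using x by simp
    next
      case False
      then have A: "A > 0" "B = 0" using nn \<open>A = 0 \<or> B = 0\<close> by auto
      \<comment> \<open>Chosen so that \<delta>^{1-p} A is x/2.\<close>
      define \<delta> where "\<delta> = (x / (2 * A)) powr (1 / (1 - p))"
      have "\<delta> > 0" "\<delta> powr (1 - p) = x / (2 * A)" using x A p by (simp_all add: \<delta>_def powr_powr)
      then have "x \<le> x / (2 * A) * A" using le[of \<delta>] A by simp
      then show False using x A by simp
    qed
  qed
  then show ?thesis using nn by (meson mult_nonneg_nonneg order_trans powr_ge_zero zero_le_numeral)
qed

text \<open>The inequality is strict so that measure 0 at level k means |u| <= k almost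
  everywhere.\<close>

definition level_measure :: "'a::euclidean_space set \<Rightarrow> ('a \<Rightarrow> real) \<Rightarrow> real \<Rightarrow> real" where
  "level_measure \<Omega> u k = measure lebesgue {x \<in> \<Omega>. k < \<bar>u x\<bar>}"

context bounded_domain
begin

lemma level_set_sets:
  fixes u :: "'a \<Rightarrow> real"
  assumes "u \<in> borel_measurable (lebesgue_on \<Omega>)"
  shows "{x \<in> \<Omega>. k < \<bar>u x\<bar>} \<in> sets (lebesgue_on \<Omega>)" "{x \<in> \<Omega>. k < \<bar>u x\<bar>} \<in> sets lebesgue"
    "{x \<in> \<Omega>. k < \<bar>u x\<bar>} \<in> lmeasurable"
proof -
  note [measurable] = assms
  have "{x \<in> space (lebesgue_on \<Omega>). k < \<bar>u x\<bar>} \<in> sets (lebesgue_on \<Omega>)" by measurable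
  then show 1: "{x \<in> \<Omega>. k < \<bar>u x\<bar>} \<in> sets (lebesgue_on \<Omega>)" by (simp add: space_restrict_space)
  then show 2: "{x \<in> \<Omega>. k < \<bar>u x\<bar>} \<in> sets lebesgue"
    using open_\<Omega> by (auto simp: sets_restrict_space_iff)
  show "{x \<in> \<Omega>. k < \<bar>u x\<bar>} \<in> lmeasurable"
    by (rule fmeasurableI2[OF lmeasurable_open[OF bounded_\<Omega> open_\<Omega>] _ 2]) auto
qed

lemma level_measure_eq:
  assumes "u \<in> borel_measurable (lebesgue_on \<Omega>)"
  shows "level_measure \<Omega> u k = measure (lebesgue_on \<Omega>) {x \<in> \<Omega>. k < \<bar>u x\<bar>}"
  unfolding level_measure_def
  by (rule measure_restrict_space[symmetric]) (use open_\<Omega> in auto)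

lemma level_measure_antimono:
  assumes "u \<in> borel_measurable (lebesgue_on \<Omega>)" "k \<le> l"
  shows "level_measure \<Omega> u l \<le> level_measure \<Omega> u k"
  unfolding level_measure_eq[OF assms(1)]
  by (rule finite_measure_mono) (use level_set_sets[OF assms(1)] assms(2) in auto)

end

section \<open>The energy estimate between two levels\<close>

locale subcritical_domain = bounded_domain +
  assumes pN: "p < real DIM('a)"
begin

text \<open>The weak-type inequality for \<psi>(u) involves the integral of \<psi>'(u) |grad u|.
  Hoelder's inequality with weight \<psi>'(u) splits off the weighted energy and the integral of
  \<psi>'(u); the latter is at most a multiple of the measure of {|u| > k}, since \<psi>' vanishes
  up to k. The energy is left unevaluated and \<psi> is exported with its properties, so that the
  energy can be bounded in two different ways later.\<close>

lemma truncated_level_estimate: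
  "\<exists>C>0. \<forall>u\<in>W10 \<Omega> p. \<forall>k d. 0 \<le> k \<longrightarrow> 0 < d \<longrightarrow> (\<exists>\<psi>. continuous_on UNIV \<psi> \<and>
    continuous_on UNIV (deriv \<psi>) \<and> (\<lambda>x. \<psi> (u x)) \<in> W10 \<Omega> p \<and>
    (AE x in lebesgue_on \<Omega>. weak_grad \<Omega> (\<lambda>x. \<psi> (u x)) x = deriv \<psi> (u x) *\<^sub>R weak_grad \<Omega> u x) \<and>
    (\<forall>s. 0 \<le> deriv \<psi> s \<and> deriv \<psi> s \<le> C) \<and> (\<forall>s. \<bar>\<psi> s\<bar> \<le> d) \<and> (\<forall>s. \<bar>s\<bar> \<le> k \<longrightarrow> \<psi> s = 0) \<and>
    d * level_measure \<Omega> u (k + d) powr (1 - 1 / real DIM('a))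
      \<le> C * (LINT x|lebesgue_on \<Omega>. deriv \<psi> (u x) * norm (weak_grad \<Omega> u x) powr p) powr (1 / p)
          * level_measure \<Omega> u k powr (1 - 1 / p))"
proof -
  define \<kappa> where "\<kappa> = 1 - 1 / real DIM('a)"
  have dim: "DIM('a) \<ge> 2" using pN p by simp
  then have \<kappa>: "\<kappa> > 0" by (simp add: \<kappa>_def)
  obtain C0 where C0: "C0 > 0" "\<And>(v :: 'a \<Rightarrow> real) g K t. (\<And>x. (v has_derivative (\<lambda>u. g x \<bullet> u)) (at x)) \<Longrightarrow> continuous_on UNIV g \<Longrightarrow>
    compact K \<Longrightarrow> (\<And>x. x \<notin> K \<Longrightarrow> v x = 0) \<Longrightarrow> t > 0 \<Longrightarrow>
    t * measure lborel {x. t \<le> \<bar>v x\<bar>} powr \<kappa> \<le> C0 * (LINT x|lborel. norm (g x))"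
    using weak_type_estimate_smooth[OF dim] unfolding \<kappa>_def by metis
  obtain L where L: "L > 0" "\<And>k d. 0 \<le> k \<Longrightarrow> 0 < d \<Longrightarrow> (\<exists>\<psi>. (\<forall>j. Ck j \<psi>) \<and> \<psi> 0 = 0 \<and>
    (\<forall>s. 0 \<le> deriv \<psi> s \<and> deriv \<psi> s \<le> L) \<and> (\<forall>s. \<bar>s\<bar> \<le> k \<longrightarrow> \<psi> s = 0 \<and> deriv \<psi> s = 0) \<and>
    (\<forall>s. \<bar>\<psi> s\<bar> \<le> d) \<and> (\<forall>s. k + d \<le> \<bar>s\<bar> \<longrightarrow> \<bar>\<psi> s\<bar> = d))"
    using truncation_exists by metis
  \<comment> \<open>One constant serves as slope bound and in the estimate. The 2 comes from the
    geometric mean, the power of L from the bound for the integral of \<psi>'(u).\<close>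
  define C where "C = max L (2 * C0 * L powr (1 - 1 / p))"
  have C: "C > 0" "L \<le> C" "2 * C0 * L powr (1 - 1 / p) \<le> C" using L by (auto simp: C_def less_max_iff_disj)
  have "\<exists>\<psi>. continuous_on UNIV \<psi> \<and>
    continuous_on UNIV (deriv \<psi>) \<and> (\<lambda>x. \<psi> (u x)) \<in> W10 \<Omega> p \<and>
    (AE x in lebesgue_on \<Omega>. weak_grad \<Omega> (\<lambda>x. \<psi> (u x)) x = deriv \<psi> (u x) *\<^sub>R weak_grad \<Omega> u x) \<and>
    (\<forall>s. 0 \<le> deriv \<psi> s \<and> deriv \<psi> s \<le> C) \<and> (\<forall>s. \<bar>\<psi> s\<bar> \<le> d) \<and> (\<forall>s. \<bar>s\<bar> \<le> k \<longrightarrow> \<psi> s = 0) \<and>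
    d * level_measure \<Omega> u (k + d) powr \<kappa>
      \<le> C * (LINT x|lebesgue_on \<Omega>. deriv \<psi> (u x) * norm (weak_grad \<Omega> u x) powr p) powr (1 / p)
          * level_measure \<Omega> u k powr (1 - 1 / p)"
    if u: "u \<in> W10 \<Omega> p" and k: "0 \<le> k" and d: "0 < d" for u k d
  proof -
    let ?M = "lebesgue_on \<Omega>" and ?G = "weak_grad \<Omega> u"
    obtain \<psi> where \<psi>: "\<And>j. Ck j \<psi>" "\<psi> 0 = 0" "\<And>s. 0 \<le> deriv \<psi> s" "\<And>s. deriv \<psi> s \<le> L"
      "\<And>s. \<bar>s\<bar> \<le> k \<Longrightarrow> \<psi> s = 0" "\<And>s. \<bar>s\<bar> \<le> k \<Longrightarrow> deriv \<psi> s = 0" "\<And>s. \<bar>\<psi> s\<bar> \<le> d"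
      "\<And>s. k + d \<le> \<bar>s\<bar> \<Longrightarrow> \<bar>\<psi> s\<bar> = d"
      using L(2)[OF k d] by blast
    have cont: "continuous_on UNIV \<psi>" "continuous_on UNIV (deriv \<psi>)"
      using \<psi>(1)[of 0] Ck_real_deriv(2)[OF \<psi>(1)] by auto
    have \<psi>'b: "\<bar>deriv \<psi> s\<bar> \<le> L" for s using \<psi>(3,4)[of s] by simp
    note W = W10_chain_rule[OF u \<psi>(1,2) \<psi>'b]
    note uL = W10_Lp(1)[OF u] and GL = W10_Lp(2)[OF u]
    have um[measurable]: "u \<in> borel_measurable ?M" by (rule Lp_measurable[OF uL])
    have Gm[measurable]: "?G \<in> borel_measurable ?M" by (rule Lp_measurable[OF GL])
    have wGm[measurable]: "weak_grad \<Omega> (\<lambda>x. \<psi> (u x)) \<in> borel_measurable ?M"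
      by (rule Lp_measurable[OF W10_Lp(2)[OF W(1)]])
    have \<psi>'m[measurable]: "deriv \<psi> \<in> borel_measurable borel" using cont(2) by (rule borel_measurable_continuous_onI)
    have iG: "integrable ?M (\<lambda>x. norm (?G x))" and iGp: "integrable ?M (\<lambda>x. norm (?G x) powr p)"
      using Lp_imp_integrable[OF GL] Lp_integrable_powr[OF GL] p by auto
    have bm: "integrable ?M (\<lambda>x. deriv \<psi> (u x) * g x)" if "integrable ?M g" for g :: "'a \<Rightarrow> real"
    proof (rule Bochner_Integration.integrable_bound)
      show "integrable ?M (\<lambda>x. L * g x)" using that by simp
      show "AE x in ?M. norm (deriv \<psi> (u x) * g x) \<le> norm (L * g x)"
        using \<psi>'b L(1) by (intro AE_I2) (auto simp: abs_mult intro!: mult_right_mono)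
      show "(\<lambda>x. deriv \<psi> (u x) * g x) \<in> borel_measurable ?M" using borel_measurable_integrable[OF that] by measurable
    qed
    define A where "A = (LINT x|?M. deriv \<psi> (u x) * norm (?G x) powr p)"
    define B where "B = (LINT x|?M. deriv \<psi> (u x))"
    have A: "A \<ge> 0" and B: "B \<ge> 0" unfolding A_def B_def by (auto intro!: Bochner_Integration.integral_nonneg mult_nonneg_nonneg \<psi>(3))
    have i1: "integrable ?M (\<lambda>x. deriv \<psi> (u x))" using bm[of "\<lambda>x. 1"] by simp
    have Bl: "B \<le> L * level_measure \<Omega> u k"
    proof -
      have "B \<le> (LINT x|?M. L * indicator {x \<in> \<Omega>. k < \<bar>u x\<bar>} x)" unfolding B_def
      proof (rule integral_mono[OF i1])
        show "integrable ?M (\<lambda>x. L * indicator {x \<in> \<Omega>. k < \<bar>u x\<bar>} x)"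
          using level_set_sets(1)[OF um] by (intro integrable_mult_right integrable_real_indicator) (auto simp: emeasure_eq_measure)
        fix x assume "x \<in> space ?M"
        then show "deriv \<psi> (u x) \<le> L * indicator {x \<in> \<Omega>. k < \<bar>u x\<bar>} x"
          using \<psi>(4)[of "u x"] \<psi>(6)[of "u x"] by (cases "k < \<bar>u x\<bar>") (auto simp: space_restrict_space)
      qed
      also have "\<dots> = L * level_measure \<Omega> u k"
        using level_set_sets(1)[OF um, of k] sets.sets_into_space[OF level_set_sets(1)[OF um, of k]]
        by (simp add: level_measure_eq[OF um] Int_absorb2)
      finally show ?thesis .
    qed
    define X where "X = (LINT x|?M. deriv \<psi> (u x) * norm (?G x))"
    have X: "X \<le> 2 * A powr (1 / p) * B powr (1 - 1 / p)"
    proof (rule le_geometric_mean_of_le_sums[OF A B p])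
      fix \<delta> :: real assume \<delta>: "\<delta> > 0"
      have "X \<le> (LINT x|?M. \<delta> * deriv \<psi> (u x) + \<delta> powr (1 - p) * (deriv \<psi> (u x) * norm (?G x) powr p))"
        unfolding X_def
      proof (rule integral_mono)
        show "integrable ?M (\<lambda>x. deriv \<psi> (u x) * norm (?G x))" by (rule bm[OF iG])
        show "integrable ?M (\<lambda>x. \<delta> * deriv \<psi> (u x) + \<delta> powr (1 - p) * (deriv \<psi> (u x) * norm (?G x) powr p))"
          using bm[OF iGp] i1 by simp
        fix x
        have "deriv \<psi> (u x) * norm (?G x) \<le> deriv \<psi> (u x) * (\<delta> + \<delta> powr (1 - p) * norm (?G x) powr p)"
          using p \<delta> by (intro mult_left_mono le_add_powr \<psi>) auto
        then show "deriv \<psi> (u x) * norm (?G x) \<le> \<delta> * deriv \<psi> (u x) + \<delta> powr (1 - p) * (deriv \<psi> (u x) * norm (?G x) powr p)"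
          by (simp add: algebra_simps)
      qed
      also have "\<dots> = \<delta> * B + \<delta> powr (1 - p) * A"
        using bm[OF iGp] i1 by (simp add: A_def B_def)
      finally show "X \<le> \<delta> * B + \<delta> powr (1 - p) * A" .
    qed
    have "{x \<in> \<Omega>. k + d < \<bar>u x\<bar>} \<subseteq> {x \<in> \<Omega>. d \<le> \<bar>\<psi> (u x)\<bar>}" using \<psi>(8) by auto
    moreover have "{x \<in> \<Omega>. d \<le> \<bar>\<psi> (u x)\<bar>} \<in> lmeasurable"
    proof -
      have [measurable]: "\<psi> \<in> borel_measurable borel" using cont(1) by (rule borel_measurable_continuous_onI)
      have "{x \<in> space ?M. d \<le> \<bar>\<psi> (u x)\<bar>} \<in> sets ?M" by measurable
      then have "{x \<in> \<Omega>. d \<le> \<bar>\<psi> (u x)\<bar>} \<in> sets lebesgue"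
        using open_\<Omega> by (auto simp: sets_restrict_space_iff space_restrict_space)
      then show ?thesis by (intro fmeasurableI2[OF lmeasurable_open[OF bounded_\<Omega> open_\<Omega>]]) auto
    qed
    ultimately have "level_measure \<Omega> u (k + d) \<le> measure lebesgue {x \<in> \<Omega>. d \<le> \<bar>\<psi> (u x)\<bar>}"
      unfolding level_measure_def using level_set_sets(2)[OF um] by (intro measure_mono_fmeasurable)
    then have "d * level_measure \<Omega> u (k + d) powr \<kappa> \<le> d * measure lebesgue {x \<in> \<Omega>. d \<le> \<bar>\<psi> (u x)\<bar>} powr \<kappa>"
      using d \<kappa> by (intro mult_left_mono powr_mono2) (auto simp: level_measure_def)
    also have "\<dots> \<le> C0 * (LINT x|?M. norm (weak_grad \<Omega> (\<lambda>x. \<psi> (u x)) x))"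
      by (rule weak_type_estimate_W10[OF C0 \<kappa> W(1) d])
    also have "(LINT x|?M. norm (weak_grad \<Omega> (\<lambda>x. \<psi> (u x)) x)) = X"
      unfolding X_def
    proof (rule integral_cong_AE)
      show "AE x in ?M. norm (weak_grad \<Omega> (\<lambda>x. \<psi> (u x)) x) = deriv \<psi> (u x) * norm (?G x)"
        using W(2) by eventually_elim (simp add: \<psi>)
    qed measurable
    also have "C0 * X \<le> C0 * (2 * A powr (1 / p) * (L * level_measure \<Omega> u k) powr (1 - 1 / p))"
    proof (rule mult_left_mono)
      have "B powr (1 - 1 / p) \<le> (L * level_measure \<Omega> u k) powr (1 - 1 / p)"
        using B Bl p by (intro powr_mono2) auto
      then have "2 * A powr (1 / p) * B powr (1 - 1 / p) \<le> 2 * A powr (1 / p) * (L * level_measure \<Omega> u k) powr (1 - 1 / p)"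
        by (intro mult_left_mono) auto
      with X show "X \<le> 2 * A powr (1 / p) * (L * level_measure \<Omega> u k) powr (1 - 1 / p)" by linarith
    qed (use C0 in simp)
    also have "\<dots> = (2 * C0 * L powr (1 - 1 / p)) * (A powr (1 / p) * level_measure \<Omega> u k powr (1 - 1 / p))"
      using L(1) by (simp add: powr_mult level_measure_def)
    also have "\<dots> \<le> C * (A powr (1 / p) * level_measure \<Omega> u k powr (1 - 1 / p))"
      by (intro mult_right_mono C) auto
    finally have "d * level_measure \<Omega> u (k + d) powr \<kappa> \<le> C * A powr (1 / p) * level_measure \<Omega> u k powr (1 - 1 / p)"
      by (simp add: mult.assoc)
    moreover have "deriv \<psi> s \<le> C" for s using \<psi>(4)[of s] C(2) by linarith
    ultimately show ?thesis
      using cont W \<psi> unfolding A_def by (intro exI[of _ \<psi>] conjI allI impI) auto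
  qed
  then show ?thesis using C(1) unfolding \<kappa>_def by (intro exI[of _ C]) auto
qed

end

section \<open>Weak solutions\<close>

text \<open>The main part of a Lebesgue set is Borel and differs from it by a null set, so the
  potential estimate, taken at the origin, carries over.\<close>

lemma nn_integral_weight_le:
  assumes "0 < \<mu>" "\<mu> < real DIM('a::euclidean_space)"
  shows "\<exists>C>0. \<forall>A::'a set. A \<in> lmeasurable \<longrightarrow>
    (\<integral>\<^sup>+x. ennreal (norm x powr (- \<mu>)) * indicator A x \<partial>lebesgue)
      \<le> ennreal (C * measure lebesgue A powr (1 - \<mu> / real DIM('a)))"
proof -
  obtain C where C: "C > 0" "\<And>(y::'a) A. A \<in> sets lborel \<Longrightarrow> emeasure lborel A < \<infinity> \<Longrightarrow>
    (\<integral>\<^sup>+x. ennreal (norm (x - y) powr (- \<mu>) * indicator A x) \<partial>lborel)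
      \<le> ennreal (C * measure lborel A powr (1 - \<mu> / real DIM('a)))"
    using nn_integral_riesz_potential_le[OF assms] by blast
  have "(\<integral>\<^sup>+x. ennreal (norm x powr (- \<mu>)) * indicator A x \<partial>lebesgue)
      \<le> ennreal (C * measure lebesgue A powr (1 - \<mu> / real DIM('a)))" if A: "A \<in> lmeasurable" for A :: "'a set"
  proof -
    define B where "B = main_part lborel A"
    have sA: "A \<in> sets lebesgue" using A by (rule fmeasurableD)
    have B[measurable]: "B \<in> sets lborel" unfolding B_def by (rule main_part_sets[OF sA])
    have eB: "emeasure lborel B = emeasure lebesgue A" unfolding B_def using sA by simp
    have mB: "measure lborel B = measure lebesgue A" using eB by (simp add: measure_def)
    have "AE x in lebesgue. x \<notin> null_part lborel A" by (rule AE_completion[OF AE_notin_null_part[OF sA]])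
    then have "AE x in lebesgue. ennreal (norm x powr (- \<mu>)) * indicator A x = ennreal (norm (x - 0) powr (- \<mu>) * indicator B x)"
    proof eventually_elim
      case (elim x)
      then have "x \<in> A \<longleftrightarrow> x \<in> B" using main_part_null_part_Un[OF sA] by (auto simp: B_def)
      then show ?case by (auto simp: indicator_def)
    qed
    then have "(\<integral>\<^sup>+x. ennreal (norm x powr (- \<mu>)) * indicator A x \<partial>lebesgue)
      = (\<integral>\<^sup>+x. ennreal (norm (x - 0) powr (- \<mu>) * indicator B x) \<partial>lebesgue)"
      by (rule nn_integral_cong_AE)
    also have "\<dots> = (\<integral>\<^sup>+x. ennreal (norm (x - 0) powr (- \<mu>) * indicator B x) \<partial>lborel)"
      by (rule nn_integral_completion)
    also have "\<dots> \<le> ennreal (C * measure lborel B powr (1 - \<mu> / real DIM('a)))"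
      using A eB by (intro C B) (auto simp: fmeasurable_def simp del: emeasure_completion)
    finally show ?thesis by (simp only: mB)
  qed
  with C(1) show ?thesis by blast
qed

section \<open>Level recursions for weak solutions\<close>

definition source_mass :: "'a::euclidean_space set \<Rightarrow> ('a \<Rightarrow> real \<Rightarrow> real) \<Rightarrow> ('a \<Rightarrow> real) \<Rightarrow> real \<Rightarrow> real" where
  "source_mass \<Omega> f u k = (LINT x|lebesgue_on \<Omega>. \<bar>f x (u x)\<bar> * indicator {x \<in> \<Omega>. k < \<bar>u x\<bar>} x)"

context subcritical_domain
begin

lemma weak_solutionD:
  assumes "weak_solution \<Omega> p f u"
  shows "u \<in> W10 \<Omega> p" "u \<in> borel_measurable (lebesgue_on \<Omega>)" "integrable (lebesgue_on \<Omega>) (\<lambda>x. f x (u x))"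
    "\<And>\<phi>. \<phi> \<in> W10 \<Omega> p \<Longrightarrow> (LINT x|lebesgue_on \<Omega>.
           norm (weak_grad \<Omega> u x) powr (p - 2) * (weak_grad \<Omega> u x \<bullet> weak_grad \<Omega> \<phi> x)) =
        (LINT x|lebesgue_on \<Omega>. f x (u x) * \<phi> x)"
proof -
  show u: "u \<in> W10 \<Omega> p" using assms by (simp add: weak_solution_def)
  show "u \<in> borel_measurable (lebesgue_on \<Omega>)"
    by (rule Lp_measurable[OF W10_Lp(1)[OF u]])
  have "sobolev_exp (real DIM('a)) p > 1"
  proof -
    have "real DIM('a) < real DIM('a) * p" using p by simp
    then have "real DIM('a) - p < real DIM('a) * p" using p by linarith
    then show ?thesis using pN by (simp add: sobolev_exp_def less_divide_eq)
  qed
  then have "conj_exp (sobolev_exp (real DIM('a)) p) \<ge> 1" by (simp add: conj_exp_def)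
  then show "integrable (lebesgue_on \<Omega>) (\<lambda>x. f x (u x))"
    using assms Lp_imp_integrable by (auto simp: weak_solution_def)
  show "(LINT x|lebesgue_on \<Omega>.
           norm (weak_grad \<Omega> u x) powr (p - 2) * (weak_grad \<Omega> u x \<bullet> weak_grad \<Omega> \<phi> x)) =
        (LINT x|lebesgue_on \<Omega>. f x (u x) * \<phi> x)" if "\<phi> \<in> W10 \<Omega> p" for \<phi>
    using assms that by (simp add: weak_solution_def)
qed

lemma source_integrable:
  assumes "weak_solution \<Omega> p f u"
  shows "integrable (lebesgue_on \<Omega>) (\<lambda>x. \<bar>f x (u x)\<bar> * indicator {x \<in> \<Omega>. k < \<bar>u x\<bar>} x)"
proof -
  note D = weak_solutionD[OF assms]
  have "integrable (lebesgue_on \<Omega>) (\<lambda>x. indicator {x \<in> \<Omega>. k < \<bar>u x\<bar>} x *\<^sub>R \<bar>f x (u x)\<bar>)"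
    using D(3) by (intro integrable_mult_indicator level_set_sets[OF D(2)]) auto
  then show ?thesis by (simp add: mult.commute)
qed

text \<open>Tested with \<psi>(u), the left side of the equation is the energy weighted by
  \<psi>'(u), and the right side is at most d times the source mass because |\<psi>| <= d and \<psi>
  vanishes up to k. The slope bound alone gives the variant with the full energy. C is quantified
  before f and u, on which the independence of the final constant rests.\<close>

lemma level_recursions:
  shows "\<exists>C>0. \<forall>f u. weak_solution \<Omega> p f u \<longrightarrow> (\<forall>k d. 0 \<le> k \<longrightarrow> 0 < d \<longrightarrow>
    d * level_measure \<Omega> u (k + d) powr (1 - 1 / real DIM('a))
      \<le> C * (d * source_mass \<Omega> f u k) powr (1 / p) * level_measure \<Omega> u k powr (1 - 1 / p) \<and>
    d * level_measure \<Omega> u (k + d) powr (1 - 1 / real DIM('a))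
      \<le> C * (C * (LINT x|lebesgue_on \<Omega>. norm (weak_grad \<Omega> u x) powr p)) powr (1 / p)
        * level_measure \<Omega> u k powr (1 - 1 / p))"
proof -
  let ?M = "lebesgue_on \<Omega>" and ?\<kappa> = "1 - 1 / real DIM('a)"
  obtain C where CT: "C > 0 \<and> (\<forall>u\<in>W10 \<Omega> p. \<forall>k d. 0 \<le> k \<longrightarrow> 0 < d \<longrightarrow> (\<exists>\<psi>. continuous_on UNIV \<psi> \<and>
    continuous_on UNIV (deriv \<psi>) \<and> (\<lambda>x. \<psi> (u x)) \<in> W10 \<Omega> p \<and>
    (AE x in lebesgue_on \<Omega>. weak_grad \<Omega> (\<lambda>x. \<psi> (u x)) x = deriv \<psi> (u x) *\<^sub>R weak_grad \<Omega> u x) \<and>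
    (\<forall>s. 0 \<le> deriv \<psi> s \<and> deriv \<psi> s \<le> C) \<and> (\<forall>s. \<bar>\<psi> s\<bar> \<le> d) \<and> (\<forall>s. \<bar>s\<bar> \<le> k \<longrightarrow> \<psi> s = 0) \<and>
    d * level_measure \<Omega> u (k + d) powr ?\<kappa>
      \<le> C * (LINT x|lebesgue_on \<Omega>. deriv \<psi> (u x) * norm (weak_grad \<Omega> u x) powr p) powr (1 / p)
          * level_measure \<Omega> u k powr (1 - 1 / p)))"
    using truncated_level_estimate by (rule exE)
  note C = conjunct1[OF CT] and T = conjunct2[OF CT]
  have "d * level_measure \<Omega> u (k + d) powr ?\<kappa>
      \<le> C * (d * source_mass \<Omega> f u k) powr (1 / p) * level_measure \<Omega> u k powr (1 - 1 / p) \<and>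
    d * level_measure \<Omega> u (k + d) powr ?\<kappa>
      \<le> C * (C * (LINT x|?M. norm (weak_grad \<Omega> u x) powr p)) powr (1 / p)
        * level_measure \<Omega> u k powr (1 - 1 / p)"
    if ws: "weak_solution \<Omega> p f u" and k: "0 \<le> k" and d: "0 < d" for f u k d
  proof -
    let ?G = "weak_grad \<Omega> u"
    note D = weak_solutionD[OF ws]
    note GL = W10_Lp(2)[OF D(1)]
    obtain \<psi> where \<psi>: "continuous_on UNIV \<psi>" "continuous_on UNIV (deriv \<psi>)" "(\<lambda>x. \<psi> (u x)) \<in> W10 \<Omega> p"
      "AE x in ?M. weak_grad \<Omega> (\<lambda>x. \<psi> (u x)) x = deriv \<psi> (u x) *\<^sub>R ?G x"
      "\<And>s. 0 \<le> deriv \<psi> s" "\<And>s. deriv \<psi> s \<le> C" "\<And>s. \<bar>\<psi> s\<bar> \<le> d" "\<And>s. \<bar>s\<bar> \<le> k \<Longrightarrow> \<psi> s = 0"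
      and est: "d * level_measure \<Omega> u (k + d) powr ?\<kappa>
      \<le> C * (LINT x|?M. deriv \<psi> (u x) * norm (?G x) powr p) powr (1 / p) * level_measure \<Omega> u k powr (1 - 1 / p)"
      using T[rule_format, OF D(1) k d] by blast
    define A where "A = (LINT x|?M. deriv \<psi> (u x) * norm (?G x) powr p)"
    have A0: "A \<ge> 0" unfolding A_def by (auto intro!: Bochner_Integration.integral_nonneg mult_nonneg_nonneg \<psi>(5))
    note um[measurable] = D(2)
    have Gm[measurable]: "?G \<in> borel_measurable ?M" by (rule Lp_measurable[OF GL])
    have wGm[measurable]: "weak_grad \<Omega> (\<lambda>x. \<psi> (u x)) \<in> borel_measurable ?M"
      by (rule Lp_measurable[OF W10_Lp(2)[OF \<psi>(3)]])
    have \<psi>m[measurable]: "\<psi> \<in> borel_measurable borel" "deriv \<psi> \<in> borel_measurable borel"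
      using \<psi>(1,2) by (auto intro: borel_measurable_continuous_onI)
    have iGp: "integrable ?M (\<lambda>x. norm (?G x) powr p)" by (rule Lp_integrable_powr[OF GL])
    have iA: "integrable ?M (\<lambda>x. deriv \<psi> (u x) * norm (?G x) powr p)"
    proof (rule Bochner_Integration.integrable_bound)
      show "integrable ?M (\<lambda>x. C * norm (?G x) powr p)" using iGp by simp
      show "AE x in ?M. norm (deriv \<psi> (u x) * norm (?G x) powr p) \<le> norm (C * norm (?G x) powr p)"
        using \<psi>(5,6) C by (intro AE_I2) (auto simp: abs_mult intro!: mult_right_mono)
    qed measurable
    have "A \<le> C * (LINT x|?M. norm (?G x) powr p)"
    proof -
      have "A \<le> (LINT x|?M. C * norm (?G x) powr p)" unfolding A_def
        by (rule integral_mono[OF iA]) (use iGp \<psi>(6) in \<open>auto intro!: mult_right_mono\<close>)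
      then show ?thesis by simp
    qed
    moreover have "A \<le> d * source_mass \<Omega> f u k"
    proof -
      have "A = (LINT x|?M. norm (?G x) powr (p - 2) * (?G x \<bullet> weak_grad \<Omega> (\<lambda>x. \<psi> (u x)) x))"
        unfolding A_def
      proof (rule integral_cong_AE)
        show "AE x in ?M. deriv \<psi> (u x) * norm (?G x) powr p =
            norm (?G x) powr (p - 2) * (?G x \<bullet> weak_grad \<Omega> (\<lambda>x. \<psi> (u x)) x)"
          using \<psi>(4)
        proof eventually_elim
          case (elim x)
          have "norm (?G x) powr p = norm (?G x) powr (p - 2) * (?G x \<bullet> ?G x)"
          proof (cases "?G x = 0")
            case False
            then have "norm (?G x) powr p = norm (?G x) powr (p - 2) * norm (?G x) powr 2"
              by (simp only: powr_add[symmetric]) simp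
            then show ?thesis using False by (simp add: power2_norm_eq_inner)
          qed simp
          then show ?case by (simp add: elim mult_ac)
        qed
      qed measurable
      also have "\<dots> = (LINT x|?M. f x (u x) * \<psi> (u x))" by (rule D(4)[OF \<psi>(3)])
      also have "\<dots> \<le> (LINT x|?M. d * (\<bar>f x (u x)\<bar> * indicator {x \<in> \<Omega>. k < \<bar>u x\<bar>} x))"
      proof (rule integral_mono)
        show "integrable ?M (\<lambda>x. f x (u x) * \<psi> (u x))"
        proof (rule Bochner_Integration.integrable_bound)
          show "integrable ?M (\<lambda>x. d * \<bar>f x (u x)\<bar>)" using D(3) by simp
          show "AE x in ?M. norm (f x (u x) * \<psi> (u x)) \<le> norm (d * \<bar>f x (u x)\<bar>)"
            using \<psi>(7) d by (intro AE_I2) (simp add: abs_mult mult.commute[of d] mult_left_mono)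
          show "(\<lambda>x. f x (u x) * \<psi> (u x)) \<in> borel_measurable ?M"
            using borel_measurable_integrable[OF D(3)] by measurable
        qed
        show "integrable ?M (\<lambda>x. d * (\<bar>f x (u x)\<bar> * indicator {x \<in> \<Omega>. k < \<bar>u x\<bar>} x))"
          using source_integrable[OF ws] by (rule integrable_mult_right)
        fix x assume x: "x \<in> space ?M"
        show "f x (u x) * \<psi> (u x) \<le> d * (\<bar>f x (u x)\<bar> * indicator {x \<in> \<Omega>. k < \<bar>u x\<bar>} x)"
        proof (cases "k < \<bar>u x\<bar>")
          case True
          have "f x (u x) * \<psi> (u x) \<le> \<bar>f x (u x)\<bar> * \<bar>\<psi> (u x)\<bar>" by (metis abs_ge_self abs_mult)
          also have "\<dots> \<le> \<bar>f x (u x)\<bar> * d" by (intro mult_left_mono \<psi>) auto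
          finally show ?thesis using True x by (simp add: space_restrict_space mult.commute)
        qed (use \<psi>(8) in simp)
      qed
      finally show ?thesis by (simp add: source_mass_def)
    qed
    moreover have "C * A powr (1 / p) * level_measure \<Omega> u k powr (1 - 1 / p) \<le> C * X powr (1 / p) * level_measure \<Omega> u k powr (1 - 1 / p)"
      if "A \<le> X" for X
      using that A0 C p by (intro mult_right_mono mult_left_mono powr_mono2) auto
    ultimately show ?thesis using est unfolding A_def[symmetric] by (meson order_trans)
  qed
  with C show ?thesis by blast
qed

text \<open>Every relevant point lies in a level set {|u| > l i} whose index i also bounds |f(x,u)|
  there, so the integrand is at most the sum over all i. Allowing a sequence of levels covers both
  applications: dyadic levels under mere growth conditions, and a single level for a bounded
  solution.\<close>

lemma source_mass_le_sum:
  assumes ws: "weak_solution \<Omega> p f u"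
    and C: "\<And>A::'a set. A \<in> lmeasurable \<Longrightarrow>
    (\<integral>\<^sup>+x. ennreal (norm x powr (- \<mu>)) * indicator A x \<partial>lebesgue) \<le> ennreal (C * measure lebesgue A powr \<theta>)" "C \<ge> 0"
    and c: "\<And>i::nat. 0 \<le> c i"
    and pt: "AE x in lebesgue_on \<Omega>. k < \<bar>u x\<bar> \<longrightarrow> (\<exists>i. l i < \<bar>u x\<bar> \<and> \<bar>f x (u x)\<bar> \<le> c i * norm x powr (- \<mu>))"
    and b: "\<And>i. c i * (C * level_measure \<Omega> u (l i) powr \<theta>) \<le> b i" and R: "b sums R"
  shows "source_mass \<Omega> f u k \<le> R"
proof -
  note um[measurable] = weak_solutionD(2)[OF ws]
  let ?A = "\<lambda>k. {x \<in> \<Omega>. k < \<bar>u x\<bar>}" and ?F = "\<lambda>x. \<bar>f x (u x)\<bar> * indicator {x \<in> \<Omega>. k < \<bar>u x\<bar>} x"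
  have b0: "b i \<ge> 0" for i
    using b[of i] c[of i] C(2) by (meson mult_nonneg_nonneg order_trans powr_ge_zero)
  have "ennreal (source_mass \<Omega> f u k) = (\<integral>\<^sup>+x. ennreal (?F x) \<partial>lebesgue_on \<Omega>)"
    unfolding source_mass_def by (rule nn_integral_eq_integral[symmetric, OF source_integrable[OF ws]]) auto
  also have "\<dots> = (\<integral>\<^sup>+x. ennreal (?F x) * indicator \<Omega> x \<partial>lebesgue)"
    using open_\<Omega> by (simp add: nn_integral_restrict_space)
  also have "\<dots> \<le> (\<integral>\<^sup>+x. (\<Sum>i. ennreal (c i) * (ennreal (norm x powr (- \<mu>)) * indicator (?A (l i)) x)) \<partial>lebesgue)"
  proof (rule nn_integral_mono_AE)
    have "AE x in lebesgue. x \<in> \<Omega> \<longrightarrow> k < \<bar>u x\<bar> \<longrightarrow> (\<exists>i. l i < \<bar>u x\<bar> \<and> \<bar>f x (u x)\<bar> \<le> c i * norm x powr (- \<mu>))"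
      using pt open_\<Omega> by (simp add: AE_restrict_space_iff)
    then show "AE x in lebesgue. ennreal (?F x) * indicator \<Omega> x
        \<le> (\<Sum>i. ennreal (c i) * (ennreal (norm x powr (- \<mu>)) * indicator (?A (l i)) x))"
    proof eventually_elim
      case (elim x)
      show ?case
      proof (cases "x \<in> \<Omega> \<and> k < \<bar>u x\<bar>")
        case True
        then obtain i where i: "l i < \<bar>u x\<bar>" "\<bar>f x (u x)\<bar> \<le> c i * norm x powr (- \<mu>)" using elim by blast
        let ?s = "\<lambda>i. ennreal (c i) * (ennreal (norm x powr (- \<mu>)) * indicator (?A (l i)) x)"
        have "ennreal (?F x) * indicator \<Omega> x = ennreal \<bar>f x (u x)\<bar>" using True by simp
        also have "\<dots> \<le> ?s i" using i c[of i] True by (simp add: ennreal_mult'[symmetric] ennreal_leI)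
        also have "\<dots> \<le> suminf ?s" using sum_le_suminf[of ?s "{i}"] by (simp del: sum_mult_indicator)
        finally show ?thesis .
      qed auto
    qed
  qed
  also have "\<dots> = (\<Sum>i. \<integral>\<^sup>+x. ennreal (c i) * (ennreal (norm x powr (- \<mu>)) * indicator (?A (l i)) x) \<partial>lebesgue)"
  proof (rule nn_integral_suminf)
    fix i
    have [measurable]: "?A (l i) \<in> sets lebesgue" by (rule level_set_sets[OF um])
    have [measurable]: "(\<lambda>x::'a. ennreal (norm x powr (- \<mu>))) \<in> borel_measurable lebesgue"
      by (rule measurable_completion) measurable
    show "(\<lambda>x. ennreal (c i) * (ennreal (norm x powr (- \<mu>)) * indicator (?A (l i)) x)) \<in> borel_measurable lebesgue"
      by measurable
  qed
  also have "\<dots> \<le> (\<Sum>i. ennreal (b i))"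
  proof (rule suminf_le)
    fix i
    have [measurable]: "?A (l i) \<in> sets lebesgue" by (rule level_set_sets[OF um])
    have [measurable]: "(\<lambda>x::'a. ennreal (norm x powr (- \<mu>))) \<in> borel_measurable lebesgue"
      by (rule measurable_completion) measurable
    have "(\<integral>\<^sup>+x. ennreal (c i) * (ennreal (norm x powr (- \<mu>)) * indicator (?A (l i)) x) \<partial>lebesgue)
        = ennreal (c i) * (\<integral>\<^sup>+x. ennreal (norm x powr (- \<mu>)) * indicator (?A (l i)) x \<partial>lebesgue)"
      by (rule nn_integral_cmult) measurable
    also have "\<dots> \<le> ennreal (c i) * ennreal (C * measure lebesgue (?A (l i)) powr \<theta>)"
      by (intro mult_left_mono C level_set_sets[OF um]) auto
    also have "\<dots> = ennreal (c i * (C * level_measure \<Omega> u (l i) powr \<theta>))"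
      using c[of i] by (simp add: ennreal_mult' level_measure_def)
    also have "\<dots> \<le> ennreal (b i)" by (rule ennreal_leI[OF b])
    finally show "(\<integral>\<^sup>+x. ennreal (c i) * (ennreal (norm x powr (- \<mu>)) * indicator (?A (l i)) x) \<partial>lebesgue) \<le> ennreal (b i)" .
  qed auto
  also have "\<dots> = ennreal R" by (rule suminf_ennreal_eq[OF b0 R])
  finally show ?thesis
    using sums_le[OF _ sums_zero R] b0 by (subst (asm) ennreal_le_iff) auto
qed

section \<open>Boundedness of weak solutions\<close>

lemma level_measure_zero_imp_bounded:
  assumes "u \<in> borel_measurable (lebesgue_on \<Omega>)" "level_measure \<Omega> u k = 0"
  shows "Linf_norm \<Omega> u \<le> ereal k"
proof -
  note [measurable] = assms(1)
  have "emeasure (lebesgue_on \<Omega>) {x \<in> \<Omega>. k < \<bar>u x\<bar>} = 0"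
    using assms(2) unfolding level_measure_eq[OF assms(1)] by (simp add: emeasure_eq_measure)
  then have "AE x in lebesgue_on \<Omega>. x \<notin> {x \<in> \<Omega>. k < \<bar>u x\<bar>}"
    using level_set_sets(1)[OF assms(1)] by (intro AE_not_in) (auto simp: null_sets_def)
  then have "AE x in lebesgue_on \<Omega>. ereal \<bar>u x\<bar> \<le> ereal k"
    using AE_space by eventually_elim (auto simp: space_restrict_space not_less)
  then show ?thesis unfolding Linf_norm_def by (intro esssup_I) measurable
qed

text \<open>Only finiteness is claimed, so the constant of \<open>level_decay\<close> may contain
  the energy of u. For \<open>source\<close>, the layer where |u| lies between 2^i k and 2^{i+1} k
  contributes at most a multiple of (2^i k)^{q-1} from the growth times E (2^i k)^{-q} from the
  measure, that is E / (2^i k), and the layers add up to a geometric series.\<close>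

lemma weak_solution_bounded:
  assumes \<mu>: "0 < \<mu>" "\<mu> < p" and ws: "weak_solution \<Omega> p f u"
    and f: "\<And>x s. x \<in> \<Omega> \<Longrightarrow> x \<noteq> 0 \<Longrightarrow> \<bar>f x s\<bar> \<le> norm x powr (- \<mu>) * ft s"
    and ft: "((\<lambda>s. ft s / \<bar>s\<bar> powr (hardy_sobolev_exp (real DIM('a)) p \<mu> - 1)) \<longlongrightarrow> 0) at_infinity"
  shows "Linf_norm \<Omega> u < \<infinity>"
proof -
  define N where "N = real DIM('a)"
  define q where "q = hardy_sobolev_exp N p \<mu>"
  define \<theta> where "\<theta> = 1 - \<mu> / N"
  have N: "p < N" using pN by (simp add: N_def)
  have q: "N * p / (N - p) * (1 - \<mu> / N) = q"
    using p N by (simp add: q_def hardy_sobolev_exp_def field_simps)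
  note um = weak_solutionD(2)[OF ws]
  obtain C1 where C1: "C1 > 0" "\<And>A::'a set. A \<in> lmeasurable \<Longrightarrow>
    (\<integral>\<^sup>+x. ennreal (norm x powr (- \<mu>)) * indicator A x \<partial>lebesgue) \<le> ennreal (C1 * measure lebesgue A powr \<theta>)"
    using nn_integral_weight_le[where 'a='a and \<mu> = \<mu>] \<mu> pN unfolding \<theta>_def N_def by auto
  obtain C2 where C2: "C2 > 0" "\<And>k d. 0 \<le> k \<Longrightarrow> 0 < d \<Longrightarrow>
    d * level_measure \<Omega> u (k + d) powr (1 - 1 / N)
      \<le> C2 * (d * source_mass \<Omega> f u k) powr (1 / p) * level_measure \<Omega> u k powr (1 - 1 / p)"
    "\<And>k d. 0 \<le> k \<Longrightarrow> 0 < d \<Longrightarrow> d * level_measure \<Omega> u (k + d) powr (1 - 1 / N)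
      \<le> C2 * (C2 * (LINT x|lebesgue_on \<Omega>. norm (weak_grad \<Omega> u x) powr p)) powr (1 / p)
        * level_measure \<Omega> u k powr (1 - 1 / p)"
    using level_recursions ws unfolding N_def by blast
  define C3 where "C3 = C2 * (C2 * (LINT x|lebesgue_on \<Omega>. norm (weak_grad \<Omega> u x) powr p)) powr (1 / p)"
  define C where "C = max C2 C3"
  have C: "C > 0" "C2 \<le> C" "C3 \<le> C" using C2(1) by (auto simp: C_def)
  have lm0: "0 \<le> level_measure \<Omega> u k" for k by (simp add: level_measure_def)
  have S0: "0 \<le> source_mass \<Omega> f u k" for k unfolding source_mass_def by (intro Bochner_Integration.integral_nonneg) auto
  interpret level_decay "level_measure \<Omega> u" "source_mass \<Omega> f u" N p \<mu> C
  proof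
    show "0 \<le> level_measure \<Omega> u k" for k by (rule lm0)
    show "level_measure \<Omega> u l \<le> level_measure \<Omega> u k" if "k \<le> l" for k l
      by (rule level_measure_antimono[OF um that])
    show "d * level_measure \<Omega> u (k + d) powr (1 - 1 / N) \<le> C * level_measure \<Omega> u k powr (1 - 1 / p)"
      if "0 < k" "0 < d" for k d
    proof -
      have "d * level_measure \<Omega> u (k + d) powr (1 - 1 / N) \<le> C3 * level_measure \<Omega> u k powr (1 - 1 / p)"
        using C2(3)[of k d] that by (simp add: C3_def)
      also have "\<dots> \<le> C * level_measure \<Omega> u k powr (1 - 1 / p)" by (intro mult_right_mono C) auto
      finally show ?thesis .
    qed
    show "d * level_measure \<Omega> u (k + d) powr (1 - 1 / N)
      \<le> C * (d * source_mass \<Omega> f u k) powr (1 / p) * level_measure \<Omega> u k powr (1 - 1 / p)" if "0 < k" "0 < d" for k d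
    proof -
      have "d * level_measure \<Omega> u (k + d) powr (1 - 1 / N)
        \<le> C2 * (d * source_mass \<Omega> f u k) powr (1 / p) * level_measure \<Omega> u k powr (1 - 1 / p)"
        using C2(2)[of k d] that by simp
      also have "\<dots> \<le> C * (d * source_mass \<Omega> f u k) powr (1 / p) * level_measure \<Omega> u k powr (1 - 1 / p)"
        by (intro mult_right_mono C) auto
      finally show ?thesis .
    qed
    show "\<exists>k0>0. \<forall>k\<ge>k0. \<forall>E\<ge>0.
      (\<forall>i::nat. level_measure \<Omega> u (2 ^ i * k) powr (1 - \<mu> / N) \<le> E * (2 ^ i * k) powr (- (N * p / (N - p) * (1 - \<mu> / N)))) \<longrightarrow>
      source_mass \<Omega> f u k \<le> \<delta> * E / k" if \<delta>: "\<delta> > 0" for \<delta>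
    proof -
      \<comment> \<open>Of the factor 2^q, the part 2^{q-1} comes from the upper end of a dyadic
        layer and the remaining 2 from the sum of the geometric series; C1 is the constant of the
        weight estimate.\<close>
      define \<delta>' where "\<delta>' = \<delta> / (C1 * 2 powr q)"
      have \<delta>': "\<delta>' > 0" using \<delta> C1 by (simp add: \<delta>'_def)
      have "\<forall>\<^sub>F s in at_infinity. ft s / \<bar>s\<bar> powr (q - 1) < \<delta>'"
        using order_tendstoD(2)[OF ft \<delta>'] by (simp add: q_def N_def)
      then obtain b where b: "\<And>s. b \<le> \<bar>s\<bar> \<Longrightarrow> ft s / \<bar>s\<bar> powr (q - 1) < \<delta>'"
        by (auto simp: eventually_at_infinity)
      define k0 where "k0 = max b 1"
      have "source_mass \<Omega> f u k \<le> \<delta> * E / k" if k: "k \<ge> k0" and E: "E \<ge> 0"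
        and dec: "\<And>i::nat. level_measure \<Omega> u (2 ^ i * k) powr \<theta> \<le> E * (2 ^ i * k) powr (- q)" for k E
      proof -
        have k1: "k \<ge> 1" "k \<ge> b" using k by (auto simp: k0_def)
        define c where "c i = \<delta>' * (2 ^ (i + 1) * k) powr (q - 1)" for i :: nat
        have q1: "q \<ge> 1"
        proof -
          have "q > p" using p N \<mu> by (simp add: q_def hardy_sobolev_exp_def field_simps)
          then show ?thesis using p by simp
        qed
        show ?thesis
        proof (rule source_mass_le_sum[OF ws C1(2) less_imp_le[OF C1(1)], where c = c and l = "\<lambda>i. 2 ^ i * k"
              and b = "\<lambda>i. \<delta> * E / (2 * k) * (1 / 2) ^ i"])
          show "0 \<le> c i" for i using \<delta>' by (simp add: c_def)
          have "AE x in lebesgue_on \<Omega>. x \<noteq> 0"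
            using AE_completion[OF AE_lborel_singleton[of 0]] open_\<Omega>
            by (simp add: AE_restrict_space_iff) (auto elim: eventually_mono)
          then show "AE x in lebesgue_on \<Omega>. k < \<bar>u x\<bar> \<longrightarrow> (\<exists>i. 2 ^ i * k < \<bar>u x\<bar> \<and> \<bar>f x (u x)\<bar> \<le> c i * norm x powr (- \<mu>))"
            using AE_space
          proof eventually_elim
            case (elim x)
            show ?case
            proof
              assume ux: "k < \<bar>u x\<bar>"
              have ex: "\<exists>n. \<bar>u x\<bar> \<le> 2 ^ n * k"
              proof -
                obtain n where "\<bar>u x\<bar> / k < 2 ^ n" using real_arch_pow[of 2 "\<bar>u x\<bar> / k"] by auto
                then show ?thesis using k1 by (intro exI[of _ n]) (simp add: field_simps)
              qed
              \<comment> \<open>This least n is positive because |u x| > k, and its predecessor i is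
                the index of the layer containing x.\<close>
              define n where "n = (LEAST n. \<bar>u x\<bar> \<le> 2 ^ n * k)"
              have n: "\<bar>u x\<bar> \<le> 2 ^ n * k" unfolding n_def by (rule LeastI_ex[OF ex])
              then have "n \<noteq> 0" using ux by (cases n) auto
              then obtain i where i: "n = Suc i" by (cases n) auto
              have lo: "2 ^ i * k < \<bar>u x\<bar>"
                using not_less_Least[of i "\<lambda>n. \<bar>u x\<bar> \<le> 2 ^ n * k"] i by (simp add: n_def not_le)
              have "x \<in> \<Omega>" using elim by (simp add: space_restrict_space)
              then have fx: "\<bar>f x (u x)\<bar> \<le> norm x powr (- \<mu>) * ft (u x)" using f elim by blast
              have "ft (u x) \<le> \<delta>' * \<bar>u x\<bar> powr (q - 1)"
                using b[of "u x"] ux k1 by (simp add: pos_divide_less_eq less_imp_le)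
              also have "\<dots> \<le> c i"
                unfolding c_def using n i \<delta>' q1 by (intro mult_left_mono powr_mono2) auto
              finally have "norm x powr (- \<mu>) * ft (u x) \<le> norm x powr (- \<mu>) * c i"
                by (rule mult_left_mono) simp
              with fx have "\<bar>f x (u x)\<bar> \<le> c i * norm x powr (- \<mu>)" by (simp add: mult.commute)
              with lo show "\<exists>i. 2 ^ i * k < \<bar>u x\<bar> \<and> \<bar>f x (u x)\<bar> \<le> c i * norm x powr (- \<mu>)" by blast
            qed
          qed
          show "c i * (C1 * level_measure \<Omega> u (2 ^ i * k) powr \<theta>) \<le> \<delta> * E / (2 * k) * (1 / 2) ^ i" for i
          proof -
            define y where "y = 2 ^ i * k"
            have y: "y > 0" using k1 by (simp add: y_def)
            have "c i * (C1 * level_measure \<Omega> u y powr \<theta>) \<le> c i * (C1 * (E * y powr (- q)))"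
              using dec[of i] \<delta>' C1 by (intro mult_left_mono) (auto simp: c_def y_def)
            also have "\<dots> = \<delta>' * C1 * 2 powr (q - 1) * E * (y powr (q - 1) * y powr (- q))"
              using k1 by (simp add: c_def y_def powr_mult)
            also have "y powr (q - 1) * y powr (- q) = 1 / y"
              using y powr_add[of y "q - 1" "- q"] powr_minus_divide[of y 1] by simp
            also have "\<delta>' * C1 * 2 powr (q - 1) = \<delta> / 2" using C1 by (simp add: \<delta>'_def powr_diff)
            finally show ?thesis by (simp add: y_def power_one_over field_simps)
          qed
          have "(\<lambda>i. \<delta> * E / (2 * k) * (1 / 2) ^ i) sums (\<delta> * E / (2 * k) * (1 / (1 - 1 / 2)))"
            by (intro sums_mult geometric_sums) auto
          then show "(\<lambda>i. \<delta> * E / (2 * k) * (1 / 2) ^ i) sums (\<delta> * E / k)" by (simp add: field_simps)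
        qed
      qed
      then show ?thesis unfolding q unfolding \<theta>_def[symmetric] by (intro exI[of _ k0]) (auto simp: k0_def)
    qed
  qed (use p N \<mu> C S0 in auto)
  obtain k where "level_measure \<Omega> u k = 0" using vanishing_level by blast
  then have "Linf_norm \<Omega> u \<le> ereal k" by (rule level_measure_zero_imp_bounded[OF um])
  then show ?thesis by (rule le_less_trans) simp
qed

end

lemma eventually_less_of_Limsup_le:
  fixes g :: "'a \<Rightarrow> real"
  assumes "Limsup F (\<lambda>s. ereal (g s)) \<le> ereal c" "c < c'"
  shows "\<forall>\<^sub>F s in F. g s < c'"
proof -
  have "Limsup F (\<lambda>s. ereal (g s)) < ereal c'" using assms by (meson ereal_less(2) le_less_trans less_ereal.simps(1))
  then show ?thesis using Limsup_lessD by fastforce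
qed

section \<open>The scale-invariant bound by the critical norm\<close>

context subcritical_domain
begin

text \<open>Chebyshev's inequality turns the critical norm into a bound for the level set at half of the
  supremum, from which the iteration starts; all powers match by scaling.\<close>

lemma sup_bound_by_critical_norm:
  assumes \<mu>: "0 < \<mu>" "\<mu> < p"
  shows "\<exists>C>0. \<forall>f u K M. weak_solution \<Omega> p f u \<longrightarrow> K \<ge> 0 \<longrightarrow>
    (AE x in lebesgue_on \<Omega>. \<bar>f x (u x)\<bar> \<le> K * norm x powr (- \<mu>)) \<longrightarrow>
    M > 0 \<longrightarrow> Linf_norm \<Omega> u = ereal M \<longrightarrow>
    M powr (hardy_sobolev_exp (real DIM('a)) p \<mu> - 1)
      \<le> C * K * Lp_norm \<Omega> (sobolev_exp (real DIM('a)) p) u powr (hardy_sobolev_exp (real DIM('a)) p \<mu> - p)"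
proof -
  define N where "N = real DIM('a)"
  define q where "q = hardy_sobolev_exp N p \<mu>"
  define r where "r = sobolev_exp N p"
  define \<theta> where "\<theta> = 1 - \<mu> / N"
  define \<kappa> where "\<kappa> = 1 - 1 / N"
  define \<gamma> where "\<gamma> = (1 - \<mu> / p) / N"
  define \<alpha> where "\<alpha> = 1 - 1 / p"
  have N: "p < N" "N > 0" using p pN by (auto simp: N_def)
  have r: "r > 0" using p N by (simp add: r_def sobolev_exp_def)
  have pos: "\<gamma> > 0" "\<kappa> > 0" "\<alpha> > 0" using p N \<mu> by (auto simp: \<gamma>_def \<kappa>_def \<alpha>_def)
  have e1: "\<alpha> + \<theta> / p = \<kappa> + \<gamma>" using p N by (simp add: \<theta>_def \<kappa>_def \<gamma>_def \<alpha>_def field_simps)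
  \<comment> \<open>The identity behind the scaling: Chebyshev's inequality contributes the exponent
    r, the iteration raises it to \<gamma>, and the final p-th power turns this into q - p.\<close>
  have e2: "r * \<gamma> * p = q - p" using p N by (simp add: r_def \<gamma>_def q_def sobolev_exp_def hardy_sobolev_exp_def field_simps)
  obtain C1 where C1: "C1 > 0" "\<And>A::'a set. A \<in> lmeasurable \<Longrightarrow>
    (\<integral>\<^sup>+x. ennreal (norm x powr (- \<mu>)) * indicator A x \<partial>lebesgue) \<le> ennreal (C1 * measure lebesgue A powr \<theta>)"
    using nn_integral_weight_le[where 'a='a and \<mu> = \<mu>] \<mu> pN unfolding \<theta>_def N_def by auto
  obtain C2 where C2: "C2 > 0" "\<And>f u k d. weak_solution \<Omega> p f u \<Longrightarrow> 0 \<le> k \<Longrightarrow> 0 < d \<Longrightarrow>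
    d * level_measure \<Omega> u (k + d) powr \<kappa>
      \<le> C2 * (d * source_mass \<Omega> f u k) powr (1 / p) * level_measure \<Omega> u k powr (1 - 1 / p)"
    using level_recursions unfolding \<kappa>_def N_def by blast
  \<comment> \<open>Collects the constants of the recursion and of the weight, and the power of 2 in
    the smallness condition of \<open>stampacchia_iteration\<close>.\<close>
  define C3 where "C3 = C2 * C1 powr (1 / p) * 2 powr (\<alpha> + \<alpha> * \<kappa> / \<gamma>)"
  have C3: "C3 > 0" using C1 C2 by (simp add: C3_def)
  define C where "C = 2 powr (q - 1) * C3 powr p"
  have C: "C > 0" using C3 by (simp add: C_def)
  have "M powr (q - 1) \<le> C * K * Lp_norm \<Omega> r u powr (q - p)"
    if ws: "weak_solution \<Omega> p f u" and K: "K \<ge> 0"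
      and fK: "AE x in lebesgue_on \<Omega>. \<bar>f x (u x)\<bar> \<le> K * norm x powr (- \<mu>)"
      and M: "M > 0" and sup: "Linf_norm \<Omega> u = ereal M" for f u K M
  proof -
    let ?\<Phi> = "level_measure \<Omega> u"
    note um[measurable] = weak_solutionD(2)[OF ws]
    have \<Phi>0: "0 \<le> ?\<Phi> k" for k by (simp add: level_measure_def)
    have S0: "0 \<le> source_mass \<Omega> f u k" for k unfolding source_mass_def by (intro Bochner_Integration.integral_nonneg) auto
    have S: "source_mass \<Omega> f u k \<le> K * (C1 * ?\<Phi> k powr \<theta>)" for k
    \<comment> \<open>One level is enough for a source bounded by K times the weight: index 0
      carries K and all other terms are 0.\<close>
    proof (rule source_mass_le_sum[OF ws C1(2) less_imp_le[OF C1(1)],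
          where c = "\<lambda>i. if i = 0 then K else 0" and l = "\<lambda>i. k" and b = "\<lambda>i. if i = 0 then K * (C1 * ?\<Phi> k powr \<theta>) else 0"])
      show "AE x in lebesgue_on \<Omega>. k < \<bar>u x\<bar> \<longrightarrow> (\<exists>i::nat. k < \<bar>u x\<bar> \<and> \<bar>f x (u x)\<bar> \<le> (if i = 0 then K else 0) * norm x powr (- \<mu>))"
        using fK by eventually_elim (auto intro: exI[of _ 0])
      show "(\<lambda>i::nat. if i = 0 then K * (C1 * ?\<Phi> k powr \<theta>) else 0) sums (K * (C1 * ?\<Phi> k powr \<theta>))"
        by (rule sums_single)
    qed (use K in auto)
    define A where "A = C2 * (K * C1) powr (1 / p)"
    have A: "A \<ge> 0" using C2 by (simp add: A_def)
    have step: "d powr \<alpha> * ?\<Phi> (k + d) powr \<kappa> \<le> A * ?\<Phi> k powr (\<kappa> + \<gamma>)" if "0 \<le> k" "0 < d" for k d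
    proof -
      have "d * ?\<Phi> (k + d) powr \<kappa> \<le> C2 * (d * source_mass \<Omega> f u k) powr (1 / p) * ?\<Phi> k powr (1 - 1 / p)"
        by (rule C2(2)[OF ws that])
      also have "\<dots> \<le> C2 * (d * (K * (C1 * ?\<Phi> k powr \<theta>))) powr (1 / p) * ?\<Phi> k powr (1 - 1 / p)"
        using S[of k] S0[of k] C2(1) p that by (intro mult_right_mono mult_left_mono powr_mono2) auto
      also have "\<dots> = d powr (1 / p) * (A * (?\<Phi> k powr (\<theta> / p) * ?\<Phi> k powr \<alpha>))"
        using that K C1 by (simp add: powr_mult powr_powr A_def \<alpha>_def)
      also have "?\<Phi> k powr (\<theta> / p) * ?\<Phi> k powr \<alpha> = ?\<Phi> k powr (\<kappa> + \<gamma>)"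
        by (simp only: powr_add[symmetric] e1[symmetric] add.commute[of "\<theta> / p"])
      finally have "d powr (1 / p) * (d powr \<alpha> * ?\<Phi> (k + d) powr \<kappa>) \<le> d powr (1 / p) * (A * ?\<Phi> k powr (\<kappa> + \<gamma>))"
        using that by (simp add: powr_add[symmetric] mult.assoc[symmetric] \<alpha>_def)
      then show ?thesis using that by (subst (asm) mult_le_cancel_left_pos) auto
    qed
    define R where "R = A * ?\<Phi> (M / 2) powr \<gamma> * 2 powr (\<alpha> + \<alpha> * \<kappa> / \<gamma>)"
    have R0: "R \<ge> 0" using A by (simp add: R_def)
    \<comment> \<open>Otherwise the iteration started at M/2 would reach measure 0 at a level M/2 +
      D below M, against M being the essential supremum.\<close>
    have MR: "(M / 2) powr \<alpha> \<le> R"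
    proof (rule ccontr)
      assume "\<not> (M / 2) powr \<alpha> \<le> R"
      then have less: "R < (M / 2) powr \<alpha>" by simp
      \<comment> \<open>The entry M/4 keeps D positive when R = 0 and is still below M/2.\<close>
      define D where "D = max (R powr (1 / \<alpha>)) (M / 4)"
      have "R powr (1 / \<alpha>) < ((M / 2) powr \<alpha>) powr (1 / \<alpha>)"
        using less R0 pos by (intro powr_less_mono2) auto
      also have "\<dots> = M / 2" using pos M by (simp add: powr_powr)
      finally have D: "D < M / 2" "D > 0" using M by (auto simp: D_def less_max_iff_disj)
      have "R = (R powr (1 / \<alpha>)) powr \<alpha>" using R0 pos by (simp add: powr_powr)
      also have "\<dots> \<le> D powr \<alpha>" using pos by (intro powr_mono2) (auto simp: D_def)
      finally have RD: "R \<le> D powr \<alpha>" .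
      have "?\<Phi> (M / 2 + D) = 0"
      proof (rule stampacchia_iteration[where C = A and \<alpha> = \<alpha> and \<kappa> = \<kappa> and e = \<gamma>])
        show "A * ?\<Phi> (M / 2) powr \<gamma> * 2 powr (\<alpha> + \<alpha> * \<kappa> / \<gamma>) \<le> D powr \<alpha>" using RD by (simp add: R_def)
        show "d powr \<alpha> * ?\<Phi> (k + d) powr \<kappa> \<le> A * ?\<Phi> k powr (\<kappa> + \<gamma>)" if "M / 2 \<le> k" "0 < d" for k d
          using step[of k d] that M by simp
        show "?\<Phi> l \<le> ?\<Phi> k" if "k \<le> l" for k l
          by (rule level_measure_antimono[OF um that])
      qed (use \<Phi>0 pos A D in auto)
      then have "Linf_norm \<Omega> u \<le> ereal (M / 2 + D)"
        by (rule level_measure_zero_imp_bounded[OF um])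
      then show False using sup D by simp
    qed
    have uM: "AE x in lebesgue_on \<Omega>. \<bar>u x\<bar> \<le> M"
      using esssup_AE[of "\<lambda>x. ereal \<bar>u x\<bar>" "lebesgue_on \<Omega>"] sup unfolding Linf_norm_def by simp
    \<comment> \<open>Boundedness makes the critical power integrable, so \<open>Lp_norm\<close> is
      the genuine norm here and not the default value of a divergent integral.\<close>
    have ir: "integrable (lebesgue_on \<Omega>) (\<lambda>x. \<bar>u x\<bar> powr r)"
    proof (rule integrable_const_bound[where B = "M powr r"])
      show "AE x in lebesgue_on \<Omega>. norm (\<bar>u x\<bar> powr r) \<le> M powr r"
        using uM by eventually_elim (use r in \<open>auto intro: powr_mono2\<close>)
    qed measurable
    define I where "I = (LINT x|lebesgue_on \<Omega>. \<bar>u x\<bar> powr r)"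
    have I: "I \<ge> 0" unfolding I_def by (intro Bochner_Integration.integral_nonneg) auto
    have U: "Lp_norm \<Omega> r u = I powr (1 / r)" by (simp add: Lp_norm_def I_def)
    have cheb: "?\<Phi> (M / 2) \<le> (M / 2) powr (- r) * I"
    proof -
      note S1 = level_set_sets(1)[OF um, of "M / 2"]
      have "?\<Phi> (M / 2) = (LINT x|lebesgue_on \<Omega>. indicator {x \<in> \<Omega>. M / 2 < \<bar>u x\<bar>} x)"
        using S1 sets.sets_into_space[OF S1]
        by (simp add: level_measure_eq[OF um] Int_absorb2)
      also have "\<dots> \<le> (LINT x|lebesgue_on \<Omega>. (M / 2) powr (- r) * \<bar>u x\<bar> powr r)"
      proof (rule integral_mono)
        show "integrable (lebesgue_on \<Omega>) (indicat_real {x \<in> \<Omega>. M / 2 < \<bar>u x\<bar>})"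
          using S1 by (intro integrable_real_indicator) (auto simp: emeasure_eq_measure)
        show "integrable (lebesgue_on \<Omega>) (\<lambda>x. (M / 2) powr (- r) * \<bar>u x\<bar> powr r)" using ir by simp
        show "indicat_real {x \<in> \<Omega>. M / 2 < \<bar>u x\<bar>} x \<le> (M / 2) powr (- r) * \<bar>u x\<bar> powr r" for x
        proof (cases "M / 2 < \<bar>u x\<bar>")
          case True
          have "1 = (M / 2) powr (- r) * (M / 2) powr r" using M by (simp add: powr_add[symmetric])
          also have "\<dots> \<le> (M / 2) powr (- r) * \<bar>u x\<bar> powr r" using True M r by (intro mult_left_mono powr_mono2) auto
          finally show ?thesis by (auto simp: indicator_def)
        qed auto
      qed
      finally show ?thesis by (simp add: I_def)
    qed
    have "(M / 2) powr \<alpha> \<le> A * ((M / 2) powr (- r) * I) powr \<gamma> * 2 powr (\<alpha> + \<alpha> * \<kappa> / \<gamma>)"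
    proof -
      have "R \<le> A * ((M / 2) powr (- r) * I) powr \<gamma> * 2 powr (\<alpha> + \<alpha> * \<kappa> / \<gamma>)"
        unfolding R_def using cheb \<Phi>0 pos A by (intro mult_right_mono mult_left_mono powr_mono2) auto
      with MR show ?thesis by linarith
    qed
    also have "\<dots> = C3 * K powr (1 / p) * ((M / 2) powr (- r * \<gamma>) * I powr \<gamma>)"
      using K C1 M I by (simp add: A_def C3_def powr_mult powr_powr)
    finally have main: "(M / 2) powr \<alpha> \<le> C3 * K powr (1 / p) * ((M / 2) powr (- r * \<gamma>) * I powr \<gamma>)" .
    have "((M / 2) powr \<alpha>) powr p \<le> (C3 * K powr (1 / p) * ((M / 2) powr (- r * \<gamma>) * I powr \<gamma>)) powr p"
      using p by (intro powr_mono2 main) auto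
    also have "\<dots> = C3 powr p * K * ((M / 2) powr (- (q - p)) * I powr (\<gamma> * p))"
      using C3 K M I p by (simp add: powr_mult powr_powr e2)
    also have "((M / 2) powr \<alpha>) powr p = (M / 2) powr (p - 1)" using p by (simp add: powr_powr \<alpha>_def left_diff_distrib)
    \<comment> \<open>Multiplying by (M/2)^{q-p} removes the negative power on the right and
      completes p - 1 to q - 1 on the left.\<close>
    finally have "(M / 2) powr (q - p) * (M / 2) powr (p - 1)
      \<le> (M / 2) powr (q - p) * (C3 powr p * K * ((M / 2) powr (- (q - p)) * I powr (\<gamma> * p)))"
      by (intro mult_left_mono) auto
    also have "\<dots> = C3 powr p * K * I powr (\<gamma> * p) * ((M / 2) powr (q - p) * (M / 2) powr (- (q - p)))"
      by (simp only: mult_ac)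
    also have "(M / 2) powr (q - p) * (M / 2) powr (- (q - p)) = 1" using M by (simp add: powr_add[symmetric])
    also have "(M / 2) powr (q - p) * (M / 2) powr (p - 1) = (M / 2) powr (q - 1)" by (simp add: powr_add[symmetric])
    finally have fin: "(M / 2) powr (q - 1) \<le> C3 powr p * K * I powr (\<gamma> * p)" by simp
    have "M powr (q - 1) = 2 powr (q - 1) * (M / 2) powr (q - 1)" using M by (simp add: powr_divide)
    also have "\<dots> \<le> 2 powr (q - 1) * (C3 powr p * K * I powr (\<gamma> * p))" by (intro mult_left_mono fin) auto
    also have "I powr (\<gamma> * p) = Lp_norm \<Omega> r u powr (q - p)"
      using r by (simp add: U powr_powr e2[symmetric])
    finally show ?thesis by (simp add: C_def mult_ac)
  qed
  then show ?thesis using C unfolding q_def r_def N_def by blast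
qed

end

text \<open>For \<mu> < 1 the numerator of B exceeds its denominator N (p - 1) / (N - p) by p (1 -
  \<mu>) / (N - p) > 0; otherwise B is 1. Thus the exponent produced by the iteration is at most the
  one that is claimed.\<close>

lemma hardy_sobolev_exponents:
  assumes "1 < p" "p < N" "0 < \<mu>" "\<mu> < p"
  shows "hardy_sobolev_exp N p \<mu> > p" "B_exp N p \<mu> \<ge> 1"
proof -
  show "hardy_sobolev_exp N p \<mu> > p" using assms by (simp add: hardy_sobolev_exp_def field_simps)
  show "B_exp N p \<mu> \<ge> 1"
  proof (cases "\<mu> < 1")
    case True
    have "sobolev_exp N p * (1 - 1 / p) = N * (p - 1) / (N - p)"
      using assms by (simp add: sobolev_exp_def field_simps)
    moreover have "hardy_sobolev_exp N p \<mu> - 1 = N * (p - 1) / (N - p) + p * (1 - \<mu>) / (N - p)"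
    proof -
      have "hardy_sobolev_exp N p \<mu> - 1 = (p * (N - \<mu>) - (N - p)) / (N - p)"
        using assms by (simp add: hardy_sobolev_exp_def diff_divide_distrib)
      also have "p * (N - \<mu>) - (N - p) = N * (p - 1) + p * (1 - \<mu>)" by algebra
      finally show ?thesis by (simp only: add_divide_distrib)
    qed
    moreover have "N * (p - 1) / (N - p) > 0" "p * (1 - \<mu>) / (N - p) > 0" using assms True by auto
    ultimately have "sobolev_exp N p * (1 - 1 / p) \<le> hardy_sobolev_exp N p \<mu> - 1"
      "0 < sobolev_exp N p * (1 - 1 / p)" by linarith+
    then show ?thesis using True by (simp only: B_exp_def if_True le_divide_eq_1_pos)
  qed (simp add: B_exp_def)
qed

theorem theorem1p4:
  fixes \<Omega> :: "(real ^ 'n) set" and N p \<mu> c0 :: real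
  assumes "N = real CARD('n)" and "1 < p" and "p < N"
    and "open \<Omega>" and "bounded \<Omega>" and "strictly_convex \<Omega>" and "has_C2_boundary \<Omega>"
    and "0 \<in> closure \<Omega>"
    and "0 < \<mu>" and "\<mu> < p" and "c0 > 0"
  shows "\<exists>C :: real \<Rightarrow> real. (\<forall>\<epsilon>>0. C \<epsilon> > 0) \<and>
    (\<forall>(f :: real ^ 'n \<Rightarrow> real \<Rightarrow> real) (ft :: real \<Rightarrow> real) (s0 :: real).
       caratheodory \<Omega> f \<and>
       (\<forall>x \<in> closure \<Omega> - {0}. \<forall>s. \<bar>f x s\<bar> \<le> norm x powr (- \<mu>) * ft s) \<and>
       continuous_on UNIV ft \<and> (\<forall>s. 0 \<le> ft s) \<and>
       0 \<le> s0 \<and> (\<forall>s. \<bar>s\<bar> > s0 \<longrightarrow> ft s > 0) \<and>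
       ((\<lambda>s. ft s / \<bar>s\<bar> powr (hardy_sobolev_exp N p \<mu> - 1)) \<longlongrightarrow> 0) at_infinity \<and>
       Limsup at_top (\<lambda>s. ereal ((SUP t\<in>{- s..s}. ft t) / max (ft (- s)) (ft s))) \<le> ereal c0
       \<longrightarrow>
       (\<exists>C0>0. \<forall>u. weak_solution \<Omega> p f u \<longrightarrow>
          Linf_norm \<Omega> u \<le> ereal C0 \<or>
          (ereal s0 < Linf_norm \<Omega> u \<and> Linf_norm \<Omega> u < \<infinity> \<and>
           (\<forall>\<epsilon>>0. h_fun N p \<mu> ft (real_of_ereal (Linf_norm \<Omega> u))
              \<le> C \<epsilon> * (1 + Lp_norm \<Omega> (sobolev_exp N p) u)
                   powr ((hardy_sobolev_exp N p \<mu> - p) * (B_exp N p \<mu> + \<epsilon>))))))"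
proof -
  note p = assms(2) and \<mu> = assms(9,10) and op = assms(4) and bd = assms(5)
  have N: "N = real DIM(real ^ 'n)" using assms(1) by simp
  have pN: "p < real DIM(real ^ 'n)" using assms(3) N by simp
  interpret subcritical_domain \<Omega> p by unfold_locales (use op bd p pN in auto)
  note ex = hardy_sobolev_exponents[OF p assms(3) \<mu>]
  let ?q = "hardy_sobolev_exp N p \<mu>" and ?r = "sobolev_exp N p"
  obtain C where C: "C > 0" "\<And>f u K M. weak_solution \<Omega> p f u \<Longrightarrow> K \<ge> 0 \<Longrightarrow>
    (AE x in lebesgue_on \<Omega>. \<bar>f x (u x)\<bar> \<le> K * norm x powr (- \<mu>)) \<Longrightarrow> M > 0 \<Longrightarrow> Linf_norm \<Omega> u = ereal M \<Longrightarrow>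
    M powr (?q - 1) \<le> C * K * Lp_norm \<Omega> ?r u powr (?q - p)"
    using sup_bound_by_critical_norm[OF \<mu>] unfolding N by blast
  \<comment> \<open>The factor c0 + 1 bounds the quotient in (H1) at large arguments; any number
    above c0 would serve. It does not vary with \<epsilon>, so the witness below is a constant
    function.\<close>
  define C' where "C' = C * (c0 + 1)"
  have C': "C' > 0" using C(1) assms(11) by (simp add: C'_def)
  show ?thesis
  proof (rule exI[of _ "\<lambda>\<epsilon>. C'"], intro conjI allI impI)
    show "0 < C'" by (rule C')
    fix f :: "real ^ 'n \<Rightarrow> real \<Rightarrow> real" and ft :: "real \<Rightarrow> real" and s0 :: real
    assume H: "caratheodory \<Omega> f \<and>
       (\<forall>x \<in> closure \<Omega> - {0}. \<forall>s. \<bar>f x s\<bar> \<le> norm x powr (- \<mu>) * ft s) \<and>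
       continuous_on UNIV ft \<and> (\<forall>s. 0 \<le> ft s) \<and>
       0 \<le> s0 \<and> (\<forall>s. \<bar>s\<bar> > s0 \<longrightarrow> ft s > 0) \<and>
       ((\<lambda>s. ft s / \<bar>s\<bar> powr (?q - 1)) \<longlongrightarrow> 0) at_infinity \<and>
       Limsup at_top (\<lambda>s. ereal ((SUP t\<in>{- s..s}. ft t) / max (ft (- s)) (ft s))) \<le> ereal c0"
    then have f: "\<And>x s. x \<in> \<Omega> \<Longrightarrow> x \<noteq> 0 \<Longrightarrow> \<bar>f x s\<bar> \<le> norm x powr (- \<mu>) * ft s"
      and ft: "continuous_on UNIV ft" "\<And>s. 0 \<le> ft s" and s0: "0 \<le> s0" and ftpos: "\<And>s. \<bar>s\<bar> > s0 \<Longrightarrow> ft s > 0"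
      and lim: "((\<lambda>s. ft s / \<bar>s\<bar> powr (?q - 1)) \<longlongrightarrow> 0) at_infinity"
      and ls: "Limsup at_top (\<lambda>s. ereal ((SUP t\<in>{- s..s}. ft t) / max (ft (- s)) (ft s))) \<le> ereal c0"
      using closure_subset by (blast, blast, blast, blast, blast, blast, blast)
    have "\<forall>\<^sub>F s in at_top. (SUP t\<in>{- s..s}. ft t) / max (ft (- s)) (ft s) < c0 + 1"
      by (rule eventually_less_of_Limsup_le[OF ls]) simp
    then obtain s1 where s1: "\<And>s. s \<ge> s1 \<Longrightarrow> (SUP t\<in>{- s..s}. ft t) / max (ft (- s)) (ft s) < c0 + 1"
      unfolding eventually_at_top_linorder by blast
    \<comment> \<open>Beyond s0 the denominator of \<open>h_fun\<close> is positive, and from s1 on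
      the quotient in (H1) is below c0 + 1. Both thresholds are independent of u.\<close>
    define C0 where "C0 = max (s0 + 1) s1"
    have C0: "C0 > 0" "C0 > s0" "C0 \<ge> s1" using s0 by (auto simp: C0_def)
    show "\<exists>C0>0. \<forall>u. weak_solution \<Omega> p f u \<longrightarrow>
          Linf_norm \<Omega> u \<le> ereal C0 \<or>
          (ereal s0 < Linf_norm \<Omega> u \<and> Linf_norm \<Omega> u < \<infinity> \<and>
           (\<forall>\<epsilon>>0. h_fun N p \<mu> ft (real_of_ereal (Linf_norm \<Omega> u))
              \<le> C' * (1 + Lp_norm \<Omega> ?r u) powr ((?q - p) * (B_exp N p \<mu> + \<epsilon>))))"
    proof (intro exI[of _ C0] conjI allI impI C0(1))
      fix u assume ws: "weak_solution \<Omega> p f u"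
      show "Linf_norm \<Omega> u \<le> ereal C0 \<or>
          (ereal s0 < Linf_norm \<Omega> u \<and> Linf_norm \<Omega> u < \<infinity> \<and>
           (\<forall>\<epsilon>>0. h_fun N p \<mu> ft (real_of_ereal (Linf_norm \<Omega> u))
              \<le> C' * (1 + Lp_norm \<Omega> ?r u) powr ((?q - p) * (B_exp N p \<mu> + \<epsilon>))))"
      proof (rule disj_imp[THEN iffD2], rule impI)
        assume "\<not> Linf_norm \<Omega> u \<le> ereal C0"
        then have gt: "ereal C0 < Linf_norm \<Omega> u" by simp
        have fin: "Linf_norm \<Omega> u < \<infinity>"
          by (rule weak_solution_bounded[OF \<mu> ws f lim[unfolded N]])
        then obtain M where M: "Linf_norm \<Omega> u = ereal M" using gt by (cases "Linf_norm \<Omega> u") auto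
        have MC: "M > C0" using gt M by simp
        have M0: "M > 0" "M > s0" "M \<ge> s1" using MC C0 by auto
        define K where "K = (SUP t\<in>{- M..M}. ft t)"
        have bddK: "bdd_above (ft ` {- M..M})"
          using compact_imp_bounded[OF compact_continuous_image[OF continuous_on_subset[OF ft(1)]]]
          by (intro bounded_imp_bdd_above) auto
        have Kub: "ft t \<le> K" if "\<bar>t\<bar> \<le> M" for t
          unfolding K_def using that by (intro cSUP_upper bddK) auto
        define m where "m = max (ft (- M)) (ft M)"
        have m: "m > 0" using ftpos[of M] M0 s0 by (auto simp: m_def less_max_iff_disj)
        have K: "K \<ge> 0" using Kub[of 0] ft(2)[of 0] M0 by simp
        \<comment> \<open>(H1) at s = M compares the maximum over the whole range of u with the end
          values that occur in \<open>h_fun\<close>.\<close>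
        have Km: "K \<le> (c0 + 1) * m"
          using s1[OF M0(3)] m by (simp add: K_def[symmetric] m_def[symmetric] pos_divide_less_eq)
        note um = weak_solutionD(2)[OF ws]
        have "AE x in lebesgue_on \<Omega>. \<bar>u x\<bar> \<le> M"
          using esssup_AE[of "\<lambda>x. ereal \<bar>u x\<bar>" "lebesgue_on \<Omega>"] M unfolding Linf_norm_def by simp
        moreover have "AE x in lebesgue_on \<Omega>. x \<noteq> 0"
          using AE_completion[OF AE_lborel_singleton[of 0]] op
          by (simp add: AE_restrict_space_iff) (auto elim: eventually_mono)
        ultimately have "AE x in lebesgue_on \<Omega>. \<bar>f x (u x)\<bar> \<le> K * norm x powr (- \<mu>)"
          using AE_space
        proof eventually_elim
          case (elim x)
          then have "\<bar>f x (u x)\<bar> \<le> norm x powr (- \<mu>) * ft (u x)" using f by (simp add: space_restrict_space)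
          also have "\<dots> \<le> norm x powr (- \<mu>) * K" by (intro mult_left_mono Kub elim) auto
          finally show ?case by (simp add: mult.commute)
        qed
        from C(2)[OF ws K this M0(1) M]
        have est: "M powr (?q - 1) \<le> C * K * Lp_norm \<Omega> ?r u powr (?q - p)" .
        have "h_fun N p \<mu> ft M \<le> C' * (1 + Lp_norm \<Omega> ?r u) powr ((?q - p) * (B_exp N p \<mu> + \<epsilon>))" if "\<epsilon> > 0" for \<epsilon>
        proof -
          define U where "U = Lp_norm \<Omega> ?r u"
          have U: "U \<ge> 0" by (simp add: U_def Lp_norm_def)
          have "h_fun N p \<mu> ft M = M powr (?q - 1) / m" using M0 by (simp add: h_fun_def m_def)
          also have "\<dots> \<le> C * K * U powr (?q - p) / m"
            using est m by (intro divide_right_mono) (auto simp: U_def)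
          also have "\<dots> \<le> C * ((c0 + 1) * m) * U powr (?q - p) / m"
            using Km C(1) m by (intro divide_right_mono mult_right_mono mult_left_mono) auto
          also have "\<dots> = C' * U powr (?q - p)" using m by (simp add: C'_def)
          \<comment> \<open>U may be less than 1. Passing to the base 1 + U makes the enlargement of
            the exponent in the next step monotone.\<close>
          also have "\<dots> \<le> C' * (1 + U) powr (?q - p)"
            using C' U ex by (intro mult_left_mono powr_mono2) auto
          also have "\<dots> \<le> C' * (1 + U) powr ((?q - p) * (B_exp N p \<mu> + \<epsilon>))"
          proof -
            have "(?q - p) * 1 \<le> (?q - p) * (B_exp N p \<mu> + \<epsilon>)" using ex that by (intro mult_left_mono) auto
            then show ?thesis using C' U by (intro mult_left_mono powr_mono) auto
          qed
          finally show ?thesis by (simp add: U_def)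
        qed
        then show "ereal s0 < Linf_norm \<Omega> u \<and> Linf_norm \<Omega> u < \<infinity> \<and>
           (\<forall>\<epsilon>>0. h_fun N p \<mu> ft (real_of_ereal (Linf_norm \<Omega> u))
              \<le> C' * (1 + Lp_norm \<Omega> ?r u) powr ((?q - p) * (B_exp N p \<mu> + \<epsilon>)))"
          using M M0 fin by simp
      qed
    qed
  qed
qed

end
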